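(* Let $\square$ be the complex Laplacian on a Kähler manifold, $\square f=f_{/j\bar j}=g^{i\bar j}\partial_i\partial_{\bar j}f$ for any smooth function $f$, and let $k\ge0$ be an integer. Then, at the center of a Kähler normal coordinate system, $$\square^k=\sum_{\Gamma:\ w(\Gamma)=k}(-1)^{|V(\Gamma)|-1}\,\frac{\varphi(\Gamma)}{|\mathrm{Aut}(\Gamma)|}\;\Gamma,$$ as differential operators acting on smooth functions, where $\Gamma$ runs over all (isomorphism classes of) strongly connected stable pointed graphs of weight $k$ and, in the exponent, $V(\Gamma)$ denotes the set of all vertices of $\Gamma$ including the distinguished vertex $\bullet$.
   Context: Normal coordinates. Let $d$ be the complex dimension; repeated indices are summed from $1$ to $d$. $(g_{i\bar j})$ is the Kähler metric and $(g^{i\bar j})$ its inverse. Kähler normal coordinates centered at $x$ are holomorphic coordinates in which $g_{i\bar j}(x)=\delta_{ij}$ and $g_{i\bar jk_1\cdots k_r}(x)=g_{i\bar j\bar l_1\cdots\bar l_r}(x)=0$ for all $1\le r\le N$, where $N$ is chosen sufficiently large; here $g_{i\bar j\alpha_1\cdots\alpha_m}=\partial_{\alpha_1}\cdots\partial_{\alpha_m}g_{i\bar j}$. Pointed graphs. A pointed graph $\Gamma$ is a finite directed graph, with multiple edges and loops allowed, with a distinguished vertex $\bullet$; the other vertices are called ordinary. $\deg^+(v)$, $\deg^-(v)$ are the numbers of outward and inward edges at $v$ (a loop contributes one to each). $\Gamma$ is stable if every ordinary vertex $v$ satisfies $\deg^+(v)\ge2$ and $\deg^-(v)\ge2$. The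 weight $w(\Gamma)$ is the number of edges minus the number of ordinary vertices. $\Gamma$ is strongly connected if there is a directed path from each vertex to every other vertex. $\mathrm{Aut}(\Gamma)$ is the group of automorphisms of the multi-digraph fixing $\bullet$, i.e. pairs of bijections of the vertex set and of the edge set compatible with sources and targets (so permutations of parallel edges and of loops are counted). Pointed graphs as operators. A stable pointed graph represents a differential operator $f\mapsto\Gamma f$, evaluated at the center: each ordinary vertex $v$ represents a partial derivative of $g_{i\bar j}$ with $\deg^+(v)$ unbarred and $\deg^-(v)$ barred indices (outward half-edges correspond to unbarred, inward to barred indices), the vertex $\bullet$ represents the partial derivative of $f$ with $\deg^+(\bullet)$ unbarred and $\deg^-(\bullet)$ barred indices, and each edge represents the contraction of the corresponding unbarred and barred indices. For example $\bullet$ with one loop represents $f\mapsto\sum_i\partial_i\partial_{\bar i}f$. The invariant $\varphi(\Gamma)$ of a pointed graph is defined recursively: (i) if $\Gamma$ is not strongly connected, $\varphi(\Gamma)=0$; (ii) if $\Gamma$ consists only of $\bullet$ with $l\ge0$ loops, $\varphi(\Gamma)=l!$; (iii) if $\Gamma$ is strongly connected and there is an ordinary vertex $v$ with $\deg^+(v)=\deg^-(v)=1$, then $\varphi(\Gamma)=\varphi(\Gamma/\{v\})$, where $\Gamma/\{v\}$ is obtained by smoothing out $v$ (removing $v$ and replacing its inward edge $uv$ and outward edge $vu'$ by one edge $uu'$); (iv) for any other strongly connected $\Gamma$, $\varphi(\Gamma)=\sum_{e\in E(\Gamma)}\varphi(\Gamma-\{e\})$, where $\Gamma-\{e\}$ is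 $\Gamma$ with the edge $e$ deleted and its endpoints kept. *)

theory Defs
  imports "HOL-Analysis.Analysis" "Graph_Theory.Digraph_Component"
begin

section \<open>Smooth functions and Wirtinger derivatives\<close>

text \<open>\<open>C_on n S\<close> is the class \<open>C\<^sup>n\<close> in the real sense; it is only meant for open \<open>S\<close> in a
  finite-dimensional space.\<close>

primrec C_on :: "nat \<Rightarrow> 'a::real_normed_vector set \<Rightarrow> ('a \<Rightarrow> 'b::real_normed_vector) \<Rightarrow> bool" where
  "C_on 0 S f \<longleftrightarrow> continuous_on S f"
| "C_on (Suc n) S f \<longleftrightarrow>
     (\<forall>z\<in>S. f differentiable (at z)) \<and> (\<forall>v. C_on n S (\<lambda>z. frechet_derivative f (at z) v))"

definition smooth_on :: "'a::real_normed_vector set \<Rightarrow> ('a \<Rightarrow> 'b::real_normed_vector) \<Rightarrow> bool" where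
  "smooth_on S f \<longleftrightarrow> (\<forall>n. C_on n S f)"

datatype 'd index = Unbar 'd | Bar 'd

fun wirtinger :: "'d::finite index \<Rightarrow> (complex^'d \<Rightarrow> complex) \<Rightarrow> complex^'d \<Rightarrow> complex" where
  "wirtinger (Unbar i) f z =
     (frechet_derivative f (at z) (axis i 1) - \<i> * frechet_derivative f (at z) (axis i \<i>)) / 2"
| "wirtinger (Bar i) f z =
     (frechet_derivative f (at z) (axis i 1) + \<i> * frechet_derivative f (at z) (axis i \<i>)) / 2"

definition partials :: "'d::finite index list \<Rightarrow> (complex^'d \<Rightarrow> complex) \<Rightarrow> complex^'d \<Rightarrow> complex" where
  "partials \<alpha>s f = foldr wirtinger \<alpha>s f"

definition holomorphic_map_on :: "(complex^'d) set \<Rightarrow> (complex^'d \<Rightarrow> complex^'e) \<Rightarrow> bool" where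
  "holomorphic_map_on S F \<longleftrightarrow>
     (\<forall>z\<in>S. \<exists>D. (F has_derivative D) (at z) \<and> (\<forall>c v. D (c *s v) = c *s D v))"


section \<open>Kaehler manifolds\<close>

text \<open>The manifold is the whole type \<open>'m\<close>, of complex dimension \<open>CARD('d)\<close>. A chart is a pair of
  its domain and its coordinate map; the values of the map off the domain are irrelevant.\<close>

type_synonym ('m, 'd) chart = "'m set \<times> ('m \<Rightarrow> complex^'d)"

abbreviation chart_dom :: "('m, 'd) chart \<Rightarrow> 'm set" where
  "chart_dom c \<equiv> fst c"

abbreviation chart_map :: "('m, 'd) chart \<Rightarrow> 'm \<Rightarrow> complex^'d" where
  "chart_map c \<equiv> snd c"

abbreviation chart_inv :: "('m, 'd) chart \<Rightarrow> complex^'d \<Rightarrow> 'm" where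
  "chart_inv c \<equiv> inv_into (fst c) (snd c)"

locale complex_manifold =
  fixes \<A> :: "('m::{t2_space, second_countable_topology}, 'd::finite) chart set"
  assumes chart: "c \<in> \<A> \<Longrightarrow> open (chart_dom c) \<and> open (chart_map c ` chart_dom c) \<and>
      homeomorphism (chart_dom c) (chart_map c ` chart_dom c) (chart_map c) (chart_inv c)"
    and cover: "(\<Union>c\<in>\<A>. chart_dom c) = UNIV"
    and transition: "c \<in> \<A> \<Longrightarrow> c' \<in> \<A> \<Longrightarrow>
      holomorphic_map_on (chart_map c ` (chart_dom c \<inter> chart_dom c')) (chart_map c' \<circ> chart_inv c)"

text \<open>\<open>g c p $ i $ j\<close> is the component \<open>g\<^bsub>i j\<^esub>\<close> (first index unbarred, second barred) of the
  metric at the point \<open>p\<close>, in the chart \<open>c\<close>; \<open>metric_comp\<close> is that component as a function of the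
  coordinates.\<close>

type_synonym ('m, 'd) metric = "('m, 'd) chart \<Rightarrow> 'm \<Rightarrow> complex^'d^'d"

definition metric_comp ::
    "('m, 'd::finite) metric \<Rightarrow> ('m, 'd) chart \<Rightarrow> 'd \<Rightarrow> 'd \<Rightarrow> complex^'d \<Rightarrow> complex" where
  "metric_comp g c i j z = g c (chart_inv c z) $ i $ j"

locale kahler_manifold = complex_manifold \<A>
  for \<A> :: "('m::{t2_space, second_countable_topology}, 'd::finite) chart set" +
  fixes g :: "('m, 'd) metric"
  assumes tensor: "c \<in> \<A> \<Longrightarrow> c' \<in> \<A> \<Longrightarrow> p \<in> chart_dom c \<inter> chart_dom c' \<Longrightarrow>
      g c p $ i $ j = (\<Sum>a\<in>UNIV. \<Sum>b\<in>UNIV.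
        wirtinger (Unbar i) (\<lambda>z. chart_map c' (chart_inv c z) $ a) (chart_map c p) *
        cnj (wirtinger (Unbar j) (\<lambda>z. chart_map c' (chart_inv c z) $ b) (chart_map c p)) *
        g c' p $ a $ b)"
    and smooth: "c \<in> \<A> \<Longrightarrow> smooth_on (chart_map c ` chart_dom c) (metric_comp g c i j)"
    and hermitian: "c \<in> \<A> \<Longrightarrow> p \<in> chart_dom c \<Longrightarrow> g c p $ i $ j = cnj (g c p $ j $ i)"
    and positive: "c \<in> \<A> \<Longrightarrow> p \<in> chart_dom c \<Longrightarrow> v \<noteq> 0 \<Longrightarrow>
      0 < Re (\<Sum>i\<in>UNIV. \<Sum>j\<in>UNIV. g c p $ i $ j * v $ i * cnj (v $ j))"
    and kahler: "c \<in> \<A> \<Longrightarrow> z \<in> chart_map c ` chart_dom c \<Longrightarrow>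
      wirtinger (Unbar l) (metric_comp g c i j) z = wirtinger (Unbar i) (metric_comp g c l j) z"

definition smooth_function ::
    "('m, 'd::finite) chart set \<Rightarrow> ('m \<Rightarrow> complex) \<Rightarrow> bool" where
  "smooth_function \<A> f \<longleftrightarrow> (\<forall>c\<in>\<A>. smooth_on (chart_map c ` chart_dom c) (f \<circ> chart_inv c))"

text \<open>The inverse metric satisfies \<open>\<Sum>\<^sub>j g\<^sup>i\<^sup>j g\<^sub>k\<^sub>j = \<delta>\<^sub>i\<^sub>k\<close> (\<open>j\<close> barred), so it is the transpose of the
  inverse matrix. The chart chosen for the definition of the Laplacian at \<open>p\<close> does not matter on a
  Kaehler manifold.\<close>

definition laplacian_in :: "('m, 'd::finite) metric \<Rightarrow> ('m, 'd) chart \<Rightarrow> ('m \<Rightarrow> complex) \<Rightarrow> 'm \<Rightarrow> complex"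
  where "laplacian_in g c f p = (\<Sum>i\<in>UNIV. \<Sum>j\<in>UNIV.
     matrix_inv (g c p) $ j $ i * partials [Unbar i, Bar j] (f \<circ> chart_inv c) (chart_map c p))"

definition laplacian ::
    "('m, 'd::finite) chart set \<Rightarrow> ('m, 'd) metric \<Rightarrow> ('m \<Rightarrow> complex) \<Rightarrow> 'm \<Rightarrow> complex" where
  "laplacian \<A> g f p = laplacian_in g (SOME c. c \<in> \<A> \<and> p \<in> chart_dom c) f p"

definition normal_coordinates ::
    "nat \<Rightarrow> ('m, 'd::finite) chart set \<Rightarrow> ('m, 'd) metric \<Rightarrow> ('m, 'd) chart \<Rightarrow> 'm \<Rightarrow> bool" where
  "normal_coordinates N \<A> g c x \<longleftrightarrow>
     c \<in> \<A> \<and> x \<in> chart_dom c \<and> chart_map c x = 0 \<and>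
     (\<forall>i j. metric_comp g c i j 0 = (if i = j then 1 else 0)) \<and>
     (\<forall>i j ks. 1 \<le> length ks \<and> length ks \<le> N \<longrightarrow>
        partials (map Unbar ks) (metric_comp g c i j) 0 = 0 \<and>
        partials (map Bar ks) (metric_comp g c i j) 0 = 0)"


section \<open>Pointed graphs\<close>

text \<open>A pointed graph is a multi-digraph with its distinguished vertex. For isomorphism classes it is
  enough to take vertices and edges from the natural numbers.\<close>

type_synonym pgraph = "(nat, nat) pre_digraph \<times> nat"

definition pointed_graph :: "pgraph \<Rightarrow> bool" where
  "pointed_graph \<Gamma> \<longleftrightarrow> fin_digraph (fst \<Gamma>) \<and> snd \<Gamma> \<in> verts (fst \<Gamma>)"

definition ordinary :: "pgraph \<Rightarrow> nat set" where
  "ordinary \<Gamma> = verts (fst \<Gamma>) - {snd \<Gamma>}"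

definition stable :: "pgraph \<Rightarrow> bool" where
  "stable \<Gamma> \<longleftrightarrow> (\<forall>v\<in>ordinary \<Gamma>. out_degree (fst \<Gamma>) v \<ge> 2 \<and> in_degree (fst \<Gamma>) v \<ge> 2)"

definition weight :: "pgraph \<Rightarrow> int" where
  "weight \<Gamma> = int (card (arcs (fst \<Gamma>))) - int (card (ordinary \<Gamma>))"

text \<open>Extensionality makes each isomorphism a unique pair of functions, so that \<open>aut\<close> can be
  counted.\<close>

definition isos :: "pgraph \<Rightarrow> pgraph \<Rightarrow> ((nat \<Rightarrow> nat) \<times> (nat \<Rightarrow> nat)) set" where
  "isos \<Gamma> \<Delta> = {(\<pi>, \<sigma>).
     \<pi> \<in> extensional (verts (fst \<Gamma>)) \<and> bij_betw \<pi> (verts (fst \<Gamma>)) (verts (fst \<Delta>)) \<and>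
     \<sigma> \<in> extensional (arcs (fst \<Gamma>)) \<and> bij_betw \<sigma> (arcs (fst \<Gamma>)) (arcs (fst \<Delta>)) \<and>
     \<pi> (snd \<Gamma>) = snd \<Delta> \<and>
     (\<forall>e\<in>arcs (fst \<Gamma>). tail (fst \<Delta>) (\<sigma> e) = \<pi> (tail (fst \<Gamma>) e) \<and>
                        head (fst \<Delta>) (\<sigma> e) = \<pi> (head (fst \<Gamma>) e))}"

abbreviation aut :: "pgraph \<Rightarrow> ((nat \<Rightarrow> nat) \<times> (nat \<Rightarrow> nat)) set" where
  "aut \<Gamma> \<equiv> isos \<Gamma> \<Gamma>"

definition sc_stable_graphs :: "nat \<Rightarrow> pgraph set" where
  "sc_stable_graphs k = {\<Gamma>. pointed_graph \<Gamma> \<and> strongly_connected (fst \<Gamma>) \<and> stable \<Gamma> \<and> weight \<Gamma> = int k}"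

definition sc_stable_classes :: "nat \<Rightarrow> pgraph set set" where
  "sc_stable_classes k = sc_stable_graphs k //
     {(\<Gamma>, \<Delta>). \<Gamma> \<in> sc_stable_graphs k \<and> \<Delta> \<in> sc_stable_graphs k \<and> isos \<Gamma> \<Delta> \<noteq> {}}"

text \<open>Smoothing out a vertex \<open>v\<close> with one inward and one outward edge: the inward edge is redirected
  to the head of the outward edge, which is deleted together with \<open>v\<close>.\<close>

definition smooth_out :: "(nat, nat) pre_digraph \<Rightarrow> nat \<Rightarrow> (nat, nat) pre_digraph" where
  "smooth_out G v = (let e = the_elem (in_arcs G v); e' = the_elem (out_arcs G v) in
     \<lparr>verts = verts G - {v}, arcs = arcs G - {e'}, tail = tail G, head = (head G)(e := head G e')\<rparr>)"

definition smoothable :: "pgraph \<Rightarrow> nat \<Rightarrow> bool" where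
  "smoothable \<Gamma> v \<longleftrightarrow> v \<in> ordinary \<Gamma> \<and> out_degree (fst \<Gamma>) v = 1 \<and> in_degree (fst \<Gamma>) v = 1"

text \<open>The value does not depend on which smoothable vertex is chosen. On pairs that are not pointed
  graphs the function is set to \<open>0\<close>.\<close>

function phi :: "pgraph \<Rightarrow> nat" where
  "phi \<Gamma> =
    (if \<not> pointed_graph \<Gamma> then 0
     else if \<not> strongly_connected (fst \<Gamma>) then 0
     else if ordinary \<Gamma> = {} then fact (card (arcs (fst \<Gamma>)))
     else if \<exists>v. smoothable \<Gamma> v then phi (smooth_out (fst \<Gamma>) (SOME v. smoothable \<Gamma> v), snd \<Gamma>)
     else (\<Sum>e\<in>arcs (fst \<Gamma>). phi (pre_digraph.del_arc (fst \<Gamma>) e, snd \<Gamma>)))"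
  by pat_completeness auto

termination
proof (relation "Wellfounded.measure (\<lambda>\<Gamma>. card (arcs (fst \<Gamma>)))", goal_cases)
  case 1
  show ?case by simp
next
  case (2 \<Gamma>)
  define v where "v = (SOME v. smoothable \<Gamma> v)"
  have "smoothable \<Gamma> v"
    unfolding v_def using 2(4) by (rule someI_ex)
  then have "card (out_arcs (fst \<Gamma>) v) = 1"
    by (simp add: smoothable_def out_degree_def)
  then obtain e' where e': "out_arcs (fst \<Gamma>) v = {e'}"
    by (auto simp: card_1_singleton_iff)
  then have "e' \<in> arcs (fst \<Gamma>)"
    by (auto simp: out_arcs_def)
  moreover have "finite (arcs (fst \<Gamma>))"
    using 2(1) by (simp add: pointed_graph_def fin_digraph.finite_arcs)
  ultimately show ?case
    unfolding v_def[symmetric]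
    by (simp add: smooth_out_def Let_def e' card_Diff1_less del: card_Diff_insert)
next
  case (3 \<Gamma> e)
  then have "finite (arcs (fst \<Gamma>))"
    by (simp add: pointed_graph_def fin_digraph.finite_arcs)
  with 3 show ?case
    by (simp add: pre_digraph.del_arc_def card_Diff1_less del: card_Diff_insert)
qed

declare phi.simps [simp del]


section \<open>Pointed graphs as differential operators\<close>

text \<open>An assignment \<open>\<iota>\<close> gives every edge the common value of the two indices it contracts (the metric
  at the center is the identity). At a vertex, \<open>out_indices\<close> are the unbarred and \<open>in_indices\<close> the
  barred indices; partial derivatives commute, so the order in the lists is immaterial.\<close>

definition out_indices :: "pgraph \<Rightarrow> (nat \<Rightarrow> 'd) \<Rightarrow> nat \<Rightarrow> 'd list" where
  "out_indices \<Gamma> \<iota> v = map \<iota> (sorted_list_of_set (out_arcs (fst \<Gamma>) v))"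

definition in_indices :: "pgraph \<Rightarrow> (nat \<Rightarrow> 'd) \<Rightarrow> nat \<Rightarrow> 'd list" where
  "in_indices \<Gamma> \<iota> v = map \<iota> (sorted_list_of_set (in_arcs (fst \<Gamma>) v))"

text \<open>One unbarred and one barred index of an ordinary vertex serve as the indices of the metric, the
  others as derivatives. By the Kaehler condition it does not matter which ones.\<close>

definition vertex_factor ::
    "('m, 'd::finite) metric \<Rightarrow> ('m, 'd) chart \<Rightarrow> complex^'d \<Rightarrow> 'd list \<Rightarrow> 'd list \<Rightarrow> complex" where
  "vertex_factor g c z is js =
     partials (map Unbar (tl is) @ map Bar (tl js)) (metric_comp g c (hd is) (hd js)) z"

definition graph_operator ::
    "('m, 'd::finite) metric \<Rightarrow> ('m, 'd) chart \<Rightarrow> pgraph \<Rightarrow> ('m \<Rightarrow> complex) \<Rightarrow> 'm \<Rightarrow> complex" where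
  "graph_operator g c \<Gamma> f x = (\<Sum>\<iota> \<in> arcs (fst \<Gamma>) \<rightarrow>\<^sub>E UNIV.
     (\<Prod>v\<in>ordinary \<Gamma>. vertex_factor g c (chart_map c x) (out_indices \<Gamma> \<iota> v) (in_indices \<Gamma> \<iota> v)) *
     partials (map Unbar (out_indices \<Gamma> \<iota> (snd \<Gamma>)) @ map Bar (in_indices \<Gamma> \<iota> (snd \<Gamma>)))
       (f \<circ> chart_inv c) (chart_map c x))"

end

theory Submission
  imports Defs "HOL-Combinatorics.Multiset_Permutations" "HOL-Complex_Analysis.Cauchy_Integral_Formula"
begin

text \<open>Unfolding the recursion for \<open>\<phi>\<close> shows that \<open>\<phi>(\<Gamma>)\<close> counts the ear decompositions of \<open>\<Gamma>\<close> starting at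
  the distinguished vertex: if no vertex is smoothable, the last ear is a single edge, and smoothing a
  vertex does not change the ears otherwise. On the analytic side, expand the derivatives at the center
  of \<open>\<box>\<^sup>k f\<close> one metric factor at a time. The contraction index of each \<open>g\<^sup>i\<^sup>j \<partial>\<^sub>i \<partial>\<^sub>j\<close> runs along a path
  through the new factors of the metric, and the two derivatives at the ends of the path fall on factors
  created by the operators further inside, or on \<open>f\<close>. So every term is an ear decomposition of a
  pointed graph, whose vertices are stable because the pure derivatives of the metric vanish. Finally
  the automorphism group acts freely on the ear decompositions of \<open>\<Gamma>\<close>, so \<open>\<Gamma>\<close> arises from
  \<open>\<phi>(\<Gamma>) / |Aut(\<Gamma>)|\<close> terms.\<close>

section \<open>Ear decompositions\<close>

text \<open>The overview does not say how the inverse metric is expanded without differentiating it.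
  Let \<open>potential\<close> be the Hessian of a function, contracted with the inverse metric on
  one side only. Multiplied by the metric it returns the Hessian, so the Leibniz rule for this
  product is a linear equation for the derivatives of \<open>potential\<close> at the center. There
  the metric is the identity, terms with a pure derivative of the metric drop out, and the mixed
  terms are moved to the other side. This produces one sign for each ordinary vertex, and as every
  mixed term uses up a pending derivative, the recursion ends. Edges are numbered in the order in
  which the expansion creates them, so a term carries no names: two ear decompositions give the same
  term exactly if an isomorphism of pointed graphs carries one to the other. This turns the sum over
  terms into a weighted sum over isomorphism classes. The number of ears is the exponent of the
  Laplacian, hence the weight of the graph. Independence of the chart has to be proved too, because
  the Laplacian is defined through an arbitrary chart at each point.\<close>

text \<open>\<open>es\<close> lists the edges ear by ear, the ear that was attached last coming first, and \<open>vs\<close> the vertices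
  other than \<open>b\<close> in the order in which the ears pass through them. In \<open>open_ear\<close>, the ear being read
  starts with the edge \<open>a\<close>, and \<open>es\<close> begins with its current edge. Both ends of the ear have to lie on
  \<open>b\<close> and the ears further down the list, whereas its inner vertices have to be new.\<close>

inductive ears :: "('e \<Rightarrow> 'v) \<Rightarrow> ('e \<Rightarrow> 'v) \<Rightarrow> 'v \<Rightarrow> 'e list \<Rightarrow> 'v list \<Rightarrow> bool"
  and open_ear :: "('e \<Rightarrow> 'v) \<Rightarrow> ('e \<Rightarrow> 'v) \<Rightarrow> 'v \<Rightarrow> 'e \<Rightarrow> 'e list \<Rightarrow> 'v list \<Rightarrow> bool"
  for t h :: "'e \<Rightarrow> 'v" and b :: 'v
where
  Nil: "ears t h b [] []"
| Ear: "open_ear t h b e (e # es) vs \<Longrightarrow> ears t h b (e # es) vs"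
| Close: "h e \<in> insert b (set vs) \<Longrightarrow> t a \<in> insert b (set vs) \<Longrightarrow> ears t h b es vs \<Longrightarrow>
    open_ear t h b a (e # es) vs"
| Open: "h e = v \<Longrightarrow> t e' = v \<Longrightarrow> v \<notin> insert b (set vs) \<Longrightarrow> open_ear t h b a (e' # es) vs \<Longrightarrow>
    open_ear t h b a (e # e' # es) (v # vs)"

section \<open>Elementary properties of ear decompositions\<close>

lemma ears_heads:
  "ears t h b es vs \<Longrightarrow> insert b (h ` set es) = insert b (set vs)"
  "open_ear t h b a es vs \<Longrightarrow> insert b (h ` set es) = insert b (set vs)"
  by (induction rule: ears_open_ear.inducts) auto

text \<open>The second part leaves out the tail of the first edge in \<open>es\<close>: this is the
  current edge of an open ear, and its tail is either \<open>t a\<close> or an inner vertex already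
  read, which no longer occurs in \<open>vs\<close>.\<close>

lemma ears_tails:
  "ears t h b es vs \<Longrightarrow> t ` set es \<subseteq> insert b (set vs)"
  "open_ear t h b a es vs \<Longrightarrow> t a \<in> insert b (set vs) \<and> t ` set (tl es) \<subseteq> insert b (set vs)"
  by (induction rule: ears_open_ear.inducts) auto

text \<open>A vertex is listed when an edge enters it as an inner vertex of an ear, and no edge
  further down the list enters it again. So this edge is the last occurrence of its head, the one
  that \<open>remdups\<close> keeps, and the edge list determines the vertex list.\<close>

lemma ears_vertices:
  "ears t h b es vs \<Longrightarrow> vs = removeAll b (remdups (map h es))"
  "open_ear t h b a es vs \<Longrightarrow> vs = removeAll b (remdups (map h es))"
proof (induction rule: ears_open_ear.inducts)
  case (Close e vs a es)
  have "h e = b \<or> h e \<in> h ` set es" using Close(1) ears_heads(1)[OF Close(3)] by blast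
  then show ?case using Close(4) by auto
next
  case (Open e v e' vs a es)
  have "v \<notin> h ` set (e' # es)" "v \<noteq> b" using Open(3) ears_heads(2)[OF Open(4)] by blast+
  moreover have "vs = removeAll b (remdups (map h (e' # es)))" using Open(5) .
  ultimately show ?case using Open(1) by (simp del: list.map(2) add: list.map(2)[of h e])
qed auto

lemma ears_distinct:
  "ears t h b es vs \<Longrightarrow> distinct vs \<and> b \<notin> set vs"
  "open_ear t h b a es vs \<Longrightarrow> distinct vs \<and> b \<notin> set vs"
  by (induction rule: ears_open_ear.inducts) auto

lemma ears_trivial_iff: "ears t h b es [] \<longleftrightarrow> (\<forall>e\<in>set es. t e = b \<and> h e = b)"
proof (induction es)
  case Nil
  show ?case by (simp add: ears_open_ear.Nil)
next
  case (Cons e es)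
  have "ears t h b (e # es) [] \<longleftrightarrow> open_ear t h b e (e # es) []"
    by (subst ears.simps) auto
  also have "\<dots> \<longleftrightarrow> h e = b \<and> t e = b \<and> ears t h b es []"
    by (subst open_ear.simps) auto
  finally show ?case using Cons by auto
qed

text \<open>Injectivity of \<pi> keeps the inner vertices of an ear new. The lemma serves for
  isomorphisms as well as for a mere renumbering of the edges, where \<pi> is the identity.\<close>

lemma ears_map:
  "ears t h b es vs \<Longrightarrow> inj_on \<pi> (insert b (set vs)) \<Longrightarrow> 
    (\<And>e. e \<in> set es \<Longrightarrow> t' (\<sigma> e) = \<pi> (t e) \<and> h' (\<sigma> e) = \<pi> (h e)) \<Longrightarrow>
    ears t' h' (\<pi> b) (map \<sigma> es) (map \<pi> vs)"
  "open_ear t h b a es vs \<Longrightarrow> inj_on \<pi> (insert b (set vs)) \<Longrightarrow> t' (\<sigma> a) = \<pi> (t a) \<Longrightarrow>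
    (\<And>e. e \<in> set es \<Longrightarrow> t' (\<sigma> e) = \<pi> (t e) \<and> h' (\<sigma> e) = \<pi> (h e)) \<Longrightarrow>
    open_ear t' h' (\<pi> b) (\<sigma> a) (map \<sigma> es) (map \<pi> vs)"
proof (induction rule: ears_open_ear.inducts)
  case Nil
  then show ?case by (simp add: ears_open_ear.Nil)
next
  case (Ear e es vs)
  then show ?case by (auto intro!: ears_open_ear.Ear)
next
  case (Close e vs a es)
  then show ?case by (auto intro!: ears_open_ear.Close)
next
  case (Open e v e' vs a es)
  have inj: "inj_on \<pi> (insert b (set vs))" using Open.prems(1) by (auto simp: inj_on_def)
  have v: "\<pi> v \<notin> insert (\<pi> b) (set (map \<pi> vs))"
    using Open.prems(1) Open(3) by (auto simp: inj_on_def)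
  have o: "open_ear t' h' (\<pi> b) (\<sigma> a) (map \<sigma> (e' # es)) (map \<pi> vs)"
    by (rule Open(5)[OF inj Open.prems(2)]) (rule Open.prems(3), simp)
  have "h' (\<sigma> e) = \<pi> v" "t' (\<sigma> e') = \<pi> v"
    using Open.prems(3)[of e] Open.prems(3)[of e'] Open(1,2) by simp_all
  from ears_open_ear.Open[OF this v o[unfolded list.map]] show ?case
    unfolding list.map .
qed

section \<open>Smoothing and subdividing inside an ear decomposition\<close>

lemma ears_cong_head:
  assumes "\<And>x. x \<in> set es \<Longrightarrow> h' x = h x"
  shows "ears t h b es vs \<Longrightarrow> ears t h' b es vs"
    and "open_ear t h b a es vs \<Longrightarrow> open_ear t h' b a es vs"
proof -
  show "ears t h' b es vs" if "ears t h b es vs"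
    using ears_map(1)[OF that, of id t id h'] assms by auto
  show "open_ear t h' b a es vs" if "open_ear t h b a es vs"
    using ears_map(2)[OF that, of id t id h'] assms by auto
qed

text \<open>The rules for an open ear look at the head of the current edge but not at its tail, so
  the current edge may be exchanged for one with the same head.\<close>

lemma open_ear_replace_edge:
  assumes "open_ear t h b a (e' # es) vs" "h' e = h e'" "\<And>x. x \<in> set es \<Longrightarrow> h' x = h x"
  shows "open_ear t h' b a (e # es) vs"
  using assms(1)
proof (cases rule: open_ear.cases)
  case Close
  show ?thesis
    by (rule ears_open_ear.Close) (use Close assms(2) ears_cong_head(1)[OF assms(3) Close(3)] in auto)
next
  case (Open v e'' vs' es')
  have "open_ear t h' b a (e'' # es') vs'"
    by (rule ears_cong_head(2)[OF _ Open(6)]) (use Open(1) assms(3) in auto)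
  moreover have "h' e = v" using Open assms(2) by simp
  ultimately show ?thesis unfolding Open(1,2) using Open(4,5) ears_open_ear.Open[of h' e v t e'' b vs' a es'] by blast
qed

text \<open>Since \<open>e\<close> is the only edge into \<open>v\<close> and \<open>e'\<close> the
  only one out of it, the ear through \<open>v\<close> reads \<open>e\<close> and directly
  afterwards \<open>e'\<close>. Dropping \<open>e'\<close> and letting \<open>e\<close> end where
  \<open>e'\<close> ended removes the inner vertex \<open>v\<close> from that ear. For an open ear
  the tail of the current edge is exempt from the hypothesis, whereas \<open>a\<close>, whose tail
  is still to be checked, is included.\<close>

lemma ears_smooth:
  shows
  "ears t h b es vs \<Longrightarrow> distinct es \<Longrightarrow> v \<in> set vs \<Longrightarrow>
    (\<And>x. x \<in> set es \<Longrightarrow> (h x = v \<longleftrightarrow> x = e) \<and> (t x = v \<longleftrightarrow> x = e')) \<Longrightarrow>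
    \<exists>xs ys vs1 vs2. es = xs @ e # e' # ys \<and> vs = vs1 @ v # vs2 \<and>
      ears t (h(e := h e')) b (xs @ e # ys) (vs1 @ vs2)"
  "open_ear t h b a es vs \<Longrightarrow> distinct es \<Longrightarrow> a \<notin> set (tl es) \<Longrightarrow> v \<in> set vs \<Longrightarrow>
    (\<And>x. x \<in> insert a (set es) \<Longrightarrow> (h x = v \<longleftrightarrow> x = e)) \<Longrightarrow> 
    (\<And>x. x \<in> insert a (set (tl es)) \<Longrightarrow> (t x = v \<longleftrightarrow> x = e')) \<Longrightarrow>
    \<exists>xs ys vs1 vs2. es = xs @ e # e' # ys \<and> vs = vs1 @ v # vs2 \<and>
      open_ear t (h(e := h e')) b a (xs @ e # ys) (vs1 @ vs2)"
proof (induction rule: ears_open_ear.inducts)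
  case Nil
  then show ?case by simp
next
  case (Ear e1 es vs)
  obtain xs ys vs1 vs2 where *: "e1 # es = xs @ e # e' # ys" "vs = vs1 @ v # vs2"
    "open_ear t (h(e := h e')) b e1 (xs @ e # ys) (vs1 @ vs2)"
    using Ear.IH Ear.prems by (auto simp del: fun_upd_apply)
  obtain zs where zs: "xs @ e # ys = e1 # zs"
    using *(1) by (cases xs) auto
  have "ears t (h(e := h e')) b (xs @ e # ys) (vs1 @ vs2)"
    using *(3) unfolding zs by (rule ears_open_ear.Ear)
  then show ?case using *(1,2) by blast
next
  case (Close e1 vs a es)
  obtain xs ys vs1 vs2 where *: "es = xs @ e # e' # ys" "vs = vs1 @ v # vs2"
    "ears t (h(e := h e')) b (xs @ e # ys) (vs1 @ vs2)"
    using Close.IH Close.prems by (auto simp del: fun_upd_apply)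
  have 1: "e1 \<noteq> e" "h e1 \<noteq> v" using Close.prems *(1) by auto
  have 2: "t a \<noteq> v" using Close.prems *(1) by auto
  have "open_ear t (h(e := h e')) b a (e1 # xs @ e # ys) (vs1 @ vs2)"
    using *(3) 1 2 Close(1,2) *(2) by (intro ears_open_ear.Close) auto
  then show ?case using *(1,2) by - (rule exI[of _ "e1 # xs"], rule exI[of _ ys], rule exI[of _ vs1], rule exI[of _ vs2], simp del: fun_upd_apply)
next
  case (Open e1 v1 e2 vs a es)
  show ?case
  proof (cases "v1 = v")
    case True
    then have e: "e1 = e" "e2 = e'"
      using Open.prems(4)[of e1] Open.prems(5)[of e2] Open(1,2) by auto
    have "open_ear t (h(e := h e')) b a (e # es) vs"
      using Open.prems e by (intro open_ear_replace_edge[OF Open(4)]) auto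
    then show ?thesis using e True by - (rule exI[of _ "[]"], rule exI[of _ es], rule exI[of _ "[]"], rule exI[of _ vs], simp del: fun_upd_apply)
  next
    case False
    have "\<exists>xs ys vs1 vs2. e2 # es = xs @ e # e' # ys \<and> vs = vs1 @ v # vs2 \<and>
      open_ear t (h(e := h e')) b a (xs @ e # ys) (vs1 @ vs2)"
    proof (rule Open(5))
      fix x assume "x \<in> insert a (set (e2 # es))" 
      then show "(h x = v) = (x = e)" using Open.prems(4)[of x] by auto
    next
      fix x assume "x \<in> insert a (set (tl (e2 # es)))" 
      then show "(t x = v) = (x = e')" using Open.prems(5)[of x] by auto
    qed (use Open.prems False in auto)
    then obtain xs ys vs1 vs2 where *: "e2 # es = xs @ e # e' # ys" "vs = vs1 @ v # vs2"
      "open_ear t (h(e := h e')) b a (xs @ e # ys) (vs1 @ vs2)" by blast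
    obtain zs where zs: "xs @ e # ys = e2 # zs"
      using *(1) by (cases xs) auto
    have "e1 \<noteq> e" using False Open.prems(4)[of e1] Open(1) by auto
    then have "open_ear t (h(e := h e')) b a (e1 # xs @ e # ys) (v1 # vs1 @ vs2)"
      using *(3) Open(1-3) *(2) unfolding zs by (intro ears_open_ear.Open) auto
    then show ?thesis using *(1,2) by - (rule exI[of _ "e1 # xs"], rule exI[of _ ys], rule exI[of _ "v1 # vs1"], rule exI[of _ vs2], simp del: fun_upd_apply)
  qed
qed

text \<open>The inverse construction: where \<open>e\<close> is read in the smoothed graph,
  \<open>e'\<close> is put after it and \<open>v\<close> becomes an inner vertex of that ear. If
  \<open>e\<close> was the last edge of its ear, this role passes to \<open>e'\<close>.\<close>

lemma ears_unsmooth: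
  assumes v: "v \<noteq> b" "h e = v" "t e' = v" "h e' \<noteq> v"
  shows
  "ears t (h(e := h e')) b es vs \<Longrightarrow> es = xs @ e # ys \<Longrightarrow> e \<notin> set xs \<union> set ys \<Longrightarrow> v \<notin> set vs \<Longrightarrow>
    \<exists>vs1 vs2. vs = vs1 @ vs2 \<and> ears t h b (xs @ e # e' # ys) (vs1 @ v # vs2)"
  "open_ear t (h(e := h e')) b a es vs \<Longrightarrow> es = xs @ e # ys \<Longrightarrow> e \<notin> set xs \<union> set ys \<Longrightarrow> v \<notin> set vs \<Longrightarrow>
    \<exists>vs1 vs2. vs = vs1 @ vs2 \<and> open_ear t h b a (xs @ e # e' # ys) (vs1 @ v # vs2)"
proof (induction arbitrary: xs and xs rule: ears_open_ear.inducts)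
  case Nil
  then show ?case by simp
next
  case (Ear e1 es vs)
  obtain vs1 vs2 where *: "vs = vs1 @ vs2" "open_ear t h b e1 (xs @ e # e' # ys) (vs1 @ v # vs2)"
    using Ear.IH Ear.prems by blast
  obtain zs where zs: "xs @ e # e' # ys = e1 # zs"
    using Ear.prems(1) by (cases xs) auto
  have "ears t h b (xs @ e # e' # ys) (vs1 @ v # vs2)"
    using *(2) unfolding zs by (rule ears_open_ear.Ear)
  then show ?case using *(1) by blast
next
  case (Close e1 vs a es)
  show ?case
  proof (cases xs)
    case Nil
    then have e: "e1 = e" "es = ys" using Close.prems by auto
    have "ears t h b es vs"
      by (rule ears_cong_head(1)[OF _ Close(3)]) (use Close.prems(2) e in auto)
    then have "open_ear t h b a (e' # ys) vs"
      using Close(1,2) e by (intro ears_open_ear.Close) auto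
    then have "open_ear t h b a (e # e' # ys) (v # vs)"
      using v Close.prems by (intro ears_open_ear.Open) auto
    then show ?thesis using Nil by - (rule exI[of _ "[]"], rule exI[of _ vs], simp del: fun_upd_apply)
  next
    case (Cons e2 zs)
    then have e: "e2 = e1" "es = zs @ e # ys" using Close.prems by auto
    obtain vs1 vs2 where *: "vs = vs1 @ vs2" "ears t h b (zs @ e # e' # ys) (vs1 @ v # vs2)"
      using Close(4)[OF e(2)] Close.prems Cons by auto
    have "open_ear t h b a (e1 # zs @ e # e' # ys) (vs1 @ v # vs2)"
      using * Close(1,2) Close.prems Cons e by (intro ears_open_ear.Close) auto
    then show ?thesis using * Cons e by auto
  qed
next
  case (Open e1 v1 e2 vs a es)
  show ?case
  proof (cases xs)
    case Nil
    then have e: "e1 = e" "e2 # es = ys" using Open.prems by auto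
    have "open_ear t h b a (e2 # es) vs"
      by (rule ears_cong_head(2)[OF _ Open(4)]) (use Open.prems(2) e in auto)
    then have "open_ear t h b a (e' # ys) (v1 # vs)"
      unfolding e(2)[symmetric] using Open(1-3) e by (intro ears_open_ear.Open) auto
    then have "open_ear t h b a (e # e' # ys) (v # v1 # vs)"
      using v Open.prems by (intro ears_open_ear.Open) auto
    then show ?thesis using Nil by - (rule exI[of _ "[]"], rule exI[of _ "v1 # vs"], simp del: fun_upd_apply)
  next
    case (Cons e3 zs)
    then have e: "e3 = e1" "e2 # es = zs @ e # ys" using Open.prems by auto
    obtain vs1 vs2 where *: "vs = vs1 @ vs2" "open_ear t h b a (zs @ e # e' # ys) (vs1 @ v # vs2)"
      using Open(5)[OF e(2)] Open.prems Cons by auto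
    obtain ws where ws: "zs @ e # e' # ys = e2 # ws"
      using e(2) by (cases zs) auto
    have "open_ear t h b a (e1 # zs @ e # e' # ys) (v1 # vs1 @ v # vs2)"
      using * Open(1-3) Open.prems Cons e unfolding ws by (intro ears_open_ear.Open) auto
    then show ?thesis using * Cons e by - (rule exI[of _ "v1 # vs1"], rule exI[of _ vs2], simp del: fun_upd_apply)
  qed
qed

text \<open>For an open ear, the way back to \<open>b\<close> follows the remaining edges, but a
  path from \<open>b\<close> to an inner vertex passes through the part already read. Hence that
  direction is conditional on reaching the head of the current edge; the condition is discharged by
  the first edge once the ear is complete.\<close>

lemma ears_reachable:
  fixes R :: "('v \<times> 'v) set"
  shows
  "ears t h b es vs \<Longrightarrow> (\<And>e. e \<in> set es \<Longrightarrow> (t e, h e) \<in> R) \<Longrightarrow>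
    \<forall>v\<in>set vs. (b, v) \<in> R\<^sup>* \<and> (v, b) \<in> R\<^sup>*"
  "open_ear t h b a es vs \<Longrightarrow> (\<And>e. e \<in> set es \<Longrightarrow> (t e, h e) \<in> R) \<Longrightarrow>
    (b, t a) \<in> R\<^sup>* \<and> (h (hd es), b) \<in> R\<^sup>* \<and>
    (\<forall>v\<in>set vs. (v, b) \<in> R\<^sup>* \<and> ((b, h (hd es)) \<in> R\<^sup>* \<longrightarrow> (b, v) \<in> R\<^sup>*))"
proof (induction rule: ears_open_ear.inducts)
  case (Ear e es vs)
  then have "(b, h e) \<in> R\<^sup>*"
    by (metis list.set_intros(1) rtrancl.rtrancl_into_rtrancl)
  then show ?case using Ear by auto
next
  case (Close e vs a es)
  then show ?case by auto
next
  case (Open e v e' vs a es)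
  have IH: "(b, t a) \<in> R\<^sup>*" "(h e', b) \<in> R\<^sup>*"
    "\<forall>v\<in>set vs. (v, b) \<in> R\<^sup>* \<and> ((b, h e') \<in> R\<^sup>* \<longrightarrow> (b, v) \<in> R\<^sup>*)"
    using Open(5,6) by auto
  have "(v, h e') \<in> R" using Open(6)[of e'] Open(2) by simp
  then have "(v, b) \<in> R\<^sup>*" "(b, v) \<in> R\<^sup>* \<Longrightarrow> (b, h e') \<in> R\<^sup>*"
    using IH(2) by (auto intro: converse_rtrancl_into_rtrancl rtrancl.rtrancl_into_rtrancl)
  then show ?case using IH Open(1) by auto
qed auto

section \<open>Counting ear decompositions by the recursion for \<phi>\<close>

definition ear_orders :: "pgraph \<Rightarrow> (nat list \<times> nat list) set" where
  "ear_orders \<Gamma> = {(es, vs). distinct es \<and> set es = arcs (fst \<Gamma>) \<and> set vs = ordinary \<Gamma> \<and>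
     ears (tail (fst \<Gamma>)) (head (fst \<Gamma>)) (snd \<Gamma>) es vs}"

lemma pointed_graphD:
  assumes "pointed_graph \<Gamma>"
  shows "finite (arcs (fst \<Gamma>))" "finite (verts (fst \<Gamma>))" "snd \<Gamma> \<in> verts (fst \<Gamma>)"
    "e \<in> arcs (fst \<Gamma>) \<Longrightarrow> tail (fst \<Gamma>) e \<in> verts (fst \<Gamma>)"
    "e \<in> arcs (fst \<Gamma>) \<Longrightarrow> head (fst \<Gamma>) e \<in> verts (fst \<Gamma>)"
    "wf_digraph (fst \<Gamma>)"
proof -
  interpret fin_digraph "fst \<Gamma>" using assms by (simp add: pointed_graph_def)
  show "finite (arcs (fst \<Gamma>))" "finite (verts (fst \<Gamma>))" "wf_digraph (fst \<Gamma>)" 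
    "e \<in> arcs (fst \<Gamma>) \<Longrightarrow> tail (fst \<Gamma>) e \<in> verts (fst \<Gamma>)"
    "e \<in> arcs (fst \<Gamma>) \<Longrightarrow> head (fst \<Gamma>) e \<in> verts (fst \<Gamma>)"
    by (auto intro: wf_digraph)
  show "snd \<Gamma> \<in> verts (fst \<Gamma>)" using assms by (simp add: pointed_graph_def)
qed

lemma pointed_graphI:
  assumes "finite (arcs G)" "finite (verts G)" "b \<in> verts G"
    "\<And>e. e \<in> arcs G \<Longrightarrow> tail G e \<in> verts G \<and> head G e \<in> verts G"
  shows "pointed_graph (G, b)"
  using assms by (auto simp: pointed_graph_def intro!: fin_digraph.intro wf_digraph.intro fin_digraph_axioms.intro)

lemma strongly_connected_rtrancl:
  assumes "pointed_graph \<Gamma>"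
  shows "strongly_connected (fst \<Gamma>) \<longleftrightarrow>
    (\<forall>u\<in>verts (fst \<Gamma>). \<forall>v\<in>verts (fst \<Gamma>). (u, v) \<in> (arcs_ends (fst \<Gamma>))\<^sup>*)"
  using pointed_graphD(3)[OF assms] wf_digraph.reachable_conv'[OF pointed_graphD(6)[OF assms]]
  by (auto simp: strongly_connected_def)

lemma ear_orders_strongly_connected:
  assumes "pointed_graph \<Gamma>" "p \<in> ear_orders \<Gamma>"
  shows "strongly_connected (fst \<Gamma>)"
proof -
  obtain es vs where p: "p = (es, vs)" by force
  have "\<forall>v\<in>set vs. (snd \<Gamma>, v) \<in> (arcs_ends (fst \<Gamma>))\<^sup>* \<and> (v, snd \<Gamma>) \<in> (arcs_ends (fst \<Gamma>))\<^sup>*"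
    using assms(2) unfolding p ear_orders_def
    by (intro ears_reachable(1)) (auto simp: arcs_ends_conv)
  then have "(snd \<Gamma>, v) \<in> (arcs_ends (fst \<Gamma>))\<^sup>* \<and> (v, snd \<Gamma>) \<in> (arcs_ends (fst \<Gamma>))\<^sup>*"
    if "v \<in> verts (fst \<Gamma>)" for v
    using assms(2) that unfolding p ear_orders_def ordinary_def by (cases "v = snd \<Gamma>") auto
  then show ?thesis
    unfolding strongly_connected_rtrancl[OF assms(1)] by (meson rtrancl_trans)
qed

lemma finite_ear_orders:
  assumes "pointed_graph \<Gamma>"
  shows "finite (ear_orders \<Gamma>)"
proof -
  have "ear_orders \<Gamma> \<subseteq> {es. set es \<subseteq> arcs (fst \<Gamma>) \<and> distinct es} \<times> {vs. set vs \<subseteq> verts (fst \<Gamma>) \<and> distinct vs}"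
    by (auto simp: ear_orders_def ordinary_def dest: ears_distinct(1))
  then show ?thesis
    by (rule finite_subset) (auto intro!: finite_cartesian_product finite_subset_distinct pointed_graphD[OF assms])
qed

text \<open>The vertex list is a function of the edge list, so ear decompositions may be counted by
  their edge lists.\<close>

lemma card_ear_orders_fst: "card (fst ` ear_orders \<Gamma>) = card (ear_orders \<Gamma>)"
proof -
  have "inj_on fst (ear_orders \<Gamma>)"
    by (auto simp: ear_orders_def inj_on_def dest!: ears_vertices(1))
  then show ?thesis by (rule card_image)
qed

lemma ear_orders_trivial:
  assumes "pointed_graph \<Gamma>" "ordinary \<Gamma> = {}"
  shows "card (ear_orders \<Gamma>) = fact (card (arcs (fst \<Gamma>)))"
proof -
  have "verts (fst \<Gamma>) = {snd \<Gamma>}" using assms pointed_graphD(3) by (auto simp: ordinary_def)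
  then have "\<forall>e\<in>arcs (fst \<Gamma>). tail (fst \<Gamma>) e = snd \<Gamma> \<and> head (fst \<Gamma>) e = snd \<Gamma>"
    using pointed_graphD(4,5)[OF assms(1)] by auto
  then have "fst ` ear_orders \<Gamma> = {es. distinct es \<and> set es = arcs (fst \<Gamma>)}"
    by (auto simp: ear_orders_def assms ears_trivial_iff image_iff)
  then have "card (ear_orders \<Gamma>) = card {es. distinct es \<and> set es = arcs (fst \<Gamma>)}"
    by (metis card_ear_orders_fst)
  also have "{es. distinct es \<and> set es = arcs (fst \<Gamma>)} = permutations_of_set (arcs (fst \<Gamma>))"
    by (auto simp: permutations_of_set_def)
  finally show ?thesis by (simp add: pointed_graphD(1)[OF assms(1)])
qed

lemma pointed_graph_del_arc:
  assumes "pointed_graph \<Gamma>"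
  shows "pointed_graph (pre_digraph.del_arc (fst \<Gamma>) e, snd \<Gamma>)"
  using pointed_graphD[OF assms]
  by (intro pointed_graphI) (auto simp: pre_digraph.arcs_del_arc pre_digraph.verts_del_arc pre_digraph.tail_del_arc pre_digraph.head_del_arc)

text \<open>The interior vertices of the outermost ear are smoothable, so in the absence of smoothable
  vertices that ear is a single edge.\<close>

lemma ear_orders_del_arc:
  assumes "pointed_graph \<Gamma>" "ordinary \<Gamma> \<noteq> {}" "\<nexists>v. smoothable \<Gamma> v"
  shows "card (ear_orders \<Gamma>) =
    (\<Sum>e\<in>arcs (fst \<Gamma>). card (ear_orders (pre_digraph.del_arc (fst \<Gamma>) e, snd \<Gamma>)))"
proof -
  define G b where "G = fst \<Gamma>" and "b = snd \<Gamma>"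
  define D where "D e = ear_orders (pre_digraph.del_arc G e, b)" for e
  have D: "(es, vs) \<in> D e \<longleftrightarrow> distinct es \<and> set es = arcs G - {e} \<and> set vs = ordinary \<Gamma> \<and>
      ears (tail G) (head G) b es vs" for e es vs
    unfolding D_def by (simp add: ear_orders_def ordinary_def pre_digraph.arcs_del_arc pre_digraph.verts_del_arc
        pre_digraph.tail_del_arc pre_digraph.head_del_arc G_def b_def)
  have "ear_orders \<Gamma> = (\<Union>e\<in>arcs G. (\<lambda>(es, vs). (e # es, vs)) ` D e)"
  proof (intro set_eqI iffI)
    fix p assume "p \<in> ear_orders \<Gamma>"
    then obtain es vs where p: "p = (es, vs)" "distinct es" "set es = arcs G" "set vs = ordinary \<Gamma>"
      "ears (tail G) (head G) b es vs"
      by (auto simp: ear_orders_def G_def b_def)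
    from p(5) show "p \<in> (\<Union>e\<in>arcs G. (\<lambda>(es, vs). (e # es, vs)) ` D e)"
    proof (cases rule: ears.cases)
      case Nil
      then show ?thesis using p assms(2) by auto
    next
      case (Ear e es')
      from Ear(2) show ?thesis
      proof (cases rule: open_ear.cases)
        case Close
        then have "(es', vs) \<in> D e" using p Ear unfolding D by auto
        then show ?thesis using p Ear by force
      next
        case (Open v e' vs' es'')
        have "arcs G = {e, e'} \<union> set es''" "e \<noteq> e'" "e \<notin> set es''" "e' \<notin> set es''"
          using p Ear Open by auto
        moreover have "\<forall>x\<in>insert e' (set es''). head G x \<noteq> v"
          using ears_heads(2)[OF Open(6)] Open(5) by auto
        moreover have "\<forall>x\<in>insert e (set es''). tail G x \<noteq> v"
          using ears_tails(2)[OF Open(6)] Open(5) by auto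
        ultimately have "in_arcs G v = {e}" "out_arcs G v = {e'}"
          using Open(3,4) unfolding in_arcs_def out_arcs_def by auto
        then have "smoothable \<Gamma> v"
          using p Open by (auto simp: smoothable_def in_degree_def out_degree_def G_def)
        then show ?thesis using assms by auto
      qed
    qed
  next
    fix p assume "p \<in> (\<Union>e\<in>arcs G. (\<lambda>(es, vs). (e # es, vs)) ` D e)"
    then obtain e es vs where p: "e \<in> arcs G" "p = (e # es, vs)" "(es, vs) \<in> D e" by auto
    have "tail G e \<in> insert b (set vs)" "head G e \<in> insert b (set vs)"
      using pointed_graphD(4,5)[OF assms(1), of e] p(1,3) by (auto simp: D ordinary_def G_def b_def)
    then have "ears (tail G) (head G) b (e # es) vs"
      using p(3) unfolding D by (intro ears_open_ear.Ear ears_open_ear.Close) auto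
    then show "p \<in> ear_orders \<Gamma>"
      using p unfolding D by (auto simp: ear_orders_def G_def b_def)
  qed
  then have "card (ear_orders \<Gamma>) = card (\<Union>e\<in>arcs G. (\<lambda>(es, vs). (e # es, vs)) ` D e)"
    by simp
  also have "\<dots> = (\<Sum>e\<in>arcs G. card ((\<lambda>(es, vs). (e # es, vs)) ` D e))"
    using pointed_graphD(1)[OF assms(1)] finite_ear_orders[OF pointed_graph_del_arc[OF assms(1)]]
    by (subst card_UN_disjoint) (auto simp: G_def D_def b_def)
  also have "\<dots> = (\<Sum>e\<in>arcs G. card (D e))"
    by (intro sum.cong card_image) (auto simp: inj_on_def)
  finally show ?thesis by (simp add: D_def G_def b_def)
qed

text \<open>Deleting \<open>e'\<close> from the edge list is a bijection between the edge lists of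
  the two graphs, because \<open>e'\<close> directly follows \<open>e\<close> in every ear
  decomposition and can be put back in one way only.\<close>

lemma ear_orders_smooth_out:
  assumes "pointed_graph \<Gamma>" "strongly_connected (fst \<Gamma>)" "smoothable \<Gamma> v"
  shows "pointed_graph (smooth_out (fst \<Gamma>) v, snd \<Gamma>)"
    and "card (ear_orders (smooth_out (fst \<Gamma>) v, snd \<Gamma>)) = card (ear_orders \<Gamma>)"
proof -
  define G b where "G = fst \<Gamma>" and "b = snd \<Gamma>"
  have "card (in_arcs G v) = 1" "card (out_arcs G v) = 1" and v: "v \<in> verts G" "v \<noteq> b"
    using assms(3) by (auto simp: smoothable_def G_def b_def in_degree_def out_degree_def ordinary_def)
  then obtain e e' where ea: "in_arcs G v = {e}" "out_arcs G v = {e'}"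
    by (auto simp: card_1_singleton_iff)
  then have e: "e \<in> arcs G" "head G e = v" "\<And>x. x \<in> arcs G \<Longrightarrow> head G x = v \<longleftrightarrow> x = e"
    and e': "e' \<in> arcs G" "tail G e' = v" "\<And>x. x \<in> arcs G \<Longrightarrow> tail G x = v \<longleftrightarrow> x = e'"
    by (auto simp: set_eq_iff)
  have "b \<in> verts G" using pointed_graphD(3)[OF assms(1)] by (simp add: G_def b_def)
  then have "(v, b) \<in> (arcs_ends G)\<^sup>*"
    using assms(2) v unfolding strongly_connected_rtrancl[OF assms(1)] by (simp add: G_def b_def)
  \<comment> \<open>If \<open>e\<close> and \<open>e'\<close> were the same edge, it would be a loop
    and no vertex but \<open>v\<close> could be reached from \<open>v\<close>, contrary to strong
    connectivity.\<close>
  moreover have "w = v" if "(v, w) \<in> (arcs_ends G)\<^sup>*" "e = e'" for w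
    using that(1) by induction (use that(2) e e' in \<open>auto simp: arcs_ends_conv\<close>)
  ultimately have ne: "e \<noteq> e'" using v by blast
  have he': "head G e' \<noteq> v" using e(3) e' ne by auto
  have "smooth_out G v = \<lparr>verts = verts G - {v}, arcs = arcs G - {e'}, tail = tail G, head = (head G)(e := head G e')\<rparr>"
    by (simp add: smooth_out_def ea)
  note S = this
  show "pointed_graph (smooth_out (fst \<Gamma>) v, snd \<Gamma>)"
    using pointed_graphD[OF assms(1)] v e e' he' unfolding G_def[symmetric] b_def[symmetric] S
    by (intro pointed_graphI) auto
  let ?O = "ear_orders (smooth_out G v, b)"
  have O: "(es, vs) \<in> ?O \<longleftrightarrow> distinct es \<and> set es = arcs G - {e'} \<and> set vs = ordinary \<Gamma> - {v} \<and>
    ears (tail G) ((head G)(e := head G e')) b es vs" for es vs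
  proof -
    have "ordinary (smooth_out G v, b) = ordinary \<Gamma> - {v}"
      unfolding ordinary_def S by (auto simp: G_def b_def)
    then show ?thesis by (simp add: ear_orders_def S del: fun_upd_apply)
  qed
  have OG: "(es, vs) \<in> ear_orders \<Gamma> \<longleftrightarrow> distinct es \<and> set es = arcs G \<and> set vs = ordinary \<Gamma> \<and>
    ears (tail G) (head G) b es vs" for es vs
    by (auto simp: ear_orders_def G_def b_def)
  have vo: "v \<in> ordinary \<Gamma>" using v by (simp add: ordinary_def G_def b_def)
  have split: "\<exists>xs ys vs1 vs2. es = xs @ e # e' # ys \<and> vs = vs1 @ v # vs2 \<and> (xs @ e # ys, vs1 @ vs2) \<in> ?O"
    if that: "(es, vs) \<in> ear_orders \<Gamma>" for es vs
  proof -
    have "\<exists>xs ys vs1 vs2. es = xs @ e # e' # ys \<and> vs = vs1 @ v # vs2 \<and>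
        ears (tail G) ((head G)(e := head G e')) b (xs @ e # ys) (vs1 @ vs2)"
      by (rule ears_smooth(1)[where e = e and e' = e' and v = v and t = "tail G" and h = "head G" and b = b and es = es and vs = vs])
        (use that vo e(3) e'(3) in \<open>auto simp: OG\<close>)
    then obtain xs ys vs1 vs2 where *: "es = xs @ e # e' # ys" "vs = vs1 @ v # vs2"
        "ears (tail G) ((head G)(e := head G e')) b (xs @ e # ys) (vs1 @ vs2)" by blast
    moreover have "distinct vs" using that ears_distinct(1)[of "tail G" "head G" b es vs] by (simp add: OG)
    ultimately have "(xs @ e # ys, vs1 @ vs2) \<in> ?O"
      using that unfolding OG O by auto
    then show ?thesis using * by blast
  qed
  have "bij_betw (removeAll e') (fst ` ear_orders \<Gamma>) (fst ` ?O)"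
  proof (rule bij_betwI')
    fix es fs assume "es \<in> fst ` ear_orders \<Gamma>" "fs \<in> fst ` ear_orders \<Gamma>"
    then obtain vs ws where 1: "(es, vs) \<in> ear_orders \<Gamma>" "(fs, ws) \<in> ear_orders \<Gamma>" by auto
    obtain xs ys where x: "es = xs @ e # e' # ys" using split[OF 1(1)] by blast
    obtain xs' ys' where x': "fs = xs' @ e # e' # ys'" using split[OF 1(2)] by blast
    have d: "distinct es" "distinct fs" using 1 by (auto simp: OG)
    then have r: "removeAll e' es = xs @ e # ys" "removeAll e' fs = xs' @ e # ys'"
      using x x' ne by auto
    have "xs = xs' \<and> ys = ys'" if "xs @ e # ys = xs' @ e # ys'"
      using that append_Cons_eq_iff[of e xs ys xs' ys'] d x x' by auto
    then show "removeAll e' es = removeAll e' fs \<longleftrightarrow> es = fs"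
      unfolding r using x x' r by metis
  next
    fix es assume "es \<in> fst ` ear_orders \<Gamma>"
    then obtain vs where 1: "(es, vs) \<in> ear_orders \<Gamma>" by auto
    obtain xs ys vs1 vs2 where *: "es = xs @ e # e' # ys" "(xs @ e # ys, vs1 @ vs2) \<in> ?O"
      using split[OF 1] by blast
    have "removeAll e' es = xs @ e # ys" using *(1) 1 ne by (auto simp: OG)
    then show "removeAll e' es \<in> fst ` ?O" using *(2) by force
  next
    fix es assume "es \<in> fst ` ?O"
    then obtain vs where 1: "(es, vs) \<in> ?O" by auto
    then have "e \<in> set es" using e ne by (auto simp: O)
    then obtain xs ys where es: "es = xs @ e # ys" by (meson split_list)
    have "\<exists>vs1 vs2. vs = vs1 @ vs2 \<and> ears (tail G) (head G) b (xs @ e # e' # ys) (vs1 @ v # vs2)"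
      using 1 v e e' he' es by (intro ears_unsmooth(1)[where es = es]) (auto simp: O)
    then obtain vs1 vs2 where *: "vs = vs1 @ vs2" "ears (tail G) (head G) b (xs @ e # e' # ys) (vs1 @ v # vs2)"
      by blast
    then have "(xs @ e # e' # ys, vs1 @ v # vs2) \<in> ear_orders \<Gamma>"
      using 1 es e' vo unfolding OG O by auto
    moreover have "es = removeAll e' (xs @ e # e' # ys)" using 1 ne unfolding es O by auto
    ultimately show "\<exists>x\<in>fst ` ear_orders \<Gamma>. es = removeAll e' x" by force
  qed
  then show "card (ear_orders (smooth_out (fst \<Gamma>) v, snd \<Gamma>)) = card (ear_orders \<Gamma>)"
    using bij_betw_same_card card_ear_orders_fst unfolding G_def b_def by metis
qed

text \<open>Each clause of the recursion matches a count of ear decompositions. The induction has to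
  cover all pointed graphs, because deleting an edge can destroy stability.\<close>

theorem phi_eq_card_ear_orders:
  assumes "pointed_graph \<Gamma>"
  shows "phi \<Gamma> = card (ear_orders \<Gamma>)"
  using assms
proof (induction \<Gamma> rule: phi.induct)
  case (1 \<Gamma>)
  consider "\<not> strongly_connected (fst \<Gamma>)" | "strongly_connected (fst \<Gamma>)" "ordinary \<Gamma> = {}"
    | "strongly_connected (fst \<Gamma>)" "ordinary \<Gamma> \<noteq> {}" "\<exists>v. smoothable \<Gamma> v"
    | "strongly_connected (fst \<Gamma>)" "ordinary \<Gamma> \<noteq> {}" "\<nexists>v. smoothable \<Gamma> v" by blast
  then show ?case
  proof cases
    case 1
    then have "ear_orders \<Gamma> = {}" using ear_orders_strongly_connected[OF "1.prems"] by blast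
    then show ?thesis using 1 by (subst phi.simps) simp
  next
    case 2
    then show ?thesis using "1.prems" by (subst phi.simps) (simp add: ear_orders_trivial)
  next
    case 3
    define v where "v = (SOME v. smoothable \<Gamma> v)"
    have v: "smoothable \<Gamma> v" unfolding v_def using 3(3) by (rule someI_ex)
    have "phi \<Gamma> = phi (smooth_out (fst \<Gamma>) v, snd \<Gamma>)"
      using "1.prems" 3 by (subst phi.simps) (simp add: v_def)
    also have "\<dots> = card (ear_orders (smooth_out (fst \<Gamma>) v, snd \<Gamma>))"
      using "1.IH"(1) "1.prems" 3 ear_orders_smooth_out(1)[OF "1.prems" 3(1) v] by (simp add: v_def)
    finally show ?thesis using ear_orders_smooth_out(2)[OF "1.prems" 3(1) v] by simp
  next
    case 4
    have "\<not> Ex (smoothable \<Gamma>)" using 4(3) by blast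
    then have "phi \<Gamma> = (\<Sum>e\<in>arcs (fst \<Gamma>). phi (pre_digraph.del_arc (fst \<Gamma>) e, snd \<Gamma>))"
      using "1.prems" 4(1,2) by (subst phi.simps) (simp only: simp_thms if_True if_False)
    also have "\<dots> = (\<Sum>e\<in>arcs (fst \<Gamma>). card (ear_orders (pre_digraph.del_arc (fst \<Gamma>) e, snd \<Gamma>)))"
      using "1.IH"(2) "1.prems" 4 pointed_graph_del_arc[OF "1.prems"] by (intro sum.cong) auto
    finally show ?thesis using ear_orders_del_arc[OF "1.prems" 4(2,3)] by simp
  qed
qed

section \<open>Coding graphs with an ear decomposition\<close>

text \<open>An ear has one edge more than it has inner vertices, so the two lengths differ by the
  number of ears.\<close>

lemma ears_length:
  "ears t h b es vs \<Longrightarrow> length vs \<le> length es"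
  "open_ear t h b a es vs \<Longrightarrow> length vs < length es"
  by (induction rule: ears_open_ear.inducts) auto

lemma Cons_eq_upt_length:
  assumes "x # xs = [p..<p + length (x # xs)]"
  shows "x = p" "xs = [Suc p..<Suc p + length xs]" "\<forall>y\<in>set xs. p < y"
proof -
  show 1: "x = p" "xs = [Suc p..<Suc p + length xs]"
    using upt_eq_Cons_conv[of p "p + length (x # xs)" x xs] assms
    by (metis add_Suc_right add_Suc_shift Suc_eq_plus1 length_Cons)+
  show "\<forall>y\<in>set xs. p < y"
    by (subst 1(2)) auto
qed

section \<open>Leaves of the expansion and ear decompositions\<close>

definition star :: "('e \<Rightarrow> 'v) \<Rightarrow> ('e \<Rightarrow> 'v) \<Rightarrow> 'e set \<Rightarrow> 'e set \<Rightarrow> 'v \<Rightarrow> 'e set \<times> 'e set" where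
  "star t h A B v = ({x \<in> A. t x = v}, {x \<in> B. h x = v})"

text \<open>A leaf is a term in the expansion of the derivatives of \<open>\<box>\<^sup>k f\<close> at the center. Contracted indices are
  edges, numbered from \<open>p\<close>; \<open>A\<close> and \<open>B\<close> are the edges whose unbarred and barred derivative still has
  to act. A block collects the edges with tail and with head at one vertex, and the last block belongs
  to \<open>f\<close>. In \<open>open_leaf\<close> the contraction path starting with \<open>a\<close> has reached \<open>p\<close>: it ends by one more
  derivative of the remaining expression, or it enters a factor of the metric, on which the derivatives
  \<open>X\<close> and \<open>Y\<close> act.\<close>

inductive closed_leaf :: "nat \<Rightarrow> nat \<Rightarrow> nat set \<Rightarrow> nat set \<Rightarrow> nat list \<Rightarrow> (nat set \<times> nat set) list \<Rightarrow> bool"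
  and open_leaf :: "nat \<Rightarrow> nat \<Rightarrow> nat \<Rightarrow> nat set \<Rightarrow> nat set \<Rightarrow> nat list \<Rightarrow> (nat set \<times> nat set) list \<Rightarrow> bool"
where
  Done: "closed_leaf 0 p A B [] [(A, B)]"
| Start: "open_leaf k p p A B es bs \<Longrightarrow> closed_leaf (Suc k) p A B es bs"
| Finish: "closed_leaf k (Suc p) (insert a A) (insert p B) es bs \<Longrightarrow> open_leaf k a p A B (p # es) bs"
| Vertex: "X \<subseteq> A \<Longrightarrow> Y \<subseteq> B \<Longrightarrow> X \<noteq> {} \<Longrightarrow> Y \<noteq> {} \<Longrightarrow> open_leaf k a (Suc p) (A - X) (B - Y) es bs \<Longrightarrow>
    open_leaf k a p A B (p # es) ((insert (Suc p) X, insert p Y) # bs)"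

lemma leaf_edges:
  "closed_leaf k p A B es bs \<Longrightarrow> es = [p..<p + length es] \<and> bs \<noteq> []"
  "open_leaf k a p A B es bs \<Longrightarrow> es = [p..<p + length es] \<and> es \<noteq> [] \<and> bs \<noteq> []"
  by (induction rule: closed_leaf_open_leaf.inducts)
    (auto simp: upt_conv_Cons simp flip: upt_Suc)

text \<open>\<open>A\<close> and \<open>B\<close> hold the edges of the part already read whose
  tail, respectively head, lies at a vertex still to come. In an open ear, the tail of a current
  edge other than \<open>a\<close> has been assigned while its head is still pending; this is why
  \<open>insert a A\<close> goes with \<open>tl es\<close> but \<open>B\<close> with
  \<open>es\<close>. At a new vertex the ear itself supplies one edge in each direction, so degrees
  of at least 2 mean that the sets \<open>X\<close> and \<open>Y\<close> of the rule
  \<open>Vertex\<close> are nonempty.\<close>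

lemma ears_imp_leaf:
  fixes t h :: "nat \<Rightarrow> 'v"
  shows
  "ears t h b es vs \<Longrightarrow> es = [p..<p + length es] \<Longrightarrow> A \<subseteq> {..<p} \<Longrightarrow> B \<subseteq> {..<p} \<Longrightarrow>
    t ` A \<subseteq> insert b (set vs) \<Longrightarrow> h ` B \<subseteq> insert b (set vs) \<Longrightarrow>
    (\<And>v. v \<in> set vs \<Longrightarrow> card {x \<in> A \<union> set es. t x = v} \<ge> 2 \<and> card {x \<in> B \<union> set es. h x = v} \<ge> 2) \<Longrightarrow>
    length es = length vs + k \<Longrightarrow>
    closed_leaf k p A B es (map (star t h (A \<union> set es) (B \<union> set es)) (vs @ [b]))"
  "open_ear t h b a es vs \<Longrightarrow> es = [p..<p + length es] \<Longrightarrow> A \<subseteq> {..<p} \<Longrightarrow> B \<subseteq> {..<p} \<Longrightarrow>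
    a \<le> p \<Longrightarrow> a \<notin> A \<Longrightarrow>
    t ` A \<subseteq> insert b (set vs) \<Longrightarrow> h ` B \<subseteq> insert b (set vs) \<Longrightarrow>
    (\<And>v. v \<in> set vs \<Longrightarrow> card {x \<in> insert a A \<union> set (tl es). t x = v} \<ge> 2 \<and> card {x \<in> B \<union> set es. h x = v} \<ge> 2) \<Longrightarrow>
    length es = length vs + Suc k \<Longrightarrow>
    open_leaf k a p A B es (map (star t h (insert a A \<union> set (tl es)) (B \<union> set es)) (vs @ [b]))"
proof (induction arbitrary: p A B k and p A B k rule: ears_open_ear.inducts)
  case Nil
  then have "map (star t h (A \<union> set []) (B \<union> set [])) ([] @ [b]) = [(A, B)]"
    by (auto simp: star_def)
  then show ?case using Nil by (auto intro!: Done)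
next
  case (Ear e es vs)
  obtain k' where k: "k = Suc k'"
    using ears_length(2)[OF Ear(1)] Ear.prems by (cases k) auto
  have e: "e = p" using Ear.prems(1) upt_eq_Cons_conv by metis
  have i: "insert e A \<union> set (tl (e # es)) = A \<union> set (e # es)" by auto
  have "open_leaf k' e p A B (e # es) (map (star t h (insert e A \<union> set (tl (e # es))) (B \<union> set (e # es))) (vs @ [b]))"
  proof (rule Ear(2))
    show "2 \<le> card {x \<in> insert e A \<union> set (tl (e # es)). t x = v} \<and> 2 \<le> card {x \<in> B \<union> set (e # es). h x = v}" if "v \<in> set vs" for v
      unfolding i using Ear.prems(6) that .
  qed (use Ear.prems e k in auto)
  then show ?case unfolding i k using e by (auto intro: Start)
next
  case (Close e vs a es)
  have e: "e = p" "es = [Suc p..<Suc p + length es]" using Cons_eq_upt_length(1,2)[OF Close.prems(1)] .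
  have i: "insert a A \<union> set (tl (e # es)) = insert a A \<union> set es" "B \<union> set (e # es) = insert e B \<union> set es" by auto
  have "closed_leaf k (Suc p) (insert a A) (insert e B) es (map (star t h (insert a A \<union> set es) (insert e B \<union> set es)) (vs @ [b]))"
  proof (rule Close(4))
    show "2 \<le> card {x \<in> insert a A \<union> set es. t x = v} \<and> 2 \<le> card {x \<in> insert e B \<union> set es. h x = v}" if "v \<in> set vs" for v
      using Close.prems(8)[OF that] unfolding i .
  next
    show "es = [Suc p..<Suc p + length es]" by (rule e(2))
    show "insert a A \<subseteq> {..<Suc p}" "insert e B \<subseteq> {..<Suc p}"
      using Close.prems(2-4) e(1) by (auto simp: less_Suc_eq less_Suc_eq_le)
  qed (use Close.prems(6,7,9) Close(1,2) in auto)
  then show ?case unfolding i unfolding e(1) by (rule Finish)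
next
  case (Open e v e' vs a es)
  have e: "e = p" "e' = Suc p" "e' # es = [Suc p..<Suc p + length (e' # es)]" "\<forall>x\<in>set es. Suc p < x"
  proof -
    have 1: "e = p" "e' # es = [Suc p..<Suc p + length (e' # es)]"
      using Cons_eq_upt_length(1,2)[OF Open.prems(1)] .
    have 2: "e' = Suc p" "\<forall>x\<in>set es. Suc p < x"
      using Cons_eq_upt_length(1,3)[OF 1(2)] .
    show "e = p" "e' = Suc p" "e' # es = [Suc p..<Suc p + length (e' # es)]" "\<forall>x\<in>set es. Suc p < x"
      by (rule 1 2)+
  qed
  have heads: "h ` set (e' # es) \<subseteq> insert b (set vs)" using ears_heads(2)[OF Open(4)] by blast
  have tails: "t ` set es \<subseteq> insert b (set vs)" "t a \<in> insert b (set vs)" using ears_tails(2)[OF Open(4)] by auto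
  \<comment> \<open>\<open>X\<close> and \<open>Y\<close> are the pending edges that meet
    \<open>v\<close>, that is, the derivatives falling on the factor of the metric at
    \<open>v\<close>.\<close>
  define X where "X = {x \<in> A. t x = v}"
  define Y where "Y = {x \<in> B. h x = v}"
  have fin: "finite A" "finite B" using Open.prems(2,3) finite_subset by auto
  have SX: "{x \<in> insert a A \<union> set (tl (e # e' # es)). t x = v} = insert e' X"
    using Open(2,3) tails by (auto simp: X_def)
  have SY: "{x \<in> B \<union> set (e # e' # es). h x = v} = insert e Y"
    using Open(1,3) heads by (auto simp: Y_def)
  have "card (insert e' X) \<ge> 2" "card (insert e Y) \<ge> 2"
    using Open.prems(8)[of v] unfolding SX SY by auto
  then have ne: "X \<noteq> {}" "Y \<noteq> {}" by auto
  have ST: "{x \<in> insert a A \<union> set (tl (e # e' # es)). t x = w} = {x \<in> insert a (A - X) \<union> set (tl (e' # es)). t x = w}" if "w \<noteq> v" for w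
    using that Open(2) by (auto simp: X_def)
  have SH: "{x \<in> B \<union> set (e # e' # es). h x = w} = {x \<in> B - Y \<union> set (e' # es). h x = w}" if "w \<noteq> v" for w
    using that Open(1) by (auto simp: Y_def)
  have "open_leaf k a (Suc p) (A - X) (B - Y) (e' # es)
      (map (star t h (insert a (A - X) \<union> set (tl (e' # es))) (B - Y \<union> set (e' # es))) (vs @ [b]))"
  proof (rule Open(5))
    fix w assume w: "w \<in> set vs"
    then have "w \<noteq> v" using Open(3) by auto
    then show "2 \<le> card {x \<in> insert a (A - X) \<union> set (tl (e' # es)). t x = w} \<and>
           2 \<le> card {x \<in> B - Y \<union> set (e' # es). h x = w}"
      using Open.prems(8)[of w] w ST[of w] SH[of w] by simp
  next
    show "e' # es = [Suc p..<Suc p + length (e' # es)]" by (rule e(3))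
    show "A - X \<subseteq> {..<Suc p}" "B - Y \<subseteq> {..<Suc p}"
      using Open.prems(2,3) by (auto simp: less_Suc_eq)
  qed (use Open.prems(4-7,9) in \<open>auto simp: X_def Y_def\<close>)
  then have "open_leaf k a p A B (p # e' # es) ((insert (Suc p) X, insert p Y) #
      map (star t h (insert a (A - X) \<union> set (tl (e' # es))) (B - Y \<union> set (e' # es))) (vs @ [b]))"
    using ne by (intro Vertex) (auto simp: X_def Y_def)
  moreover have "map (star t h (insert a A \<union> set (tl (e # e' # es))) (B \<union> set (e # e' # es))) ((v # vs) @ [b]) =
      (insert (Suc p) X, insert p Y) #
      map (star t h (insert a (A - X) \<union> set (tl (e' # es))) (B - Y \<union> set (e' # es))) (vs @ [b])"
  proof -
    have "star t h (insert a A \<union> set (tl (e # e' # es))) (B \<union> set (e # e' # es)) v = (insert (Suc p) X, insert p Y)"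
      unfolding star_def SX SY by (simp only: e(1,2))
    moreover have "star t h (insert a A \<union> set (tl (e # e' # es))) (B \<union> set (e # e' # es)) w =
        star t h (insert a (A - X) \<union> set (tl (e' # es))) (B - Y \<union> set (e' # es)) w" if "w \<in> set (vs @ [b])" for w
    proof -
      have "w \<noteq> v" using that Open(3) by auto
      then show ?thesis unfolding star_def using ST[of w] SH[of w] by simp
    qed
    ultimately show ?thesis
      unfolding append_Cons list.map(2) using map_cong[OF refl, of "vs @ [b]"] by metis
  qed
  ultimately show ?case using e(1) by (simp only:)
qed

text \<open>Once the blocks are known to be the stars of distinct vertices, the block made by
  \<open>Vertex\<close> belongs to the first vertex, the other stars do not meet it, and its edges
  can be removed from the pending ones. The equation \<open>length es = length vs + k\<close>
  identifies the number of Laplacians left with the number of ears left.\<close>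

lemma leaf_imp_ears:
  fixes t h :: "nat \<Rightarrow> 'v"
  shows
  "closed_leaf k p A B es bs \<Longrightarrow> bs = map (star t h (A \<union> set es) (B \<union> set es)) (vs @ [b]) \<Longrightarrow>
    distinct (vs @ [b]) \<Longrightarrow> A \<subseteq> {..<p} \<Longrightarrow> B \<subseteq> {..<p} \<Longrightarrow>
    t ` (A \<union> set es) \<subseteq> insert b (set vs) \<Longrightarrow> h ` (B \<union> set es) \<subseteq> insert b (set vs) \<Longrightarrow>
    ears t h b es vs \<and> length es = length vs + k \<and>
    (\<forall>v\<in>set vs. 2 \<le> card {x \<in> A \<union> set es. t x = v} \<and> 2 \<le> card {x \<in> B \<union> set es. h x = v})"
  "open_leaf k a p A B es bs \<Longrightarrow> bs = map (star t h (insert a A \<union> set (tl es)) (B \<union> set es)) (vs @ [b]) \<Longrightarrow>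
    distinct (vs @ [b]) \<Longrightarrow> A \<subseteq> {..<p} \<Longrightarrow> B \<subseteq> {..<p} \<Longrightarrow> a \<le> p \<Longrightarrow> a \<notin> A \<Longrightarrow>
    t ` (insert a A \<union> set (tl es)) \<subseteq> insert b (set vs) \<Longrightarrow> h ` (B \<union> set es) \<subseteq> insert b (set vs) \<Longrightarrow>
    open_ear t h b a es vs \<and> length es = length vs + Suc k \<and>
    (\<forall>v\<in>set vs. 2 \<le> card {x \<in> insert a A \<union> set (tl es). t x = v} \<and> 2 \<le> card {x \<in> B \<union> set es. h x = v})"
proof (induction arbitrary: vs and vs rule: closed_leaf_open_leaf.inducts)
  case (Done p A B)
  then have "vs = []" by (cases vs) auto
  then show ?case by (auto intro: ears_open_ear.Nil)
next
  case (Start k p A B es bs)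
  obtain es' where es: "es = p # es'"
    using leaf_edges(2)[OF Start(1)] upt_eq_Cons_conv[of p] by (metis list.exhaust)
  have i: "insert p A \<union> set (tl es) = A \<union> set es" using es by auto
  have "open_ear t h b p es vs \<and> length es = length vs + Suc k \<and>
    (\<forall>v\<in>set vs. 2 \<le> card {x \<in> insert p A \<union> set (tl es). t x = v} \<and> 2 \<le> card {x \<in> B \<union> set es. h x = v})"
    by (rule Start(2)) (use Start.prems in \<open>simp_all only: i, auto\<close>)
  then show ?case unfolding i unfolding es by (auto intro: ears_open_ear.Ear)
next
  case (Finish k p a A B es bs)
  have i: "insert a A \<union> set (tl (p # es)) = insert a A \<union> set es" "B \<union> set (p # es) = insert p B \<union> set es" by auto
  have "ears t h b es vs \<and> length es = length vs + k \<and>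
    (\<forall>v\<in>set vs. 2 \<le> card {x \<in> insert a A \<union> set es. t x = v} \<and> 2 \<le> card {x \<in> insert p B \<union> set es. h x = v})"
    by (rule Finish(2)) (use Finish.prems in \<open>simp_all only: i, auto\<close>)
  moreover have "h p \<in> insert b (set vs)" "t a \<in> insert b (set vs)"
    using Finish.prems(7,8) by auto
  ultimately show ?case unfolding i by (auto intro!: ears_open_ear.Close)
next
  case (Vertex X A Y B k a p es bs)
  obtain es' where es: "es = Suc p # es'" "\<forall>x\<in>set es'. Suc p < x"
  proof -
    obtain y ys where y: "es = y # ys" "y # ys = [Suc p..<Suc p + length (y # ys)]"
      using leaf_edges(2)[OF Vertex(5)] by (cases es) auto
    have ys: "y = Suc p" "\<forall>x\<in>set ys. Suc p < x"
      using Cons_eq_upt_length(1,3)[OF y(2)] .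
    show ?thesis using that[of ys] y(1) ys by simp
  qed
  obtain v vs' where vs: "vs = v # vs'" using Vertex.prems(1) leaf_edges(2)[OF Vertex(5)] by (cases vs) auto
  let ?T = "insert a A \<union> set (tl (p # es))" and ?H = "B \<union> set (p # es)"
  have "star t h ?T ?H v = (insert (Suc p) X, insert p Y)" and bs: "bs = map (star t h ?T ?H) (vs' @ [b])"
    using Vertex.prems(1) vs by auto
  then have SX: "{x \<in> ?T. t x = v} = insert (Suc p) X" and SY: "{x \<in> ?H. h x = v} = insert p Y"
    by (auto simp: star_def)
  have tv: "t (Suc p) = v" "h p = v" "\<And>x. x \<in> X \<Longrightarrow> t x = v" "\<And>x. x \<in> Y \<Longrightarrow> h x = v" using SX SY by blast+
  have ST: "{x \<in> ?T. t x = w} = {x \<in> insert a (A - X) \<union> set (tl es). t x = w}" if "w \<noteq> v" for w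
    using that tv es by auto
  have SH: "{x \<in> ?H. h x = w} = {x \<in> (B - Y) \<union> set es. h x = w}" if "w \<noteq> v" for w
    using that tv es by auto
  have vn: "v \<notin> insert b (set vs')" using Vertex.prems(2) vs by auto
  have lt: "\<And>x. x \<in> A \<Longrightarrow> x < p" "\<And>x. x \<in> B \<Longrightarrow> x < p"
    using Vertex.prems(3,4) by auto
  have "t x \<noteq> v" if "x \<in> insert a (A - X) \<union> set (tl es)" for x
  proof
    assume "t x = v"
    then have "x \<in> insert (Suc p) X" using that es(1) unfolding SX[symmetric] by auto
    then show False using that es Vertex.prems(5,6) Vertex(1) lt by fastforce
  qed
  moreover have "h x \<noteq> v" if "x \<in> (B - Y) \<union> set es" for x
  proof
    assume "h x = v"
    then have "x \<in> insert p Y" using that unfolding SY[symmetric] by auto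
    then show False using that es Vertex(2) lt by fastforce
  qed
  moreover have "insert a (A - X) \<union> set (tl es) \<subseteq> insert a A \<union> set (tl (p # es))" "(B - Y) \<union> set es \<subseteq> B \<union> set (p # es)"
    using es(1) by auto
  ultimately have r: "t ` (insert a (A - X) \<union> set (tl es)) \<subseteq> insert b (set vs')"
      "h ` ((B - Y) \<union> set es) \<subseteq> insert b (set vs')"
    using Vertex.prems(7,8) unfolding vs list.set image_subset_iff by blast+
  have "open_ear t h b a es vs' \<and> length es = length vs' + Suc k \<and>
    (\<forall>v\<in>set vs'. 2 \<le> card {x \<in> insert a (A - X) \<union> set (tl es). t x = v} \<and> 2 \<le> card {x \<in> (B - Y) \<union> set es. h x = v})"
  proof (rule Vertex(6))
    show "bs = map (star t h (insert a (A - X) \<union> set (tl es)) (B - Y \<union> set es)) (vs' @ [b])"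
      unfolding bs
    proof (rule map_cong[OF refl])
      fix w assume "w \<in> set (vs' @ [b])"
      then have "w \<noteq> v" using vn by auto
      then show "star t h ?T ?H w = star t h (insert a (A - X) \<union> set (tl es)) (B - Y \<union> set es) w"
        unfolding star_def using ST[of w] SH[of w] by simp
    qed
  qed (use r Vertex.prems vs in auto)
  note IH = this
  have fin: "finite X" "finite Y" using Vertex.prems(3,4) Vertex(1,2) finite_subset[OF _ finite_lessThan] by (meson subset_trans)+
  have "Suc p \<notin> X" "p \<notin> Y" using Vertex.prems(3,4) Vertex(1,2) by auto
  then have c: "2 \<le> card (insert (Suc p) X)" "2 \<le> card (insert p Y)"
    using fin Vertex(3,4) by (auto simp: Suc_le_eq card_gt_0_iff)
  have "open_ear t h b a (p # es) vs"
    unfolding vs es(1) using IH vn tv(1,2) es(1) by (intro ears_open_ear.Open) auto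
  moreover have "2 \<le> card {x \<in> ?T. t x = w} \<and> 2 \<le> card {x \<in> ?H. h x = w}" if "w \<in> set vs" for w
  proof (cases "w = v")
    case True
    then show ?thesis using c SX SY by simp
  next
    case False
    then show ?thesis using ST[OF False] SH[OF False] IH that vs by simp
  qed
  ultimately show ?case using IH vs by simp
qed

text \<open>The blocks of a leaf partition the pending tails and the pending heads, so suitable end
  maps exist for any list of distinct vertex names: the first block is sent to the first name, and
  elsewhere the maps for the remaining blocks are kept.\<close>

lemma leaf_realization:
  fixes ws :: "'v list"
  shows
  "closed_leaf k p A B es bs \<Longrightarrow> distinct ws \<Longrightarrow> length ws = length bs \<Longrightarrow> A \<subseteq> {..<p} \<Longrightarrow> B \<subseteq> {..<p} \<Longrightarrow>
    \<exists>t h. bs = map (star t h (A \<union> set es) (B \<union> set es)) ws \<and>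
      t ` (A \<union> set es) \<subseteq> set ws \<and> h ` (B \<union> set es) \<subseteq> set ws"
  "open_leaf k a p A B es bs \<Longrightarrow> distinct ws \<Longrightarrow> length ws = length bs \<Longrightarrow> A \<subseteq> {..<p} \<Longrightarrow> B \<subseteq> {..<p} \<Longrightarrow>
    a \<le> p \<Longrightarrow> a \<notin> A \<Longrightarrow>
    \<exists>t h. bs = map (star t h (insert a A \<union> set (tl es)) (B \<union> set es)) ws \<and>
      t ` (insert a A \<union> set (tl es)) \<subseteq> set ws \<and> h ` (B \<union> set es) \<subseteq> set ws"
proof (induction arbitrary: ws and ws rule: closed_leaf_open_leaf.inducts)
  case (Done p A B)
  then obtain w where "ws = [w]" by (cases ws) auto
  then show ?case by (intro exI[of _ "\<lambda>_. w"]) (auto simp: star_def)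
next
  case (Start k p A B es bs)
  obtain es' where es: "es = p # es'"
    using leaf_edges(2)[OF Start(1)] upt_eq_Cons_conv[of p] by (metis list.exhaust)
  have i: "insert p A \<union> set (tl es) = A \<union> set es" using es by auto
  show ?case using Start(2)[of ws] Start.prems unfolding i by auto
next
  case (Finish k p a A B es bs)
  have i: "insert a A \<union> set (tl (p # es)) = insert a A \<union> set es" "B \<union> set (p # es) = insert p B \<union> set es" by auto
  have "insert a A \<subseteq> {..<Suc p}" "insert p B \<subseteq> {..<Suc p}"
    using Finish.prems(3-5) lessThan_Suc[of p] by (auto simp: less_Suc_eq_le)
  then show ?case unfolding i using Finish(2)[of ws] Finish.prems by blast
next
  case (Vertex X A Y B k a p es bs)
  obtain es' where es: "es = Suc p # es'" "\<forall>x\<in>set es'. Suc p < x"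
  proof -
    obtain y ys where y: "es = y # ys" "y # ys = [Suc p..<Suc p + length (y # ys)]"
      using leaf_edges(2)[OF Vertex(5)] by (cases es) auto
    have ys: "y = Suc p" "\<forall>x\<in>set ys. Suc p < x"
      using Cons_eq_upt_length(1,3)[OF y(2)] .
    show ?thesis using that[of ys] y(1) ys by simp
  qed
  obtain w ws' where ws: "ws = w # ws'" using Vertex.prems(2) by (cases ws) auto
  have "\<exists>t h. bs = map (star t h (insert a (A - X) \<union> set (tl es)) (B - Y \<union> set es)) ws' \<and>
      t ` (insert a (A - X) \<union> set (tl es)) \<subseteq> set ws' \<and> h ` (B - Y \<union> set es) \<subseteq> set ws'"
    by (rule Vertex(6)) (use Vertex.prems ws in auto)
  then obtain t h where th: "bs = map (star t h (insert a (A - X) \<union> set (tl es)) (B - Y \<union> set es)) ws'"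
      "t ` (insert a (A - X) \<union> set (tl es)) \<subseteq> set ws'" "h ` (B - Y \<union> set es) \<subseteq> set ws'" by blast
  define t' where "t' = (\<lambda>x. if x \<in> insert (Suc p) X then w else t x)"
  define h' where "h' = (\<lambda>x. if x \<in> insert p Y then w else h x)"
  let ?T = "insert a A \<union> set (tl (p # es))" and ?H = "B \<union> set (p # es)"
  have w: "w \<notin> set ws'" using Vertex.prems ws by auto
  have lt: "\<And>x. x \<in> A \<Longrightarrow> x < p" "\<And>x. x \<in> B \<Longrightarrow> x < p"
    using Vertex.prems(3,4) by auto
  have n: "a \<notin> X" "a \<noteq> Suc p" "p \<notin> Y" "p \<notin> B" "Suc p \<notin> A" "Suc p \<notin> B" "\<forall>x\<in>set es'. x \<notin> A \<and> x \<notin> B \<and> x \<noteq> Suc p \<and> x \<noteq> p"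
    using Vertex.prems(5,6) Vertex(1,2) es(2) lt by fastforce+
  have rt: "t x \<in> set ws'" if "x \<in> ?T" "x \<notin> insert (Suc p) X" for x
    using th(2) that es by auto
  have rh: "h x \<in> set ws'" if "x \<in> ?H" "x \<notin> insert p Y" for x
    using th(3) that es by auto
  have "star t' h' ?T ?H w = (insert (Suc p) X, insert p Y)"
  proof -
    have "{x \<in> ?T. t' x = w} = insert (Suc p) X"
      using rt w Vertex(1) es(1) by (auto simp: t'_def)
    moreover have "{x \<in> ?H. h' x = w} = insert p Y"
      using rh w Vertex(2) by (auto simp: h'_def)
    ultimately show ?thesis by (simp add: star_def)
  qed
  moreover have "star t' h' ?T ?H u = star t h (insert a (A - X) \<union> set (tl es)) (B - Y \<union> set es) u" if "u \<in> set ws'" for u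
  proof -
    have "u \<noteq> w" using that w by auto
    then have "{x \<in> ?T. t' x = u} = {x \<in> insert a (A - X) \<union> set (tl es). t x = u}"
      using n es(1) Vertex(1) by (auto simp: t'_def split: if_splits)
    moreover have "{x \<in> ?H. h' x = u} = {x \<in> B - Y \<union> set es. h x = u}"
      using n es(1) Vertex(2) \<open>u \<noteq> w\<close> by (auto simp: h'_def split: if_splits)
    ultimately show ?thesis by (simp add: star_def)
  qed
  ultimately have 1: "(insert (Suc p) X, insert p Y) # bs = map (star t' h' ?T ?H) ws"
    unfolding ws th(1) by (simp del: set_simps)
  have 2: "t' ` ?T \<subseteq> set ws" "h' ` ?H \<subseteq> set ws"
    using rt rh unfolding ws t'_def h'_def by auto
  show ?case
    by (rule exI[of _ t'], rule exI[of _ h'], intro conjI) (fact 1, fact 2(1), fact 2(2))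
qed

section \<open>Codes of enumerated graphs and isomorphisms\<close>

definition enumerates :: "pgraph \<Rightarrow> nat list \<times> nat list \<Rightarrow> bool" where
  "enumerates \<Gamma> p \<longleftrightarrow> distinct (fst p) \<and> set (fst p) = arcs (fst \<Gamma>) \<and>
     distinct (snd p) \<and> set (snd p) = ordinary \<Gamma>"

text \<open>An edge is replaced by its position and a vertex by its star, the distinguished vertex
  coming last as in a leaf. Every enumeration has a code, not only an ear decomposition, so that
  isomorphism of graphs can be expressed through codes as well.\<close>

definition code :: "pgraph \<Rightarrow> nat list \<times> nat list \<Rightarrow> nat list \<times> (nat set \<times> nat set) list" where
  "code \<Gamma> p = ([0..<length (fst p)],
     map (star (\<lambda>i. tail (fst \<Gamma>) (fst p ! i)) (\<lambda>i. head (fst \<Gamma>) (fst p ! i))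
       {..<length (fst p)} {..<length (fst p)}) (snd p @ [snd \<Gamma>]))"

lemma ear_orders_enumerates: "p \<in> ear_orders \<Gamma> \<Longrightarrow> enumerates \<Gamma> p"
  by (auto simp: ear_orders_def enumerates_def dest: ears_distinct(1))

lemma ex_enumerates:
  assumes "pointed_graph \<Gamma>"
  shows "\<exists>p. enumerates \<Gamma> p"
proof -
  have "finite (arcs (fst \<Gamma>))" "finite (ordinary \<Gamma>)"
    using pointed_graphD[OF assms] by (auto simp: ordinary_def)
  then obtain es vs where "set es = arcs (fst \<Gamma>)" "distinct es" "set vs = ordinary \<Gamma>" "distinct vs"
    using finite_distinct_list by meson
  then have "enumerates \<Gamma> (es, vs)" by (simp add: enumerates_def)
  then show ?thesis ..
qed

lemma verts_eq_insert_ordinary: "pointed_graph \<Gamma> \<Longrightarrow> verts (fst \<Gamma>) = insert (snd \<Gamma>) (ordinary \<Gamma>)"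
  using pointed_graphD(3) by (auto simp: ordinary_def)

text \<open>The relabelling is made extensional so that it can be a component of an element of
  \<open>isos\<close>.\<close>

lemma ex_relabel:
  assumes "distinct xs" "distinct ys" "length xs = length ys"
  shows "\<exists>f. f \<in> extensional (set xs) \<and> bij_betw f (set xs) (set ys) \<and> map f xs = ys"
proof -
  define n where "n = length xs"
  define f where "f = restrict (\<lambda>x. ys ! inv_into {..<n} (nth xs) x) (set xs)"
  have x: "bij_betw (nth xs) {..<n} (set xs)" and y: "bij_betw (nth ys) {..<n} (set ys)"
    using assms by (auto intro!: bij_betw_nth simp: n_def)
  have "bij_betw (nth ys \<circ> inv_into {..<n} (nth xs)) (set xs) (set ys)"
    using bij_betw_trans[OF bij_betw_inv_into[OF x] y] .
  then have "bij_betw f (set xs) (set ys)"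
    by (rule bij_betw_cong[THEN iffD1, rotated]) (auto simp: f_def)
  moreover have "map f xs = ys"
  proof (rule nth_equalityI)
    fix i assume "i < length (map f xs)"
    then have "i < n" by (simp add: n_def)
    then show "map f xs ! i = ys ! i"
      using bij_betw_inv_into_left[OF x] by (simp add: f_def n_def)
  qed (use assms in simp)
  ultimately show ?thesis unfolding f_def by (intro exI[of _ f]) (auto simp: f_def)
qed

lemma isosD:
  assumes "(\<pi>, \<sigma>) \<in> isos \<Gamma> \<Delta>"
  shows "bij_betw \<pi> (verts (fst \<Gamma>)) (verts (fst \<Delta>))" "bij_betw \<sigma> (arcs (fst \<Gamma>)) (arcs (fst \<Delta>))"
    "\<pi> (snd \<Gamma>) = snd \<Delta>"
    "e \<in> arcs (fst \<Gamma>) \<Longrightarrow> tail (fst \<Delta>) (\<sigma> e) = \<pi> (tail (fst \<Gamma>) e)"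
    "e \<in> arcs (fst \<Gamma>) \<Longrightarrow> head (fst \<Delta>) (\<sigma> e) = \<pi> (head (fst \<Gamma>) e)"
  using assms unfolding isos_def by auto

lemma snd_notin_ordinary [simp]: "snd \<Gamma> \<notin> ordinary \<Gamma>"
  by (simp add: ordinary_def)

lemma isos_code:
  assumes "pointed_graph \<Gamma>" "pointed_graph \<Delta>" "(\<pi>, \<sigma>) \<in> isos \<Gamma> \<Delta>" "enumerates \<Gamma> (es, vs)"
  shows "enumerates \<Delta> (map \<sigma> es, map \<pi> vs)" "code \<Delta> (map \<sigma> es, map \<pi> vs) = code \<Gamma> (es, vs)"
proof -
  note iso = isosD[OF assms(3)]
  have e: "distinct es" "set es = arcs (fst \<Gamma>)" "distinct vs" "set vs = ordinary \<Gamma>"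
    using assms(4) by (auto simp: enumerates_def)
  have inj: "inj_on \<pi> (verts (fst \<Gamma>))" "inj_on \<sigma> (arcs (fst \<Gamma>))" using iso by (auto simp: bij_betw_def)
  have "\<pi> ` ordinary \<Gamma> = ordinary \<Delta>"
    unfolding ordinary_def using inj_on_image_set_diff[OF inj(1), of "verts (fst \<Gamma>)" "{snd \<Gamma>}"]
      pointed_graphD(3)[OF assms(1)] iso(1,3) by (auto simp: bij_betw_def)
  then show "enumerates \<Delta> (map \<sigma> es, map \<pi> vs)"
    using e bij_betw_imp_surj_on[OF iso(2)] inj inj_on_subset[OF inj(1), of "ordinary \<Gamma>"]
    unfolding enumerates_def by (simp add: distinct_map) (simp add: ordinary_def)
  have sp: "star (\<lambda>i. tail (fst \<Delta>) (map \<sigma> es ! i)) (\<lambda>i. head (fst \<Delta>) (map \<sigma> es ! i)) {..<length es} {..<length es} (\<pi> v) =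
      star (\<lambda>i. tail (fst \<Gamma>) (es ! i)) (\<lambda>i. head (fst \<Gamma>) (es ! i)) {..<length es} {..<length es} v"
    if v: "v \<in> verts (fst \<Gamma>)" for v
  proof -
    have "tail (fst \<Delta>) (map \<sigma> es ! i) = \<pi> v \<longleftrightarrow> tail (fst \<Gamma>) (es ! i) = v"
      "head (fst \<Delta>) (map \<sigma> es ! i) = \<pi> v \<longleftrightarrow> head (fst \<Gamma>) (es ! i) = v" if "i < length es" for i
    proof -
      have "es ! i \<in> arcs (fst \<Gamma>)" using nth_mem[OF that] unfolding e(2) .
      note x = this
      have m: "map \<sigma> es ! i = \<sigma> (es ! i)" using that by simp
      show "tail (fst \<Delta>) (map \<sigma> es ! i) = \<pi> v \<longleftrightarrow> tail (fst \<Gamma>) (es ! i) = v"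
        unfolding m iso(4)[OF x] by (rule inj_on_eq_iff[OF inj(1) pointed_graphD(4)[OF assms(1) x] v])
      show "head (fst \<Delta>) (map \<sigma> es ! i) = \<pi> v \<longleftrightarrow> head (fst \<Gamma>) (es ! i) = v"
        unfolding m iso(5)[OF x] by (rule inj_on_eq_iff[OF inj(1) pointed_graphD(5)[OF assms(1) x] v])
    qed
    then show ?thesis by (auto simp: star_def)
  qed
  have sub: "v \<in> verts (fst \<Gamma>)" if "v \<in> set (vs @ [snd \<Gamma>])" for v
    using that e verts_eq_insert_ordinary[OF assms(1)] by auto
  have mb: "map \<pi> vs @ [snd \<Delta>] = map \<pi> (vs @ [snd \<Gamma>])" using iso(3) by simp
  show "code \<Delta> (map \<sigma> es, map \<pi> vs) = code \<Gamma> (es, vs)"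
    unfolding code_def fst_conv snd_conv length_map mb map_map prod.inject
  proof (rule conjI, rule refl, rule map_cong, rule refl)
    fix v assume "v \<in> set (vs @ [snd \<Gamma>])"
    from sp[OF sub[OF this]]
    show "(star (\<lambda>i. tail (fst \<Delta>) (map \<sigma> es ! i)) (\<lambda>i. head (fst \<Delta>) (map \<sigma> es ! i)) {..<length es} {..<length es} \<circ> \<pi>) v =
      star (\<lambda>i. tail (fst \<Gamma>) (es ! i)) (\<lambda>i. head (fst \<Gamma>) (es ! i)) {..<length es} {..<length es} v"
      unfolding comp_apply .
  qed
qed

text \<open>The tail of an edge is the vertex whose star contains its position on the tail side, and
  likewise for the head, so a code determines the graph up to names. The isomorphism matches the two
  enumerations entry by entry.\<close>

lemma isos_of_code:
  assumes "pointed_graph \<Gamma>" "pointed_graph \<Delta>" "enumerates \<Gamma> (es, vs)" "enumerates \<Delta> (fs, ws)"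
    and "code \<Gamma> (es, vs) = code \<Delta> (fs, ws)"
  shows "\<exists>(\<pi>, \<sigma>)\<in>isos \<Gamma> \<Delta>. map \<sigma> es = fs \<and> map \<pi> vs = ws"
proof -
  have e: "distinct es" "set es = arcs (fst \<Gamma>)" "distinct (vs @ [snd \<Gamma>])" "set (vs @ [snd \<Gamma>]) = verts (fst \<Gamma>)"
    using assms(3) verts_eq_insert_ordinary[OF assms(1)] by (auto simp: enumerates_def)
  have f: "distinct fs" "set fs = arcs (fst \<Delta>)" "distinct (ws @ [snd \<Delta>])" "set (ws @ [snd \<Delta>]) = verts (fst \<Delta>)"
    using assms(4) verts_eq_insert_ordinary[OF assms(2)] by (auto simp: enumerates_def)
  have len: "length es = length fs"
    using assms(5) by (metis code_def fst_conv length_upt minus_nat.diff_0)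
  let ?n = "length es"
  let ?sG = "star (\<lambda>i. tail (fst \<Gamma>) (es ! i)) (\<lambda>i. head (fst \<Gamma>) (es ! i)) {..<?n} {..<?n}"
  let ?sD = "star (\<lambda>i. tail (fst \<Delta>) (fs ! i)) (\<lambda>i. head (fst \<Delta>) (fs ! i)) {..<?n} {..<?n}"
  have c: "map ?sG (vs @ [snd \<Gamma>]) = map ?sD (ws @ [snd \<Delta>])"
    using arg_cong[OF assms(5), of snd] unfolding code_def fst_conv snd_conv len .
  have lv: "length (vs @ [snd \<Gamma>]) = length (ws @ [snd \<Delta>])" using arg_cong[OF c, of length] by simp
  obtain \<sigma> where s: "\<sigma> \<in> extensional (set es)" "bij_betw \<sigma> (set es) (set fs)" "map \<sigma> es = fs"
    using ex_relabel[OF e(1) f(1) len] by blast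
  obtain \<pi> where p: "\<pi> \<in> extensional (set (vs @ [snd \<Gamma>]))" 
      "bij_betw \<pi> (set (vs @ [snd \<Gamma>])) (set (ws @ [snd \<Delta>]))" "map \<pi> (vs @ [snd \<Gamma>]) = ws @ [snd \<Delta>]"
    using ex_relabel[OF e(3) f(3) lv] by blast
  have pm: "map \<pi> vs = ws" "\<pi> (snd \<Gamma>) = snd \<Delta>" using p(3) by auto
  have sp: "?sG v = ?sD (\<pi> v)" if "v \<in> verts (fst \<Gamma>)" for v
    using c that unfolding p(3)[symmetric] e(4)[symmetric] map_map by (auto simp: comp_def)
  have "tail (fst \<Delta>) (\<sigma> x) = \<pi> (tail (fst \<Gamma>) x) \<and> head (fst \<Delta>) (\<sigma> x) = \<pi> (head (fst \<Gamma>) x)"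
    if "x \<in> arcs (fst \<Gamma>)" for x
  proof -
    obtain i where i: "i < ?n" "es ! i = x" using \<open>x \<in> arcs _\<close> e(2) by (metis in_set_conv_nth)
    have "\<sigma> x = fs ! i" using s(3) i by auto
    moreover have "i \<in> fst (?sG (tail (fst \<Gamma>) x))" "i \<in> snd (?sG (head (fst \<Gamma>) x))"
      using i by (auto simp: star_def)
    ultimately show ?thesis
      using sp[OF pointed_graphD(4)[OF assms(1) that]] sp[OF pointed_graphD(5)[OF assms(1) that]]
      by (auto simp: star_def)
  qed
  then have "(\<pi>, \<sigma>) \<in> isos \<Gamma> \<Delta>"
    using s(1,2) p(1,2) pm(2) e(2,4) f(2,4) unfolding isos_def by auto
  then show ?thesis using s(3) pm(1) by blast
qed

lemma isos_ear_orders: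
  assumes "pointed_graph \<Gamma>" "pointed_graph \<Delta>" "(\<pi>, \<sigma>) \<in> isos \<Gamma> \<Delta>" "(es, vs) \<in> ear_orders \<Gamma>"
  shows "(map \<sigma> es, map \<pi> vs) \<in> ear_orders \<Delta>"
proof -
  note iso = isosD[OF assms(3)]
  have "enumerates \<Delta> (map \<sigma> es, map \<pi> vs)"
    using isos_code(1)[OF assms(1-3)] ear_orders_enumerates[OF assms(4)] by blast
  moreover have "ears (tail (fst \<Delta>)) (head (fst \<Delta>)) (\<pi> (snd \<Gamma>)) (map \<sigma> es) (map \<pi> vs)"
    by (rule ears_map(1)[of "tail (fst \<Gamma>)" "head (fst \<Gamma>)"])
      (use assms(4) iso verts_eq_insert_ordinary[OF assms(1)] in \<open>auto simp: ear_orders_def bij_betw_def\<close>)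
  ultimately show ?thesis using iso(3) by (auto simp: ear_orders_def enumerates_def)
qed

text \<open>Applying automorphisms to the lists of a fixed ear decomposition \<open>q\<close> is a
  bijection from \<open>aut \<Gamma>\<close> onto the ear decompositions with the code of
  \<open>q\<close>: injective because the lists contain all edges and all ordinary vertices, onto
  because equal codes come from an isomorphism.\<close>

lemma card_ear_orders_eq_card_aut:
  assumes "pointed_graph \<Gamma>"
  shows "card (ear_orders \<Gamma>) = card (aut \<Gamma>) * card (code \<Gamma> ` ear_orders \<Gamma>)"
proof -
  have fibre: "card {p \<in> ear_orders \<Gamma>. code \<Gamma> p = code \<Gamma> q} = card (aut \<Gamma>)" if q: "q \<in> ear_orders \<Gamma>" for q
  proof -
    obtain es vs where q': "q = (es, vs)" by force
    have en: "enumerates \<Gamma> (es, vs)" using ear_orders_enumerates q q' by auto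
    then have e: "set es = arcs (fst \<Gamma>)" "insert (snd \<Gamma>) (set vs) = verts (fst \<Gamma>)"
      using verts_eq_insert_ordinary[OF assms] by (auto simp: enumerates_def)
    have "bij_betw (\<lambda>(\<pi>, \<sigma>). (map \<sigma> es, map \<pi> vs)) (aut \<Gamma>) {p \<in> ear_orders \<Gamma>. code \<Gamma> p = code \<Gamma> q}"
      unfolding bij_betw_def
    proof (intro conjI inj_onI subset_antisym subsetI)
      fix x y assume xy: "x \<in> aut \<Gamma>" "y \<in> aut \<Gamma>"
        "(\<lambda>(\<pi>, \<sigma>). (map \<sigma> es, map \<pi> vs)) x = (\<lambda>(\<pi>, \<sigma>). (map \<sigma> es, map \<pi> vs)) y"
      obtain \<pi> \<sigma> \<pi>' \<sigma>' where p: "x = (\<pi>, \<sigma>)" "y = (\<pi>', \<sigma>')" by force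
      have m: "map \<sigma> es = map \<sigma>' es" "map \<pi> vs = map \<pi>' vs" using xy(3) unfolding p by auto
      have x: "\<pi> \<in> extensional (verts (fst \<Gamma>))" "\<pi>' \<in> extensional (verts (fst \<Gamma>))"
        "\<sigma> \<in> extensional (arcs (fst \<Gamma>))" "\<sigma>' \<in> extensional (arcs (fst \<Gamma>))"
        "\<pi> (snd \<Gamma>) = \<pi>' (snd \<Gamma>)"
        using xy(1,2) unfolding p isos_def by auto
      \<comment> \<open>Agreement on the entries of \<open>es\<close> is agreement on all edges, and
        off the edges both maps are extensional.\<close>
      have "\<sigma> = \<sigma>'"
        using m(1) by (intro extensionalityI[OF x(3,4)]) (simp flip: e(1))
      moreover have "\<pi> = \<pi>'"
        using m(2) x(5) by (intro extensionalityI[OF x(1,2)]) (auto simp flip: e(2))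
      ultimately show "x = y" using p by simp
    next
      fix p assume "p \<in> (\<lambda>(\<pi>, \<sigma>). (map \<sigma> es, map \<pi> vs)) ` aut \<Gamma>"
      then obtain \<pi> \<sigma> where i: "(\<pi>, \<sigma>) \<in> aut \<Gamma>" "p = (map \<sigma> es, map \<pi> vs)" by auto
      show "p \<in> {p \<in> ear_orders \<Gamma>. code \<Gamma> p = code \<Gamma> q}"
        using isos_code(2)[OF assms assms i(1) en] isos_ear_orders[OF assms assms i(1)] q
        unfolding q' i(2) by blast
    next
      fix p assume p: "p \<in> {p \<in> ear_orders \<Gamma>. code \<Gamma> p = code \<Gamma> q}"
      obtain fs ws where p': "p = (fs, ws)" by force
      have "\<exists>(\<pi>, \<sigma>)\<in>isos \<Gamma> \<Gamma>. map \<sigma> es = fs \<and> map \<pi> vs = ws"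
      proof (rule isos_of_code[OF assms assms en])
        show "enumerates \<Gamma> (fs, ws)" using p ear_orders_enumerates unfolding p' by blast
        show "code \<Gamma> (es, vs) = code \<Gamma> (fs, ws)" using p unfolding p' q' by simp
      qed
      then show "p \<in> (\<lambda>(\<pi>, \<sigma>). (map \<sigma> es, map \<pi> vs)) ` aut \<Gamma>" using p' by force
    qed
    from bij_betw_same_card[OF this] show ?thesis by (rule sym)
  qed
  have "card (ear_orders \<Gamma>) = (\<Sum>l\<in>code \<Gamma> ` ear_orders \<Gamma>. card {p \<in> ear_orders \<Gamma>. code \<Gamma> p = l})"
    using sum.image_gen[OF finite_ear_orders[OF assms], of "\<lambda>_. 1::nat" "code \<Gamma>"] by simp
  also have "\<dots> = (\<Sum>l\<in>code \<Gamma> ` ear_orders \<Gamma>. card (aut \<Gamma>))"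
    using fibre by (intro sum.cong) auto
  finally show ?thesis by simp
qed

section \<open>Leaves as codes of ear decompositions of stable graphs\<close>

definition leaves :: "nat \<Rightarrow> (nat list \<times> (nat set \<times> nat set) list) set" where
  "leaves k = {(es, bs). closed_leaf k 0 {} {} es bs}"

lemma card_index_set:
  assumes "distinct es"
  shows "card {i \<in> {..<length es}. P (es ! i)} = card {e \<in> set es. P e}"
proof (rule bij_betw_same_card[of "nth es"])
  show "bij_betw (nth es) {i \<in> {..<length es}. P (es ! i)} {e \<in> set es. P e}"
    by (rule bij_betw_subset[OF bij_betw_nth[OF assms refl refl]])
      (auto simp: image_iff in_set_conv_nth)
qed

lemma sc_stable_graphsD:
  assumes "\<Gamma> \<in> sc_stable_graphs k"
  shows "pointed_graph \<Gamma>" "strongly_connected (fst \<Gamma>)" "stable \<Gamma>"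
    "card (arcs (fst \<Gamma>)) = card (ordinary \<Gamma>) + k"
  using assms by (auto simp: sc_stable_graphs_def weight_def)

lemma code_in_leaves:
  assumes "\<Gamma> \<in> sc_stable_graphs k" "p \<in> ear_orders \<Gamma>"
  shows "code \<Gamma> p \<in> leaves k"
proof -
  obtain es vs where p: "p = (es, vs)" by force
  note \<Gamma> = sc_stable_graphsD[OF assms(1)]
  have e: "distinct es" "set es = arcs (fst \<Gamma>)" "distinct vs" "set vs = ordinary \<Gamma>"
    using ear_orders_enumerates[OF assms(2)] by (auto simp: enumerates_def p)
  define n where "n = length es"
  define t where "t i = tail (fst \<Gamma>) (es ! i)" for i
  define h where "h i = head (fst \<Gamma>) (es ! i)" for i
  \<comment> \<open>\<sigma> takes an edge to its position in \<open>es\<close>, so the transported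
    ear decomposition lists the edges as \<open>[0..<n]\<close>, as a leaf does.\<close>
  define \<sigma> where "\<sigma> = inv_into {..<n} (nth es)"
  have bij: "bij_betw (nth es) {..<n} (set es)" using e(1) by (auto intro: bij_betw_nth simp: n_def)
  have inv: "es ! \<sigma> x = x" if "x \<in> set es" for x
    unfolding \<sigma>_def using bij_betw_inv_into_right[OF bij that] .
  have "map \<sigma> es = [0..<n]"
  proof (rule nth_equalityI)
    fix i assume "i < length (map \<sigma> es)"
    then show "map \<sigma> es ! i = [0..<n] ! i"
      using bij_betw_inv_into_left[OF bij, of i] by (simp add: \<sigma>_def n_def)
  qed (simp add: n_def)
  moreover have "ears t h (id (snd \<Gamma>)) (map \<sigma> es) (map id vs)"
  proof (rule ears_map(1))
    show "ears (tail (fst \<Gamma>)) (head (fst \<Gamma>)) (snd \<Gamma>) es vs"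
      using assms(2) by (simp add: ear_orders_def p)
  qed (auto simp: t_def h_def inv)
  ultimately have "ears t h (snd \<Gamma>) [0..<n] vs" by simp
  then have "closed_leaf k 0 {} {} [0..<n] (map (star t h ({} \<union> set [0..<n]) ({} \<union> set [0..<n])) (vs @ [snd \<Gamma>]))"
  proof (rule ears_imp_leaf(1))
    fix v assume "v \<in> set vs"
    then have "out_degree (fst \<Gamma>) v \<ge> 2" "in_degree (fst \<Gamma>) v \<ge> 2"
      using \<Gamma>(3) e(4) by (auto simp: stable_def)
    moreover have "card {x \<in> {} \<union> set [0..<n]. t x = v} = out_degree (fst \<Gamma>) v"
      "card {x \<in> {} \<union> set [0..<n]. h x = v} = in_degree (fst \<Gamma>) v"
      using card_index_set[OF e(1), of "\<lambda>e. tail (fst \<Gamma>) e = v"] card_index_set[OF e(1), of "\<lambda>e. head (fst \<Gamma>) e = v"] e(2)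
      by (auto simp: out_degree_def in_degree_def out_arcs_def in_arcs_def t_def h_def n_def atLeast0LessThan)
    ultimately show "2 \<le> card {x \<in> {} \<union> set [0..<n]. t x = v} \<and> 2 \<le> card {x \<in> {} \<union> set [0..<n]. h x = v}"
      by simp
  next
    show "length [0..<n] = length vs + k"
      using \<Gamma>(4) distinct_card[OF e(1)] distinct_card[OF e(3)] e(2,4) by (simp add: n_def)
  qed auto
  moreover have "code \<Gamma> p = ([0..<n], map (star t h ({} \<union> set [0..<n]) ({} \<union> set [0..<n])) (vs @ [snd \<Gamma>]))"
    by (simp add: code_def p t_def[abs_def] h_def[abs_def] n_def atLeast0LessThan)
  ultimately show ?thesis by (simp add: leaves_def)
qed

lemma leaves_realized:
  assumes "l \<in> leaves k"
  shows "\<exists>\<Gamma>\<in>sc_stable_graphs k. \<exists>p\<in>ear_orders \<Gamma>. code \<Gamma> p = l"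
proof -
  obtain es bs where l: "l = (es, bs)" "closed_leaf k 0 {} {} es bs" using assms by (auto simp: leaves_def)
  define n m where "n = length es" and "m = length bs - 1"
  have es: "es = [0..<n]" and bs: "bs \<noteq> []" using leaf_edges(1)[OF l(2)] by (auto simp: n_def)
  have ws: "[0..<length bs] = [0..<m] @ [m]" using bs by (cases "length bs") (auto simp: m_def)
  obtain t h where th: "bs = map (star t h ({} \<union> set es) ({} \<union> set es)) [0..<length bs]"
      "t ` ({} \<union> set es) \<subseteq> set [0..<length bs]" "h ` ({} \<union> set es) \<subseteq> set [0..<length bs]"
    using leaf_realization(1)[OF l(2), of "[0..<length bs]"] by auto
  have L: "ears t h m es [0..<m] \<and> length es = length [0..<m] + k \<and>
    (\<forall>v\<in>set [0..<m]. 2 \<le> card {x \<in> {} \<union> set es. t x = v} \<and> 2 \<le> card {x \<in> {} \<union> set es. h x = v})"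
  proof (rule leaf_imp_ears(1)[OF l(2)])
    show "bs = map (star t h ({} \<union> set es) ({} \<union> set es)) ([0..<m] @ [m])" using th(1) unfolding ws .
    show "t ` ({} \<union> set es) \<subseteq> insert m (set [0..<m])" "h ` ({} \<union> set es) \<subseteq> insert m (set [0..<m])"
      using th(2,3) unfolding ws by auto
  qed auto
  \<comment> \<open>The vertices are the positions of the blocks; \<open>m\<close> is the
    distinguished one, since the last block is that of the function.\<close>
  define G where "G = \<lparr>verts = {..m}, arcs = {..<n}, tail = t, head = h\<rparr>"
  have ses: "set es = {..<n}" using es by (simp add: atLeast0LessThan)
  have vm: "set [0..<length bs] = {..m}" unfolding ws by auto
  have pg: "pointed_graph (G, m)"
    using th(2,3) unfolding vm ses by (intro pointed_graphI) (auto simp: G_def)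
  have ord: "ordinary (G, m) = {..<m}" by (auto simp: ordinary_def G_def)
  have eo: "(es, [0..<m]) \<in> ear_orders (G, m)"
    using L ses unfolding ear_orders_def ord by (simp add: G_def atLeast0LessThan) (simp add: es)
  have "out_degree G v = card {x \<in> {} \<union> set es. t x = v}" "in_degree G v = card {x \<in> {} \<union> set es. h x = v}" for v
    unfolding ses by (simp_all add: out_degree_def in_degree_def out_arcs_def in_arcs_def G_def)
  then have "stable (G, m)" using L unfolding stable_def ord by (auto simp: atLeast0LessThan)
  moreover have "weight (G, m) = int k"
    using L unfolding weight_def ord by (simp add: G_def n_def)
  ultimately have sc: "(G, m) \<in> sc_stable_graphs k"
    using pg ear_orders_strongly_connected[OF pg eo] by (simp add: sc_stable_graphs_def)
  have "code (G, m) (es, [0..<m]) = (es, bs)"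
  proof -
    have "star (\<lambda>i. tail G (es ! i)) (\<lambda>i. head G (es ! i)) {..<n} {..<n} v = star t h ({} \<union> set es) ({} \<union> set es) v" for v
      unfolding ses using es by (auto simp: star_def G_def)
    then show ?thesis
      using th(1) unfolding ws by (simp add: code_def n_def[symmetric]) (simp add: es)
  qed
  then show ?thesis using sc eo l(1) by blast
qed

section \<open>Isomorphism classes of stable graphs\<close>

definition iso_rel :: "nat \<Rightarrow> (pgraph \<times> pgraph) set" where
  "iso_rel k = {(\<Gamma>, \<Delta>). \<Gamma> \<in> sc_stable_graphs k \<and> \<Delta> \<in> sc_stable_graphs k \<and> isos \<Gamma> \<Delta> \<noteq> {}}"

text \<open>Expresses isomorphism by equality of codes. A single enumeration of \<Gamma> is enough,
  as an isomorphism carries it over to \<Delta>.\<close>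

lemma iso_rel_code:
  assumes "\<Gamma> \<in> sc_stable_graphs k" "\<Delta> \<in> sc_stable_graphs k" "enumerates \<Gamma> p"
  shows "(\<Gamma>, \<Delta>) \<in> iso_rel k \<longleftrightarrow> (\<exists>q. enumerates \<Delta> q \<and> code \<Delta> q = code \<Gamma> p)"
proof -
  obtain es vs where p: "p = (es, vs)" by force
  note pg = sc_stable_graphsD(1)[OF assms(1)] sc_stable_graphsD(1)[OF assms(2)]
  show ?thesis
  proof
    assume "(\<Gamma>, \<Delta>) \<in> iso_rel k"
    then obtain \<pi> \<sigma> where "(\<pi>, \<sigma>) \<in> isos \<Gamma> \<Delta>" by (auto simp: iso_rel_def)
    then show "\<exists>q. enumerates \<Delta> q \<and> code \<Delta> q = code \<Gamma> p"
      using isos_code[OF pg _ assms(3)[unfolded p]] unfolding p by blast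
  next
    assume "\<exists>q. enumerates \<Delta> q \<and> code \<Delta> q = code \<Gamma> p"
    then obtain fs ws where q: "enumerates \<Delta> (fs, ws)" "code \<Delta> (fs, ws) = code \<Gamma> (es, vs)"
      unfolding p by force
    have "\<exists>(\<pi>, \<sigma>)\<in>isos \<Gamma> \<Delta>. map \<sigma> es = fs \<and> map \<pi> vs = ws"
      by (rule isos_of_code[OF pg assms(3)[unfolded p] q(1) q(2)[symmetric]])
    then show "(\<Gamma>, \<Delta>) \<in> iso_rel k" using assms(1,2) by (auto simp: iso_rel_def)
  qed
qed

text \<open>Symmetry and transitivity are inherited from equality of codes, so no inverses or
  composites of extensional maps have to be formed.\<close>

lemma equiv_iso_rel: "equiv (sc_stable_graphs k) (iso_rel k)"
proof (rule equivI)
  show "iso_rel k \<subseteq> sc_stable_graphs k \<times> sc_stable_graphs k" by (auto simp: iso_rel_def)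
  show "refl_on (sc_stable_graphs k) (iso_rel k)"
  proof (rule refl_onI)
    fix \<Gamma> assume g: "\<Gamma> \<in> sc_stable_graphs k"
    obtain p where "enumerates \<Gamma> p" using ex_enumerates[OF sc_stable_graphsD(1)[OF g]] ..
    then show "(\<Gamma>, \<Gamma>) \<in> iso_rel k" unfolding iso_rel_code[OF g g \<open>enumerates \<Gamma> p\<close>] by blast
  qed
  show "sym (iso_rel k)"
  proof (rule symI)
    fix \<Gamma> \<Delta> assume i: "(\<Gamma>, \<Delta>) \<in> iso_rel k"
    then have g: "\<Gamma> \<in> sc_stable_graphs k" "\<Delta> \<in> sc_stable_graphs k" by (auto simp: iso_rel_def)
    obtain p where p: "enumerates \<Gamma> p" using ex_enumerates[OF sc_stable_graphsD(1)[OF g(1)]] ..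
    obtain q where q: "enumerates \<Delta> q" "code \<Delta> q = code \<Gamma> p" using i iso_rel_code[OF g p] by auto
    show "(\<Delta>, \<Gamma>) \<in> iso_rel k" unfolding iso_rel_code[OF g(2,1) q(1)] using p q(2) by metis
  qed
  show "trans (iso_rel k)"
  proof (rule transI)
    fix \<Gamma> \<Delta> \<Theta> assume i: "(\<Gamma>, \<Delta>) \<in> iso_rel k" "(\<Delta>, \<Theta>) \<in> iso_rel k"
    then have g: "\<Gamma> \<in> sc_stable_graphs k" "\<Delta> \<in> sc_stable_graphs k" "\<Theta> \<in> sc_stable_graphs k" by (auto simp: iso_rel_def)
    obtain p where p: "enumerates \<Gamma> p" using ex_enumerates[OF sc_stable_graphsD(1)[OF g(1)]] ..
    obtain q where q: "enumerates \<Delta> q" "code \<Delta> q = code \<Gamma> p" using i(1) iso_rel_code[OF g(1,2) p] by auto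
    obtain r where r: "enumerates \<Theta> r" "code \<Theta> r = code \<Delta> q" using i(2) iso_rel_code[OF g(2,3) q(1)] by auto
    show "(\<Gamma>, \<Theta>) \<in> iso_rel k" unfolding iso_rel_code[OF g(1,3) p] using r q(2) by metis
  qed
qed

text \<open>Counting edges by their tails, stability yields at least twice as many edges as ordinary
  vertices, while the weight fixes the difference of the two numbers as \<open>k\<close>.\<close>

lemma stable_card_bounds:
  assumes "\<Gamma> \<in> sc_stable_graphs k"
  shows "card (ordinary \<Gamma>) \<le> k" "card (arcs (fst \<Gamma>)) \<le> 2 * k"
proof -
  note \<Gamma> = sc_stable_graphsD[OF assms] and fin = pointed_graphD(1,2)[OF sc_stable_graphsD(1)[OF assms]]
  have fo: "finite (ordinary \<Gamma>)" using fin by (simp add: ordinary_def)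
  have fa: "finite (out_arcs (fst \<Gamma>) v)" for v using fin by (simp add: out_arcs_def)
  have "2 * card (ordinary \<Gamma>) = (\<Sum>v\<in>ordinary \<Gamma>. 2)" by simp
  also have "\<dots> \<le> (\<Sum>v\<in>ordinary \<Gamma>. card (out_arcs (fst \<Gamma>) v))"
    using \<Gamma>(3) by (intro sum_mono) (auto simp: stable_def out_degree_def)
  also have "\<dots> = card (\<Union>v\<in>ordinary \<Gamma>. out_arcs (fst \<Gamma>) v)"
    using fo fa by (intro card_UN_disjoint[symmetric]) auto
  also have "\<dots> \<le> card (arcs (fst \<Gamma>))" using fin by (intro card_mono) auto
  finally show "card (ordinary \<Gamma>) \<le> k" "card (arcs (fst \<Gamma>)) \<le> 2 * k" using \<Gamma>(4) by auto
qed

lemma sc_stable_classes_eq: "sc_stable_classes k = sc_stable_graphs k // iso_rel k"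
  by (simp add: sc_stable_classes_def iso_rel_def)

lemma class_representative:
  assumes "\<C> \<in> sc_stable_classes k"
  shows "(SOME \<Gamma>. \<Gamma> \<in> \<C>) \<in> \<C>" "(SOME \<Gamma>. \<Gamma> \<in> \<C>) \<in> sc_stable_graphs k"
proof -
  have "\<C> \<noteq> {}" "\<C> \<subseteq> sc_stable_graphs k"
    using assms in_quotient_imp_non_empty[OF equiv_iso_rel] in_quotient_imp_subset[OF equiv_iso_rel]
    unfolding sc_stable_classes_eq by auto
  then show "(SOME \<Gamma>. \<Gamma> \<in> \<C>) \<in> \<C>" "(SOME \<Gamma>. \<Gamma> \<in> \<C>) \<in> sc_stable_graphs k"
    by (metis ex_in_conv someI_ex subsetD)+
qed

lemma class_eqI:
  assumes "\<C> \<in> sc_stable_classes k" "\<C>' \<in> sc_stable_classes k" "\<Gamma> \<in> \<C>" "\<Delta> \<in> \<C>'" "(\<Gamma>, \<Delta>) \<in> iso_rel k"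
  shows "\<C> = \<C>'"
  using quotient_eqI[OF equiv_iso_rel] assms unfolding sc_stable_classes_eq by blast

text \<open>A class is determined by the code of its representative under some enumeration, and with
  at most \<open>2 * k\<close> edges and \<open>k + 1\<close> vertices only finitely many codes are
  possible.\<close>

lemma finite_sc_stable_classes: "finite (sc_stable_classes k)"
proof -
  let ?rep = "\<lambda>\<C>. SOME \<Gamma>. \<Gamma> \<in> (\<C> :: pgraph set)"
  let ?f = "\<lambda>\<C>. code (?rep \<C>) (SOME p. enumerates (?rep \<C>) p)"
  let ?A = "(\<lambda>n. [0..<n]) ` {..2 * k}"
  let ?B = "{bs. set bs \<subseteq> Pow {..<2 * k} \<times> Pow {..<2 * k} \<and> length bs \<le> Suc k}"
  have en: "enumerates (?rep \<C>) (SOME p. enumerates (?rep \<C>) p)" if "\<C> \<in> sc_stable_classes k" for \<C>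
    using ex_enumerates[OF sc_stable_graphsD(1)[OF class_representative(2)[OF that]]] by (rule someI_ex)
  have "inj_on ?f (sc_stable_classes k)"
  proof (rule inj_onI)
    fix \<C> \<D> assume c: "\<C> \<in> sc_stable_classes k" "\<D> \<in> sc_stable_classes k" "?f \<C> = ?f \<D>"
    have "(?rep \<C>, ?rep \<D>) \<in> iso_rel k"
      unfolding iso_rel_code[OF class_representative(2)[OF c(1)] class_representative(2)[OF c(2)] en[OF c(1)]]
      using c(3) en[OF c(2)] by metis
    then show "\<C> = \<D>"
      using class_eqI[OF c(1,2) class_representative(1)[OF c(1)] class_representative(1)[OF c(2)]] by blast
  qed
  moreover have "?f ` sc_stable_classes k \<subseteq> ?A \<times> ?B"
  proof
    fix l assume "l \<in> ?f ` sc_stable_classes k"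
    then obtain \<Gamma> p where g: "\<Gamma> \<in> sc_stable_graphs k" "enumerates \<Gamma> p" "l = code \<Gamma> p"
      using class_representative(2) en by blast
    have "length (fst p) = card (arcs (fst \<Gamma>))" "length (snd p) = card (ordinary \<Gamma>)"
      using g(2) distinct_card unfolding enumerates_def by metis+
    then have "length (fst p) \<le> 2 * k" "length (snd p) \<le> k" using stable_card_bounds[OF g(1)] by auto
    then show "l \<in> ?A \<times> ?B" unfolding g(3) code_def by (auto simp: star_def)
  qed
  moreover have "finite (?A \<times> ?B)"
    using finite_lists_length_le[of "Pow {..<2 * k} \<times> Pow {..<2 * k}" "Suc k"] by simp
  ultimately show ?thesis using finite_imageD finite_subset by blast
qed

lemma finite_code_image: "\<Gamma> \<in> sc_stable_graphs k \<Longrightarrow> finite (code \<Gamma> ` ear_orders \<Gamma>)"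
  using finite_ear_orders sc_stable_graphsD(1) by blast

text \<open>A leaf is the code of an ear decomposition of some stable graph; an isomorphism carries
  this decomposition to the chosen representative of the class without changing the code.\<close>

lemma leaves_eq_Union:
  "leaves k = (\<Union>\<C>\<in>sc_stable_classes k. code (SOME \<Gamma>. \<Gamma> \<in> \<C>) ` ear_orders (SOME \<Gamma>. \<Gamma> \<in> \<C>))"
proof (intro subset_antisym subsetI)
  fix l assume "l \<in> leaves k"
  then obtain \<Gamma> p where g: "\<Gamma> \<in> sc_stable_graphs k" "p \<in> ear_orders \<Gamma>" "code \<Gamma> p = l"
    using leaves_realized by blast
  define \<C> where "\<C> = iso_rel k `` {\<Gamma>}"
  have C: "\<C> \<in> sc_stable_classes k" unfolding \<C>_def sc_stable_classes_eq using g(1) by (rule quotientI)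
  define \<Delta> where "\<Delta> = (SOME \<Gamma>. \<Gamma> \<in> \<C>)"
  have D: "\<Delta> \<in> sc_stable_graphs k" "(\<Gamma>, \<Delta>) \<in> iso_rel k"
    using class_representative[OF C] unfolding \<Delta>_def by (auto simp: \<C>_def)
  obtain \<pi> \<sigma> where i: "(\<pi>, \<sigma>) \<in> isos \<Gamma> \<Delta>" using D(2) by (auto simp: iso_rel_def)
  obtain es vs where p: "p = (es, vs)" by force
  note pg = sc_stable_graphsD(1)[OF g(1)] sc_stable_graphsD(1)[OF D(1)]
  have "(map \<sigma> es, map \<pi> vs) \<in> ear_orders \<Delta>"
    using isos_ear_orders[OF pg i] g(2) unfolding p .
  moreover have "code \<Delta> (map \<sigma> es, map \<pi> vs) = l"
    using isos_code(2)[OF pg i] ear_orders_enumerates[OF g(2)] g(3) unfolding p by blast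
  ultimately have "l \<in> code \<Delta> ` ear_orders \<Delta>" by blast
  then show "l \<in> (\<Union>\<C>\<in>sc_stable_classes k. code (SOME \<Gamma>. \<Gamma> \<in> \<C>) ` ear_orders (SOME \<Gamma>. \<Gamma> \<in> \<C>))"
    using C unfolding \<Delta>_def by blast
next
  fix l assume "l \<in> (\<Union>\<C>\<in>sc_stable_classes k. code (SOME \<Gamma>. \<Gamma> \<in> \<C>) ` ear_orders (SOME \<Gamma>. \<Gamma> \<in> \<C>))"
  then show "l \<in> leaves k" using code_in_leaves class_representative(2) by blast
qed

lemma code_image_disjoint:
  assumes "\<C> \<in> sc_stable_classes k" "\<D> \<in> sc_stable_classes k" "\<C> \<noteq> \<D>"
  shows "code (SOME \<Gamma>. \<Gamma> \<in> \<C>) ` ear_orders (SOME \<Gamma>. \<Gamma> \<in> \<C>) \<inter>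
    code (SOME \<Gamma>. \<Gamma> \<in> \<D>) ` ear_orders (SOME \<Gamma>. \<Gamma> \<in> \<D>) = {}"
proof (rule ccontr)
  define \<Gamma> where "\<Gamma> = (SOME \<Gamma>. \<Gamma> \<in> \<C>)"
  define \<Delta> where "\<Delta> = (SOME \<Gamma>. \<Gamma> \<in> \<D>)"
  note r = class_representative[OF assms(1), folded \<Gamma>_def] class_representative[OF assms(2), folded \<Delta>_def]
  assume "\<not> ?thesis"
  then obtain l where l: "l \<in> code \<Gamma> ` ear_orders \<Gamma>" "l \<in> code \<Delta> ` ear_orders \<Delta>"
    unfolding \<Gamma>_def[symmetric] \<Delta>_def[symmetric] by blast
  obtain p where p: "p \<in> ear_orders \<Gamma>" "code \<Gamma> p = l" using l(1) by auto
  obtain q where q: "q \<in> ear_orders \<Delta>" "code \<Delta> q = l" using l(2) by auto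
  have pq: "p \<in> ear_orders \<Gamma>" "q \<in> ear_orders \<Delta>" "code \<Delta> q = code \<Gamma> p"
    using p q by simp_all
  have "(\<Gamma>, \<Delta>) \<in> iso_rel k"
    unfolding iso_rel_code[OF r(2,4) ear_orders_enumerates[OF pq(1)]]
    using pq ear_orders_enumerates by blast
  then show False using class_eqI[OF assms(1,2) r(1,3)] assms(3) by blast
qed

text \<open>Each isomorphism class contributes \<open>|ear_orders| / |Aut|\<close> leaves, because the automorphism group
  acts freely on the ear orders and its orbits are the fibres of \<open>code\<close>.\<close>

lemma sum_leaves:
  fixes F :: "nat list \<times> (nat set \<times> nat set) list \<Rightarrow> 'c::field_char_0"
  assumes "\<And>\<Gamma> p. \<Gamma> \<in> sc_stable_graphs k \<Longrightarrow> p \<in> ear_orders \<Gamma> \<Longrightarrow> F (code \<Gamma> p) = W \<Gamma>"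
  shows "(\<Sum>l\<in>leaves k. F l) = (\<Sum>\<C>\<in>sc_stable_classes k. let \<Gamma> = (SOME \<Gamma>. \<Gamma> \<in> \<C>) in
     of_nat (phi \<Gamma>) / of_nat (card (aut \<Gamma>)) * W \<Gamma>)"
proof -
  have "(\<Sum>l\<in>leaves k. F l) =
    (\<Sum>\<C>\<in>sc_stable_classes k. \<Sum>l\<in>code (SOME \<Gamma>. \<Gamma> \<in> \<C>) ` ear_orders (SOME \<Gamma>. \<Gamma> \<in> \<C>). F l)"
    unfolding leaves_eq_Union
    using finite_sc_stable_classes finite_code_image[OF class_representative(2)] code_image_disjoint
    by (intro sum.UNION_disjoint) blast+
  also have "\<dots> = (\<Sum>\<C>\<in>sc_stable_classes k. let \<Gamma> = (SOME \<Gamma>. \<Gamma> \<in> \<C>) in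
     of_nat (phi \<Gamma>) / of_nat (card (aut \<Gamma>)) * W \<Gamma>)"
  proof (rule sum.cong[OF refl])
    fix \<C> assume "\<C> \<in> sc_stable_classes k"
    define \<Gamma> where "\<Gamma> = (SOME \<Gamma>. \<Gamma> \<in> \<C>)"
    have g: "\<Gamma> \<in> sc_stable_graphs k" unfolding \<Gamma>_def by (rule class_representative(2)) fact
    note pg = sc_stable_graphsD(1)[OF g]
    have phi: "phi \<Gamma> = card (aut \<Gamma>) * card (code \<Gamma> ` ear_orders \<Gamma>)"
      unfolding phi_eq_card_ear_orders[OF pg] by (rule card_ear_orders_eq_card_aut[OF pg])
    have "(\<Sum>l\<in>code \<Gamma> ` ear_orders \<Gamma>. F l) = of_nat (card (code \<Gamma> ` ear_orders \<Gamma>)) * W \<Gamma>"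
    proof -
      have "(\<Sum>l\<in>code \<Gamma> ` ear_orders \<Gamma>. F l) = (\<Sum>l\<in>code \<Gamma> ` ear_orders \<Gamma>. W \<Gamma>)"
        using assms[OF g] by (intro sum.cong) auto
      then show ?thesis by simp
    qed
    also have "\<dots> = of_nat (phi \<Gamma>) / of_nat (card (aut \<Gamma>)) * W \<Gamma>"
    proof (cases "card (aut \<Gamma>) = 0")
      \<comment> \<open>Division by zero yields zero; by the counting identity there are then no ear
        decompositions either, so both sides vanish.\<close>
      case True
      then have "ear_orders \<Gamma> = {}"
        using card_ear_orders_eq_card_aut[OF pg] finite_ear_orders[OF pg] by simp
      then show ?thesis using True by simp
    next
      case False
      then show ?thesis unfolding phi by simp
    qed
    finally show "(\<Sum>l\<in>code (SOME \<Gamma>. \<Gamma> \<in> \<C>) ` ear_orders (SOME \<Gamma>. \<Gamma> \<in> \<C>). F l) =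
      (let \<Gamma> = (SOME \<Gamma>. \<Gamma> \<in> \<C>) in of_nat (phi \<Gamma>) / of_nat (card (aut \<Gamma>)) * W \<Gamma>)"
      unfolding \<Gamma>_def[symmetric] Let_def .
  qed
  finally show ?thesis .
qed

section \<open>Smooth functions and Wirtinger derivatives\<close>

lemma frechet_derivativeI:
  "(f has_derivative D) (at z) \<Longrightarrow> frechet_derivative f (at z) v = D v"
  by (metis frechet_derivative_at)

lemma has_derivative_frechet:
  "f differentiable (at z) \<Longrightarrow> (f has_derivative frechet_derivative f (at z)) (at z)"
  by (simp add: frechet_derivative_works)

lemma C_on_cong:
  assumes "open S" "\<And>z. z \<in> S \<Longrightarrow> f z = g z" "C_on n S f"
  shows "C_on n S g"
  using assms(2,3)
proof (induction n arbitrary: f g)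
  case 0
  then show ?case by (simp add: continuous_on_cong[of S S f g])
next
  case (Suc n)
  have "g differentiable (at z)" if "z \<in> S" for z
  proof -
    have "(f has_derivative frechet_derivative f (at z)) (at z)"
      using Suc.prems that by (auto intro: has_derivative_frechet)
    then show ?thesis
      using has_derivative_transform_within_open[OF _ assms(1) that] Suc.prems(1) differentiable_def by blast
  qed
  moreover have "C_on n S (\<lambda>z. frechet_derivative g (at z) v)" for v
  proof (rule Suc.IH)
    show "C_on n S (\<lambda>z. frechet_derivative f (at z) v)" using Suc.prems by simp
    show "frechet_derivative f (at z) v = frechet_derivative g (at z) v" if "z \<in> S" for z
      using frechet_derivative_transform_within_open[of f z S g] Suc.prems assms(1) that by auto
  qed
  ultimately show ?case by simp
qed

lemma C_on_Suc_D: "C_on (Suc n) S f \<Longrightarrow> C_on n S f"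
proof (induction n arbitrary: f)
  case 0
  then show ?case
    by (auto intro!: continuous_at_imp_continuous_on differentiable_imp_continuous_within)
next
  case (Suc n)
  show ?case unfolding C_on.simps(2)[of n]
  proof (intro conjI allI ballI)
    show "f differentiable (at z)" if "z \<in> S" for z using Suc.prems that by simp
    show "C_on n S (\<lambda>z. frechet_derivative f (at z) v)" for v
      using Suc.prems by (intro Suc.IH) simp
  qed
qed

lemma C_on_differentiable: "C_on (Suc n) S f \<Longrightarrow> z \<in> S \<Longrightarrow> f differentiable (at z)"
  by simp

text \<open>The closure properties below use this form with an explicit derivative, so that their
  induction hypotheses apply to the formula of a differentiation rule.\<close>

lemma C_on_SucI:
  assumes "open S" "\<And>z. z \<in> S \<Longrightarrow> (f has_derivative D z) (at z)" "\<And>v. C_on n S (\<lambda>z. D z v)"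
  shows "C_on (Suc n) S f"
proof -
  have "f differentiable (at z)" if "z \<in> S" for z
    using assms(2)[OF that] differentiable_def by blast
  moreover have "C_on n S (\<lambda>z. frechet_derivative f (at z) v)" for v
    by (rule C_on_cong[OF assms(1) _ assms(3)[of v]]) (simp add: frechet_derivativeI[OF assms(2)])
  ultimately show ?thesis by simp
qed

lemma C_on_const: "open S \<Longrightarrow> C_on n S (\<lambda>z. c)"
proof (induction n arbitrary: c)
  case (Suc n)
  then show ?case by (intro C_on_SucI[where D = "\<lambda>_ _. 0"]) auto
qed simp

lemma C_on_linear:
  assumes "open S" "bounded_linear L" "C_on n S f"
  shows "C_on n S (\<lambda>z. L (f z))"
  using assms(3)
proof (induction n arbitrary: f)
  case 0
  then show ?case using bounded_linear.continuous_on[OF assms(2)] by simp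
next
  case (Suc n)
  show ?case
    by (rule C_on_SucI[where D = "\<lambda>z v. L (frechet_derivative f (at z) v)", OF assms(1)])
      (use Suc in \<open>auto intro!: bounded_linear.has_derivative[OF assms(2)] has_derivative_frechet\<close>)
qed

lemma C_on_add:
  assumes "open S" "C_on n S f" "C_on n S g"
  shows "C_on n S (\<lambda>z. f z + g z)"
  using assms(2,3)
proof (induction n arbitrary: f g)
  case (Suc n)
  show ?case
    by (rule C_on_SucI[where D = "\<lambda>z v. frechet_derivative f (at z) v + frechet_derivative g (at z) v", OF assms(1)])
      (use Suc in \<open>auto intro!: has_derivative_add has_derivative_frechet\<close>)
qed (auto intro: continuous_on_add)

lemma C_on_mult:
  fixes f g :: "'a::real_normed_vector \<Rightarrow> 'b::real_normed_algebra"
  assumes "open S" "C_on n S f" "C_on n S g"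
  shows "C_on n S (\<lambda>z. f z * g z)"
  using assms(2,3)
proof (induction n arbitrary: f g)
  case (Suc n)
  show ?case
    by (rule C_on_SucI[where D = "\<lambda>z v. f z * frechet_derivative g (at z) v + frechet_derivative f (at z) v * g z", OF assms(1)])
      (use Suc C_on_Suc_D[OF Suc.prems(1)] C_on_Suc_D[OF Suc.prems(2)] in
        \<open>auto intro!: has_derivative_mult has_derivative_frechet C_on_add assms(1)\<close>)
qed (auto intro: continuous_on_mult)

text \<open>The derivative of \<open>inverse f\<close> contains \<open>inverse f\<close> again,
  which by induction is already known to have the class that the derivative needs.\<close>

lemma C_on_inverse:
  fixes f :: "'a::real_normed_vector \<Rightarrow> 'b::real_normed_field"
  assumes "open S" "C_on n S f" "\<And>z. z \<in> S \<Longrightarrow> f z \<noteq> 0"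
  shows "C_on n S (\<lambda>z. inverse (f z))"
  using assms(2)
proof (induction n)
  case 0
  then show ?case using assms(3) by (auto intro: continuous_on_inverse)
next
  case (Suc n)
  have c: "C_on n S (\<lambda>z. inverse (f z))" using C_on_Suc_D[OF Suc.prems] by (rule Suc.IH)
  show ?case
  proof (rule C_on_SucI[where D = "\<lambda>z v. - (inverse (f z) * frechet_derivative f (at z) v * inverse (f z))", OF assms(1)])
    show "((\<lambda>z. inverse (f z)) has_derivative (\<lambda>v. - (inverse (f z) * frechet_derivative f (at z) v * inverse (f z)))) (at z)" if "z \<in> S" for z
      using Suc.prems that assms(3) by (intro Deriv.has_derivative_inverse has_derivative_frechet) auto
    show "C_on n S (\<lambda>z. - (inverse (f z) * frechet_derivative f (at z) v * inverse (f z)))" for v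
      using Suc.prems c by (intro C_on_linear[OF assms(1) bounded_linear_minus[OF bounded_linear_ident]] C_on_mult assms(1)) auto
  qed
qed

lemma smooth_on_cong: "open S \<Longrightarrow> (\<And>z. z \<in> S \<Longrightarrow> f z = g z) \<Longrightarrow> smooth_on S f \<Longrightarrow> smooth_on S g"
  unfolding smooth_on_def using C_on_cong by blast

lemma smooth_on_const: "open S \<Longrightarrow> smooth_on S (\<lambda>z. c)"
  by (simp add: smooth_on_def C_on_const)

lemma smooth_on_linear: "open S \<Longrightarrow> bounded_linear L \<Longrightarrow> smooth_on S f \<Longrightarrow> smooth_on S (\<lambda>z. L (f z))"
  by (simp add: smooth_on_def C_on_linear)

lemma smooth_on_add: "open S \<Longrightarrow> smooth_on S f \<Longrightarrow> smooth_on S g \<Longrightarrow> smooth_on S (\<lambda>z. f z + g z)"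
  by (simp add: smooth_on_def C_on_add)

lemma smooth_on_mult:
  fixes f g :: "'a::real_normed_vector \<Rightarrow> 'b::real_normed_algebra"
  shows "open S \<Longrightarrow> smooth_on S f \<Longrightarrow> smooth_on S g \<Longrightarrow> smooth_on S (\<lambda>z. f z * g z)"
  by (simp add: smooth_on_def C_on_mult)

lemma smooth_on_inverse:
  fixes f :: "'a::real_normed_vector \<Rightarrow> 'b::real_normed_field"
  shows "open S \<Longrightarrow> smooth_on S f \<Longrightarrow> (\<And>z. z \<in> S \<Longrightarrow> f z \<noteq> 0) \<Longrightarrow> smooth_on S (\<lambda>z. inverse (f z))"
  by (simp add: smooth_on_def C_on_inverse)

lemma smooth_on_sum:
  "open S \<Longrightarrow> (\<And>i. i \<in> I \<Longrightarrow> smooth_on S (f i)) \<Longrightarrow> smooth_on S (\<lambda>z. \<Sum>i\<in>I. f i z)"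
proof (induction I rule: infinite_finite_induct)
  case (insert i I)
  then show ?case using smooth_on_add[of S "f i" "\<lambda>z. \<Sum>i\<in>I. f i z"] by simp
qed (auto intro: smooth_on_const)

lemma smooth_on_prod:
  fixes f :: "'i \<Rightarrow> 'a::real_normed_vector \<Rightarrow> 'b::real_normed_field"
  shows "open S \<Longrightarrow> (\<And>i. i \<in> I \<Longrightarrow> smooth_on S (f i)) \<Longrightarrow> smooth_on S (\<lambda>z. \<Prod>i\<in>I. f i z)"
proof (induction I rule: infinite_finite_induct)
  case (insert i I)
  then show ?case using smooth_on_mult[of S "f i" "\<lambda>z. \<Prod>i\<in>I. f i z"] by simp
qed (auto intro: smooth_on_const)

lemma smooth_on_cmult:
  fixes f :: "'a::real_normed_vector \<Rightarrow> 'b::real_normed_algebra"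
  shows "open S \<Longrightarrow> smooth_on S f \<Longrightarrow> smooth_on S (\<lambda>z. c * f z)"
  using smooth_on_mult[of S "\<lambda>_. c" f] smooth_on_const[of S c] by blast

lemma smooth_on_differentiable: "smooth_on S f \<Longrightarrow> z \<in> S \<Longrightarrow> f differentiable (at z)"
  unfolding smooth_on_def using C_on_differentiable by blast

lemma smooth_on_frechet: "smooth_on S f \<Longrightarrow> smooth_on S (\<lambda>z. frechet_derivative f (at z) v)"
  unfolding smooth_on_def by (metis C_on.simps(2))

section \<open>Symmetry of second derivatives\<close>

lemma has_real_derivative_along_line:
  fixes f :: "'a::real_normed_vector \<Rightarrow> real"
  assumes "(f has_derivative D) (at (x + s *\<^sub>R v))"
  shows "((\<lambda>s. f (x + s *\<^sub>R v)) has_real_derivative D v) (at s)"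
proof -
  have "((\<lambda>s. x + s *\<^sub>R v) has_derivative (\<lambda>s. s *\<^sub>R v)) (at s)"
    by (auto intro!: derivative_eq_intros)
  from has_derivative_compose[OF this assms]
  have "((\<lambda>s. f (x + s *\<^sub>R v)) has_derivative (\<lambda>s. D (s *\<^sub>R v))) (at s)" .
  moreover have "D (r *\<^sub>R v) = D v * r" for r
    using linear_scale[OF has_derivative_linear[OF assms], of r v] by simp
  ultimately show ?thesis by (simp add: has_field_derivative_def)
qed

text \<open>The second difference is symmetric in \<open>v\<close> and \<open>w\<close>. The mean
  value theorem along \<open>v\<close>, applied to the difference of \<open>f\<close> at two points
  that are \<open>r *\<^sub>R w\<close> apart, and then along \<open>w\<close>, expresses it by one
  mixed derivative at an intermediate point.\<close>

lemma second_difference: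
  fixes f :: "'a::real_normed_vector \<Rightarrow> real"
  assumes "C_on 2 S f" "0 < r"
    and "\<And>s t. 0 \<le> s \<Longrightarrow> s \<le> r \<Longrightarrow> 0 \<le> t \<Longrightarrow> t \<le> r \<Longrightarrow> z + s *\<^sub>R v + t *\<^sub>R w \<in> S"
  shows "\<exists>s t. 0 < s \<and> s < r \<and> 0 < t \<and> t < r \<and>
    f (z + r *\<^sub>R v + r *\<^sub>R w) - f (z + r *\<^sub>R v) - f (z + r *\<^sub>R w) + f z =
    r * r * frechet_derivative (\<lambda>y. frechet_derivative f (at y) v) (at (z + s *\<^sub>R v + t *\<^sub>R w)) w"
proof -
  let ?D = "\<lambda>y. frechet_derivative f (at y) v"
  have C: "C_on (Suc (Suc 0)) S f" using assms(1) by (simp add: numeral_2_eq_2)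
  have f: "(f has_derivative frechet_derivative f (at y)) (at y)" if "y \<in> S" for y
    using C that by (auto intro: has_derivative_frechet)
  have D: "(?D has_derivative frechet_derivative ?D (at y)) (at y)" if "y \<in> S" for y
    using C that by (auto intro: has_derivative_frechet)
  have d: "((\<lambda>s. f (z + s *\<^sub>R v + t *\<^sub>R w)) has_real_derivative ?D (z + s *\<^sub>R v + t *\<^sub>R w)) (at s)"
    if "0 \<le> s" "s \<le> r" "0 \<le> t" "t \<le> r" for s t
  proof -
    have e: "z + s *\<^sub>R v + t *\<^sub>R w = (z + t *\<^sub>R w) + s *\<^sub>R v" for s by simp
    show ?thesis unfolding e
      by (rule has_real_derivative_along_line) (use f assms(3)[OF that] e in auto)
  qed
  have "\<exists>s. 0 < s \<and> s < r \<and> (f (z + r *\<^sub>R v + r *\<^sub>R w) - f (z + r *\<^sub>R v + 0 *\<^sub>R w)) - (f (z + 0 *\<^sub>R v + r *\<^sub>R w) - f (z + 0 *\<^sub>R v + 0 *\<^sub>R w)) =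
    (r - 0) * (?D (z + s *\<^sub>R v + r *\<^sub>R w) - ?D (z + s *\<^sub>R v + 0 *\<^sub>R w))"
    by (intro MVT2 DERIV_diff d) (use assms(2) in auto)
  then obtain s where s: "0 < s" "s < r" "f (z + r *\<^sub>R v + r *\<^sub>R w) - f (z + r *\<^sub>R v) - f (z + r *\<^sub>R w) + f z =
    r * (?D (z + s *\<^sub>R v + r *\<^sub>R w) - ?D (z + s *\<^sub>R v))"
    by (auto simp: algebra_simps)
  have "\<exists>t. 0 < t \<and> t < r \<and> ?D (z + s *\<^sub>R v + r *\<^sub>R w) - ?D (z + s *\<^sub>R v + 0 *\<^sub>R w) =
    (r - 0) * frechet_derivative ?D (at (z + s *\<^sub>R v + t *\<^sub>R w)) w"
    using assms(2) s(1,2) by (intro MVT2 has_real_derivative_along_line D assms(3)) auto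
  then obtain t where t: "0 < t" "t < r" "?D (z + s *\<^sub>R v + r *\<^sub>R w) - ?D (z + s *\<^sub>R v) =
    r * frechet_derivative ?D (at (z + s *\<^sub>R v + t *\<^sub>R w)) w" by auto
  have "f (z + r *\<^sub>R v + r *\<^sub>R w) - f (z + r *\<^sub>R v) - f (z + r *\<^sub>R w) + f z =
    r * r * frechet_derivative ?D (at (z + s *\<^sub>R v + t *\<^sub>R w)) w"
    unfolding s(3) t(3) by simp
  then show ?thesis using s(1,2) t(1,2) by blast
qed

text \<open>At suitable points of a small parallelogram at \<open>z\<close>, both mixed derivatives
  equal the same second difference divided by \<open>r * r\<close>; continuity at \<open>z\<close>
  does the rest.\<close>

lemma second_derivative_symmetric_real:
  fixes f :: "'a::real_normed_vector \<Rightarrow> real"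
  assumes "open S" "C_on 2 S f" "z \<in> S"
  shows "frechet_derivative (\<lambda>y. frechet_derivative f (at y) v) (at z) w =
    frechet_derivative (\<lambda>y. frechet_derivative f (at y) w) (at z) v"
proof -
  define A where "A y = frechet_derivative (\<lambda>y. frechet_derivative f (at y) v) (at y) w" for y
  define B where "B y = frechet_derivative (\<lambda>y. frechet_derivative f (at y) w) (at y) v" for y
  have "continuous_on S A" "continuous_on S B"
    using assms(2) unfolding A_def B_def by (simp_all add: numeral_2_eq_2)
  then have cont: "isCont A z" "isCont B z"
    using assms(1,3) continuous_on_eq_continuous_at by blast+
  have "\<bar>A z - B z\<bar> \<le> e" if e: "e > 0" for e
  proof -
    obtain d1 where d1: "d1 > 0" "\<And>y. dist y z < d1 \<Longrightarrow> dist (A y) (A z) < e / 2"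
      using cont(1)[unfolded continuous_at_eps_delta, rule_format, OF half_gt_zero[OF e]] by blast
    obtain d2 where d2: "d2 > 0" "\<And>y. dist y z < d2 \<Longrightarrow> dist (B y) (B z) < e / 2"
      using cont(2)[unfolded continuous_at_eps_delta, rule_format, OF half_gt_zero[OF e]] by blast
    obtain d3 where d3: "d3 > 0" "ball z d3 \<subseteq> S" using assms(1,3) openE by blast
    define d where "d = min d1 (min d2 d3)"
    \<comment> \<open>The summand 1 makes the denominator positive and keeps the parallelogram
      strictly inside the ball of radius \<open>d\<close>.\<close>
    define r where "r = d / (norm v + norm w + 1)"
    have pos: "norm v + norm w + 1 > 0" by (smt (verit) norm_ge_zero)
    have d: "d > 0" "d \<le> d1" "d \<le> d2" "d \<le> d3" using d1 d2 d3 by (auto simp: d_def)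
    have r: "r > 0" using d pos by (simp add: r_def)
    have near: "dist (z + s *\<^sub>R v + t *\<^sub>R w) z < d" if "0 \<le> s" "s \<le> r" "0 \<le> t" "t \<le> r" for s t
    proof -
      have "dist (z + s *\<^sub>R v + t *\<^sub>R w) z = norm (s *\<^sub>R v + t *\<^sub>R w)" by (simp add: dist_norm algebra_simps)
      also have "\<dots> \<le> s * norm v + t * norm w" using norm_triangle_ineq[of "s *\<^sub>R v" "t *\<^sub>R w"] that by simp
      also have "\<dots> \<le> r * norm v + r * norm w" using that by (intro add_mono mult_right_mono) auto
      also have "\<dots> < r * (norm v + norm w + 1)" using r by (simp add: algebra_simps)
      also have "\<dots> = d" using pos by (simp add: r_def)
      finally show ?thesis .
    qed
    have inS: "z + s *\<^sub>R v + t *\<^sub>R w \<in> S" if "0 \<le> s" "s \<le> r" "0 \<le> t" "t \<le> r" for s t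
      using near[OF that] d(4) d3(2) by (auto simp: subset_eq dist_commute)
    obtain s t where st: "0 < s" "s < r" "0 < t" "t < r"
      "f (z + r *\<^sub>R v + r *\<^sub>R w) - f (z + r *\<^sub>R v) - f (z + r *\<^sub>R w) + f z = r * r * A (z + s *\<^sub>R v + t *\<^sub>R w)"
      using second_difference[OF assms(2) r inS] unfolding A_def by blast
    have inS': "z + s *\<^sub>R w + t *\<^sub>R v \<in> S" if "0 \<le> s" "s \<le> r" "0 \<le> t" "t \<le> r" for s t
      using inS[OF that(3,4,1,2)] by (simp add: algebra_simps)
    obtain s' t' where st': "0 < s'" "s' < r" "0 < t'" "t' < r"
      "f (z + r *\<^sub>R w + r *\<^sub>R v) - f (z + r *\<^sub>R w) - f (z + r *\<^sub>R v) + f z = r * r * B (z + s' *\<^sub>R w + t' *\<^sub>R v)"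
      using second_difference[OF assms(2) r inS'] unfolding B_def by blast
    have "r * r * A (z + s *\<^sub>R v + t *\<^sub>R w) = r * r * B (z + s' *\<^sub>R w + t' *\<^sub>R v)"
      using st(5) st'(5) by (simp add: algebra_simps)
    then have "A (z + s *\<^sub>R v + t *\<^sub>R w) = B (z + s' *\<^sub>R w + t' *\<^sub>R v)" using r by simp
    moreover have "dist (A (z + s *\<^sub>R v + t *\<^sub>R w)) (A z) < e / 2"
      using near[of s t] st d(2) by (intro d1(2)) auto
    moreover have "dist (B (z + s' *\<^sub>R w + t' *\<^sub>R v)) (B z) < e / 2"
      using near[of t' s'] st' d(3) by (intro d2(2)) (auto simp: algebra_simps)
    ultimately show ?thesis unfolding dist_real_def by linarith
  qed
  then have "\<bar>A z - B z\<bar> \<le> 0" by (rule field_le_epsilon) simp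
  then show ?thesis by (simp add: A_def B_def)
qed

text \<open>The mean value theorem is about real functions, hence the passage to real and imaginary
  parts, which commute with differentiation.\<close>

lemma second_derivative_symmetric:
  fixes f :: "'a::real_normed_vector \<Rightarrow> complex"
  assumes "open S" "smooth_on S f" "z \<in> S"
  shows "frechet_derivative (\<lambda>y. frechet_derivative f (at y) v) (at z) w =
    frechet_derivative (\<lambda>y. frechet_derivative f (at y) w) (at z) v"
proof -
  have L: "L (frechet_derivative (\<lambda>y. frechet_derivative f (at y) v) (at z) w) =
    frechet_derivative (\<lambda>y. frechet_derivative (\<lambda>x. L (f x)) (at y) v) (at z) w"
    if L: "bounded_linear L" for L :: "complex \<Rightarrow> real" and v w
  proof -
    have 1: "frechet_derivative (\<lambda>x. L (g x)) (at y) u = L (frechet_derivative g (at y) u)"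
      if "g differentiable (at y)" for g :: "'a \<Rightarrow> complex" and y u
      using bounded_linear.has_derivative[OF L has_derivative_frechet[OF that]] by (rule frechet_derivativeI)
    have d: "(\<lambda>y. frechet_derivative f (at y) v) differentiable (at z)"
      using smooth_on_differentiable[OF smooth_on_frechet[OF assms(2)] assms(3)] .
    have "L (frechet_derivative (\<lambda>y. frechet_derivative f (at y) v) (at z) w) =
      frechet_derivative (\<lambda>y. L (frechet_derivative f (at y) v)) (at z) w"
      using 1[OF d] by simp
    also have "\<dots> = frechet_derivative (\<lambda>y. frechet_derivative (\<lambda>x. L (f x)) (at y) v) (at z) w"
    proof (rule fun_cong[OF frechet_derivative_transform_within_open])
      show "(\<lambda>y. L (frechet_derivative f (at y) v)) differentiable (at z)"
        using bounded_linear.has_derivative[OF L has_derivative_frechet[OF d]] differentiable_def by blast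
      show "L (frechet_derivative f (at y) v) = frechet_derivative (\<lambda>x. L (f x)) (at y) v" if "y \<in> S" for y
        using 1 smooth_on_differentiable[OF assms(2) that] by simp
    qed (use assms in auto)
    finally show ?thesis .
  qed
  have C: "C_on 2 S (\<lambda>x. L (f x))" if "bounded_linear L" for L :: "complex \<Rightarrow> real"
    using smooth_on_linear[OF assms(1) that assms(2)] by (simp add: smooth_on_def)
  show ?thesis
  proof (rule complex_eqI)
    show "Re (frechet_derivative (\<lambda>y. frechet_derivative f (at y) v) (at z) w) =
      Re (frechet_derivative (\<lambda>y. frechet_derivative f (at y) w) (at z) v)"
      unfolding L[OF bounded_linear_Re] by (rule second_derivative_symmetric_real[OF assms(1) C[OF bounded_linear_Re] assms(3)])
    show "Im (frechet_derivative (\<lambda>y. frechet_derivative f (at y) v) (at z) w) =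
      Im (frechet_derivative (\<lambda>y. frechet_derivative f (at y) w) (at z) v)"
      unfolding L[OF bounded_linear_Im] by (rule second_derivative_symmetric_real[OF assms(1) C[OF bounded_linear_Im] assms(3)])
  qed
qed

section \<open>Wirtinger derivatives and their commutation\<close>

fun index_of :: "'d index \<Rightarrow> 'd" where
  "index_of (Unbar i) = i"
| "index_of (Bar i) = i"

fun wirtinger_coeff :: "'d index \<Rightarrow> complex" where
  "wirtinger_coeff (Unbar i) = - \<i>"
| "wirtinger_coeff (Bar i) = \<i>"

text \<open>One formula for both kinds of derivatives. It replaces the defining equations, which are
  withdrawn from the simplifier, and saves later proofs the case distinction.\<close>

lemma wirtinger_eq:
  "wirtinger a f z = (frechet_derivative f (at z) (axis (index_of a) 1) +
     wirtinger_coeff a * frechet_derivative f (at z) (axis (index_of a) \<i>)) / 2"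
  by (cases a) auto

declare wirtinger.simps [simp del]

lemma smooth_on_wirtinger:
  assumes "open S" "smooth_on S f"
  shows "smooth_on S (wirtinger a f)"
proof -
  have "smooth_on S (\<lambda>z. (1 / 2) * (frechet_derivative f (at z) (axis (index_of a) 1) +
     wirtinger_coeff a * frechet_derivative f (at z) (axis (index_of a) \<i>)))"
    by (intro smooth_on_cmult smooth_on_add smooth_on_frechet assms)
  then show ?thesis
    by (rule smooth_on_cong[OF assms(1), rotated]) (simp add: wirtinger_eq)
qed

lemma wirtinger_cong:
  assumes "open S" "z \<in> S" "smooth_on S f" "\<And>z. z \<in> S \<Longrightarrow> f z = g z"
  shows "wirtinger a f z = wirtinger a g z"
proof -
  have "frechet_derivative f (at z) = frechet_derivative g (at z)"
    by (rule frechet_derivative_transform_within_open[OF smooth_on_differentiable[OF assms(3,2)] assms(1,2)])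
      (rule assms(4))
  then show ?thesis by (simp add: wirtinger_eq)
qed

lemma wirtinger_of_derivative:
  "(f has_derivative D) (at z) \<Longrightarrow>
    wirtinger a f z = (D (axis (index_of a) 1) + wirtinger_coeff a * D (axis (index_of a) \<i>)) / 2"
  by (simp add: wirtinger_eq frechet_derivativeI)

lemma wirtinger_add:
  assumes "f differentiable (at z)" "g differentiable (at z)"
  shows "wirtinger a (\<lambda>z. f z + g z) z = wirtinger a f z + wirtinger a g z"
  by (subst wirtinger_of_derivative[OF has_derivative_add[OF has_derivative_frechet[OF assms(1)] has_derivative_frechet[OF assms(2)]]])
    (simp add: wirtinger_eq field_simps)

lemma wirtinger_mult:
  assumes "f differentiable (at z)" "g differentiable (at z)"
  shows "wirtinger a (\<lambda>z. f z * g z) z = wirtinger a f z * g z + f z * wirtinger a g z"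
  by (subst wirtinger_of_derivative[OF has_derivative_mult[OF has_derivative_frechet[OF assms(1)] has_derivative_frechet[OF assms(2)]]])
    (simp add: wirtinger_eq field_simps)

lemma wirtinger_const: "wirtinger a (\<lambda>z. c) z = 0"
  by (subst wirtinger_of_derivative[OF has_derivative_const]) simp

lemma wirtinger_cmult:
  assumes "f differentiable (at z)"
  shows "wirtinger a (\<lambda>z. c * f z) z = c * wirtinger a f z"
  using wirtinger_mult[OF differentiable_const[of c] assms, of a] wirtinger_const[of a c z] by simp

lemma wirtinger_cnj:
  assumes "f differentiable (at z)"
  shows "wirtinger (Bar i) (\<lambda>z. cnj (f z)) z = cnj (wirtinger (Unbar i) f z)"
  by (subst wirtinger_of_derivative[OF bounded_linear.has_derivative[OF bounded_linear_cnj has_derivative_frechet[OF assms]]])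
    (simp add: wirtinger_eq)

lemma wirtinger_commute:
  assumes "open S" "smooth_on S f" "z \<in> S"
  shows "wirtinger a (wirtinger b f) z = wirtinger b (wirtinger a f) z"
proof -
  let ?F = "\<lambda>v z. frechet_derivative f (at z) v"
  have d: "?F v differentiable (at z)" for v
    by (rule smooth_on_differentiable[OF smooth_on_frechet[OF assms(2)] assms(3)])
  have e: "wirtinger a (wirtinger b f) z =
    (1 / 2) * (wirtinger a (?F (axis (index_of b) 1)) z + wirtinger_coeff b * wirtinger a (?F (axis (index_of b) \<i>)) z)" for a b
  proof -
    have "wirtinger b f = (\<lambda>z. (1 / 2) * (?F (axis (index_of b) 1) z + wirtinger_coeff b * ?F (axis (index_of b) \<i>) z))"
      by (auto simp: wirtinger_eq)
    then show ?thesis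
      by (simp only: wirtinger_cmult[OF differentiable_add[OF d differentiable_mult[OF differentiable_const d]]]
        wirtinger_add[OF d differentiable_mult[OF differentiable_const d]] wirtinger_cmult[OF d])
  qed
  show ?thesis
    unfolding e[of a b] e[of b a]
    unfolding wirtinger_eq[of _ "?F _"] second_derivative_symmetric[OF assms(1,2,3), of "axis (index_of b) _" "axis (index_of a) _"]
    by (simp add: field_simps)
qed

lemma partials_Nil [simp]: "partials [] f = f"
  by (simp add: partials_def)

lemma partials_Cons: "partials (a # as) f = wirtinger a (partials as f)"
  by (simp add: partials_def)

lemma partials_append: "partials (xs @ ys) f = partials xs (partials ys f)"
  by (simp add: partials_def)

lemma smooth_on_partials: "open S \<Longrightarrow> smooth_on S f \<Longrightarrow> smooth_on S (partials as f)"
  by (induction as) (auto simp: partials_Cons smooth_on_wirtinger)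

lemma partials_cong:
  assumes "open S" "z \<in> S" "smooth_on S f" "\<And>z. z \<in> S \<Longrightarrow> f z = g z"
  shows "partials as f z = partials as g z"
  using assms(2)
proof (induction as arbitrary: z)
  case (Cons a as)
  show ?case unfolding partials_Cons
    by (rule wirtinger_cong[OF assms(1) Cons.prems smooth_on_partials[OF assms(1,3)] Cons.IH])
qed (use assms(4) in simp)

lemma partials_perm:
  assumes "open S" "smooth_on S f" "z \<in> S" "mset xs = mset ys"
  shows "partials xs f z = partials ys f z"
  using assms(3,4)
proof (induction xs arbitrary: ys z)
  case (Cons x xs)
  \<comment> \<open>Commuting one derivative at a time brings \<open>x\<close> to the front. The
    equation is proved at all points of \<open>S\<close>, since further derivatives are applied to
    it.\<close>
  have move: "partials (us @ x # vs) f z = partials (x # us @ vs) f z" if "z \<in> S" for us vs z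
    using that
  proof (induction us arbitrary: z)
    case (Cons u us)
    have "partials ((u # us) @ x # vs) f z = wirtinger u (wirtinger x (partials (us @ vs) f)) z"
      unfolding append_Cons partials_Cons
      by (rule wirtinger_cong[OF assms(1) Cons.prems smooth_on_partials[OF assms(1,2)]])
        (simp add: Cons.IH partials_Cons)
    also have "\<dots> = wirtinger x (wirtinger u (partials (us @ vs) f)) z"
      by (rule wirtinger_commute[OF assms(1) smooth_on_partials[OF assms(1,2)] Cons.prems])
    finally show ?case by (simp add: partials_Cons)
  qed simp
  have "x \<in> set ys" using Cons.prems(2) by (metis list.set_intros(1) mset_eq_setD)
  then obtain us vs where ys: "ys = us @ x # vs" by (meson split_list)
  have "partials (x # xs) f z = wirtinger x (partials (us @ vs) f) z"
    unfolding partials_Cons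
    by (rule wirtinger_cong[OF assms(1) Cons.prems(1) smooth_on_partials[OF assms(1,2)] Cons.IH])
      (use Cons.prems ys in auto)
  then show ?case using move[OF Cons.prems(1), of us vs] ys by (simp add: partials_Cons)
qed simp

lemma partials_add:
  assumes "open S" "z \<in> S" "smooth_on S f" "smooth_on S g"
  shows "partials as (\<lambda>z. f z + g z) z = partials as f z + partials as g z"
  using assms(2)
proof (induction as arbitrary: z)
  case (Cons a as)
  note sm = smooth_on_partials[OF assms(1)]
  have "partials (a # as) (\<lambda>z. f z + g z) z = wirtinger a (\<lambda>z. partials as f z + partials as g z) z"
    unfolding partials_Cons
    by (rule wirtinger_cong[OF assms(1) Cons.prems sm Cons.IH]) (intro smooth_on_add assms)
  also have "\<dots> = partials (a # as) f z + partials (a # as) g z"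
    unfolding partials_Cons
    by (intro wirtinger_add smooth_on_differentiable[OF sm Cons.prems] assms)
  finally show ?case .
qed simp

lemma partials_const: "as \<noteq> [] \<Longrightarrow> partials as (\<lambda>z. c) = (\<lambda>z. 0)"
proof (induction as)
  case (Cons a as)
  then show ?case by (cases "as = []") (auto simp: partials_Cons wirtinger_const intro!: ext)
qed simp

lemma partials_sum:
  assumes "open S" "z \<in> S" "finite I" "\<And>i. i \<in> I \<Longrightarrow> smooth_on S (f i)"
  shows "partials as (\<lambda>z. \<Sum>i\<in>I. f i z) z = (\<Sum>i\<in>I. partials as (f i) z)"
  using assms(3,4)
proof (induction I rule: finite_induct)
  case empty
  then show ?case using partials_const[of as 0] by (cases "as = []") (auto simp: fun_eq_iff)
next
  case (insert i I)
  then show ?case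
    using partials_add[OF assms(1,2), of "f i" "\<lambda>z. \<Sum>i\<in>I. f i z" as] smooth_on_sum[OF assms(1), of I f] by auto
qed

section \<open>Derivatives indexed by sets of edges and the Leibniz rule\<close>

definition set_partials :: "(nat \<Rightarrow> 'd::finite) \<Rightarrow> nat set \<Rightarrow> nat set \<Rightarrow> (complex^'d \<Rightarrow> complex) \<Rightarrow> complex^'d \<Rightarrow> complex" where
  "set_partials \<iota> A B f = partials (map Unbar (map \<iota> (sorted_list_of_set A)) @ map Bar (map \<iota> (sorted_list_of_set B))) f"

lemma mset_sorted_list: "finite A \<Longrightarrow> mset (sorted_list_of_set A) = mset_set A"
  by (metis mset_set_set sorted_list_of_set.set_sorted_key_list_of_set sorted_list_of_set.distinct_sorted_key_list_of_set)

context
  fixes S :: "(complex^'d::finite) set"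
  assumes S: "open S"
begin

lemma set_partials_eq_partials:
  assumes "smooth_on S f" "z \<in> S" "finite A" "finite B"
    "mset xs = image_mset Unbar (image_mset \<iota> (mset_set A)) + image_mset Bar (image_mset \<iota> (mset_set B))"
  shows "set_partials \<iota> A B f z = partials xs f z"
  unfolding set_partials_def
  by (rule partials_perm[OF S assms(1,2)]) (simp add: assms mset_sorted_list multiset.map_comp)

lemma set_partials_empty [simp]: "set_partials \<iota> {} {} f = f"
  by (simp add: set_partials_def)

lemma set_partials_cong:
  "z \<in> S \<Longrightarrow> smooth_on S f \<Longrightarrow> (\<And>z. z \<in> S \<Longrightarrow> f z = g z) \<Longrightarrow> set_partials \<iota> A B f z = set_partials \<iota> A B g z"
  unfolding set_partials_def by (rule partials_cong[OF S])

lemma set_partials_insert_unbar: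
  assumes "smooth_on S f" "z \<in> S" "finite A" "finite B" "a \<notin> A"
  shows "set_partials \<iota> (insert a A) B f z = set_partials \<iota> A B (wirtinger (Unbar (\<iota> a)) f) z"
proof -
  have "set_partials \<iota> (insert a A) B f z =
    partials ((map Unbar (map \<iota> (sorted_list_of_set A)) @ map Bar (map \<iota> (sorted_list_of_set B))) @ [Unbar (\<iota> a)]) f z"
    by (rule set_partials_eq_partials) (use assms in \<open>auto simp: mset_sorted_list multiset.map_comp\<close>)
  then show ?thesis by (simp add: set_partials_def partials_append partials_Cons)
qed

lemma set_partials_insert_bar:
  assumes "smooth_on S f" "z \<in> S" "finite A" "finite B" "b \<notin> B"
  shows "set_partials \<iota> A (insert b B) f z = set_partials \<iota> A B (wirtinger (Bar (\<iota> b)) f) z"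
proof -
  have "set_partials \<iota> A (insert b B) f z =
    partials ((map Unbar (map \<iota> (sorted_list_of_set A)) @ map Bar (map \<iota> (sorted_list_of_set B))) @ [Bar (\<iota> b)]) f z"
    by (rule set_partials_eq_partials) (use assms in \<open>auto simp: mset_sorted_list multiset.map_comp\<close>)
  then show ?thesis by (simp add: set_partials_def partials_append partials_Cons)
qed

lemma set_partials_add:
  assumes "z \<in> S" "smooth_on S f" "smooth_on S g"
  shows "set_partials \<iota> A B (\<lambda>z. f z + g z) z = set_partials \<iota> A B f z + set_partials \<iota> A B g z"
  unfolding set_partials_def by (rule partials_add[OF S assms])

lemma set_partials_sum:
  assumes "z \<in> S" "finite I" "\<And>i. i \<in> I \<Longrightarrow> smooth_on S (f i)"
  shows "set_partials \<iota> A B (\<lambda>z. \<Sum>i\<in>I. f i z) z = (\<Sum>i\<in>I. set_partials \<iota> A B (f i) z)"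
  unfolding set_partials_def by (rule partials_sum[OF S assms])

lemma sum_Pow_insert:
  assumes "finite A" "a \<notin> A"
  shows "(\<Sum>X\<in>Pow (insert a A). F X) = (\<Sum>X\<in>Pow A. F X + F (insert a X) :: 'c::comm_monoid_add)"
proof -
  have "Pow A \<inter> insert a ` Pow A = {}" using assms by auto
  moreover have "inj_on (insert a) (Pow A)" using assms(2) by (auto simp: inj_on_def)
  ultimately show ?thesis
    using assms(1) by (simp add: Pow_insert sum.union_disjoint sum.reindex sum.distrib)
qed

text \<open>Derivatives are labelled by edges rather than by index values: two edges may have the
  same value under \<iota> and still act on different factors, which makes the Leibniz rule a plain
  sum over subsets. In the induction the new label acts innermost, and the two terms of the product
  rule are the subsets with and without it.\<close>

lemma set_partials_mult:
  assumes "finite A" "finite B" "smooth_on S u" "smooth_on S v" "z \<in> S"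
  shows "set_partials \<iota> A B (\<lambda>z. u z * v z) z =
    (\<Sum>X\<in>Pow A. \<Sum>Y\<in>Pow B. set_partials \<iota> X Y u z * set_partials \<iota> (A - X) (B - Y) v z)"
  using assms(1,3,4,5)
proof (induction A arbitrary: u v rule: finite_induct)
  case empty
  show ?case using assms(2) empty
  proof (induction B arbitrary: u v rule: finite_induct)
    case (insert b B)
    let ?w = "wirtinger (Bar (\<iota> b))"
    note sm = smooth_on_wirtinger[OF S, of _ "Bar (\<iota> b)"]
    have "set_partials \<iota> {} (insert b B) (\<lambda>z. u z * v z) z = set_partials \<iota> {} B (?w (\<lambda>z. u z * v z)) z"
      using insert smooth_on_mult[OF S insert.prems(1,2)] by (intro set_partials_insert_bar) auto
    also have "\<dots> = set_partials \<iota> {} B (\<lambda>z. ?w u z * v z + u z * ?w v z) z"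
      using insert.prems by (intro set_partials_cong sm smooth_on_mult[OF S] wirtinger_mult smooth_on_differentiable) auto
    also have "\<dots> = set_partials \<iota> {} B (\<lambda>z. ?w u z * v z) z + set_partials \<iota> {} B (\<lambda>z. u z * ?w v z) z"
      using insert.prems by (intro set_partials_add smooth_on_mult[OF S] sm) auto
    also have "\<dots> = (\<Sum>Y\<in>Pow B. set_partials \<iota> {} Y (?w u) z * set_partials \<iota> {} (B - Y) v z) +
      (\<Sum>Y\<in>Pow B. set_partials \<iota> {} Y u z * set_partials \<iota> {} (B - Y) (?w v) z)"
      using insert.IH[OF sm[OF insert.prems(1)] insert.prems(2,3)] insert.IH[OF insert.prems(1) sm[OF insert.prems(2)] insert.prems(3)] by simp
    also have "\<dots> = (\<Sum>Y\<in>Pow (insert b B). set_partials \<iota> {} Y u z * set_partials \<iota> {} (insert b B - Y) v z)"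
      unfolding sum_Pow_insert[OF insert.hyps(1,2)] sum.distrib
    proof (subst add.commute, intro arg_cong2[where f = "(+)"] sum.cong refl)
      fix Y assume Y: "Y \<in> Pow B"
      then have f: "finite Y" "b \<notin> Y" using insert.hyps by (auto intro: finite_subset)
      have "insert b B - Y = insert b (B - Y)" using f by auto
      then show "set_partials \<iota> {} Y u z * set_partials \<iota> {} (B - Y) (?w v) z = set_partials \<iota> {} Y u z * set_partials \<iota> {} (insert b B - Y) v z"
        using insert.hyps insert.prems by (simp add: set_partials_insert_bar)
      have "insert b B - insert b Y = B - Y" using insert.hyps by auto
      then show "set_partials \<iota> {} Y (?w u) z * set_partials \<iota> {} (B - Y) v z = set_partials \<iota> {} (insert b Y) u z * set_partials \<iota> {} (insert b B - insert b Y) v z"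
        using f insert.prems by (simp add: set_partials_insert_bar)
    qed
    finally show ?case by simp
  qed simp
next
  case (insert a A)
  let ?w = "wirtinger (Unbar (\<iota> a))"
  let ?P = "\<lambda>A X u v. \<Sum>Y\<in>Pow B. set_partials \<iota> X Y u z * set_partials \<iota> (A - X) (B - Y) v z"
  note sm = smooth_on_wirtinger[OF S, of _ "Unbar (\<iota> a)"]
  have fB: "finite Y" if "Y \<subseteq> B" for Y using that assms(2) finite_subset by auto
  have "set_partials \<iota> (insert a A) B (\<lambda>z. u z * v z) z = set_partials \<iota> A B (?w (\<lambda>z. u z * v z)) z"
    using insert assms(2) smooth_on_mult[OF S insert.prems(1,2)] by (intro set_partials_insert_unbar) auto
  also have "\<dots> = set_partials \<iota> A B (\<lambda>z. ?w u z * v z + u z * ?w v z) z"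
    using insert.prems by (intro set_partials_cong sm smooth_on_mult[OF S] wirtinger_mult smooth_on_differentiable) auto
  also have "\<dots> = set_partials \<iota> A B (\<lambda>z. ?w u z * v z) z + set_partials \<iota> A B (\<lambda>z. u z * ?w v z) z"
    using insert.prems by (intro set_partials_add smooth_on_mult[OF S] sm) auto
  also have "\<dots> = (\<Sum>X\<in>Pow A. ?P A X (?w u) v) + (\<Sum>X\<in>Pow A. ?P A X u (?w v))"
    using insert.IH[OF sm[OF insert.prems(1)] insert.prems(2,3)] insert.IH[OF insert.prems(1) sm[OF insert.prems(2)] insert.prems(3)] by simp
  also have "\<dots> = (\<Sum>X\<in>Pow (insert a A). ?P (insert a A) X u v)"
    unfolding sum_Pow_insert[OF insert.hyps(1,2)] sum.distrib
  proof (subst add.commute, intro arg_cong2[where f = "(+)"] sum.cong refl)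
    fix X Y assume XY: "X \<in> Pow A" "Y \<in> Pow B"
    then have f: "finite X" "a \<notin> X" "finite Y" using insert.hyps fB by (auto intro: finite_subset)
    have "insert a A - X = insert a (A - X)" using f by auto
    then show "set_partials \<iota> X Y u z * set_partials \<iota> (A - X) (B - Y) (?w v) z = set_partials \<iota> X Y u z * set_partials \<iota> (insert a A - X) (B - Y) v z"
      using insert.hyps insert.prems assms(2) by (simp add: set_partials_insert_unbar)
    have "insert a A - insert a X = A - X" using insert.hyps by auto
    then show "set_partials \<iota> X Y (?w u) z * set_partials \<iota> (A - X) (B - Y) v z = set_partials \<iota> (insert a X) Y u z * set_partials \<iota> (insert a A - insert a X) (B - Y) v z"
      using f insert.prems by (simp add: set_partials_insert_unbar)
  qed
  finally show ?case .
qed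

end

section \<open>The Laplacian in charts\<close>

lemma has_derivative_vec_lambda:
  fixes f :: "'d::finite \<Rightarrow> complex \<Rightarrow> complex"
  assumes "\<And>a. (f a has_derivative f' a) (at x)"
  shows "((\<lambda>x. \<chi> a. f a x) has_derivative (\<lambda>h. \<chi> a. f' a h)) (at x)"
proof -
  have ax: "bounded_linear (axis a :: complex \<Rightarrow> complex^'d)" for a
    unfolding linear_conv_bounded_linear[symmetric]
    by (rule linearI) (auto simp: axis_def vec_eq_iff)
  have "((\<lambda>x. \<Sum>a\<in>UNIV. axis a (f a x)) has_derivative (\<lambda>h. \<Sum>a\<in>UNIV. axis a (f' a h))) (at x)"
    by (intro has_derivative_sum bounded_linear.has_derivative[OF ax] assms)
  moreover have "(\<Sum>a\<in>UNIV. axis a (y a)) = (\<chi> a. y a)" for y :: "'d \<Rightarrow> complex"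
    by (simp add: vec_eq_iff axis_def)
  ultimately show ?thesis by simp
qed

section \<open>Inverse matrices under congruence and as smooth functions\<close>

lemma matrix_inv_inverse:
  fixes A :: "'a::field^'n^'n"
  assumes "invertible A"
  shows "A ** matrix_inv A = mat 1" "matrix_inv A ** A = mat 1"
proof -
  have "\<exists>B. A ** B = mat 1 \<and> B ** A = mat 1" using assms by (simp add: invertible_def)
  then have "A ** matrix_inv A = mat 1 \<and> matrix_inv A ** A = mat 1"
    unfolding matrix_inv_def by (rule someI_ex)
  then show "A ** matrix_inv A = mat 1" "matrix_inv A ** A = mat 1" by auto
qed

lemma matrix_inv_eqI:
  fixes A B :: "'a::field^'n^'n"
  assumes "B ** A = mat 1"
  shows "matrix_inv A = B"
proof -
  have "invertible A" using assms invertible_left_inverse by blast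
  then have "B ** (A ** matrix_inv A) = B" by (simp add: matrix_inv_inverse)
  then show ?thesis by (simp add: matrix_mul_assoc assms)
qed

text \<open>The Laplacian is the trace of the inverse metric times the complex Hessian, and a change
  of coordinates acts on both matrices by the same congruence. In
  \<open>matrix_inv G ** P ** G' ** Q = mat 1\<close> the factor \<open>Q\<close> may be moved to
  the front, which exhibits \<open>Q ** matrix_inv G ** P\<close> as the inverse of
  \<open>G'\<close>; then cyclicity of the trace applies.\<close>

lemma trace_matrix_inv_congruence:
  fixes G G' H H' P Q :: "'a::field^'n^'n"
  assumes "invertible G" "G = P ** G' ** Q" "H = P ** H' ** Q"
  shows "trace (matrix_inv G ** H) = trace (matrix_inv G' ** H')"
proof -
  let ?X = "matrix_inv G"
  have "(?X ** P ** G') ** Q = mat 1"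
    using matrix_inv_inverse(2)[OF assms(1)] by (simp add: assms(2) matrix_mul_assoc)
  then have "Q ** (?X ** P ** G') = mat 1" by (rule matrix_left_right_inverse1)
  then have "matrix_inv G' = Q ** ?X ** P" by (intro matrix_inv_eqI) (simp add: matrix_mul_assoc)
  moreover have "trace (?X ** H) = trace (Q ** (?X ** P ** H'))"
    unfolding trace_mul_sym[of Q] by (simp add: assms(3) matrix_mul_assoc)
  ultimately show ?thesis by (simp add: matrix_mul_assoc)
qed

lemma smooth_on_det:
  fixes A :: "'a::real_normed_vector \<Rightarrow> complex^'n^'n"
  assumes "open S" "\<And>i j. smooth_on S (\<lambda>z. A z $ i $ j)"
  shows "smooth_on S (\<lambda>z. det (A z))"
  unfolding det_def by (intro smooth_on_sum smooth_on_cmult smooth_on_prod assms)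

text \<open>Cramer's rule writes the entries of the inverse as quotients of determinants, which are
  polynomials in the matrix entries.\<close>

lemma smooth_on_matrix_inv:
  fixes A :: "'a::real_normed_vector \<Rightarrow> complex^'n^'n"
  assumes "open S" "\<And>i j. smooth_on S (\<lambda>z. A z $ i $ j)" "\<And>z. z \<in> S \<Longrightarrow> invertible (A z)"
  shows "smooth_on S (\<lambda>z. matrix_inv (A z) $ i $ j)"
proof -
  let ?C = "\<lambda>z. (\<chi> r s. if s = i then axis j 1 $ r else A z $ r $ s) :: complex^'n^'n"
  have "smooth_on S (\<lambda>z. det (?C z) * inverse (det (A z)))"
  proof (intro smooth_on_mult smooth_on_inverse smooth_on_det assms(1,2))
    show "smooth_on S (\<lambda>z. ?C z $ r $ s)" for r s
      using assms(2) by (cases "s = i") (auto intro: smooth_on_const assms(1))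
    show "det (A z) \<noteq> 0" if "z \<in> S" for z
      using assms(3)[OF that] by (simp add: invertible_det_nz)
  qed
  moreover have "det (?C z) * inverse (det (A z)) = matrix_inv (A z) $ i $ j" if z: "z \<in> S" for z
  proof -
    have "A z *v (matrix_inv (A z) *v axis j 1) = axis j 1"
      by (simp add: matrix_vector_mul_assoc matrix_inv_inverse[OF assms(3)[OF z]])
    then have "matrix_inv (A z) *v axis j 1 = (\<chi> k. det (\<chi> r s. if s = k then axis j 1 $ r else A z $ r $ s) / det (A z))"
      using assms(3)[OF z] by (subst (asm) cramer) (simp_all add: invertible_det_nz)
    then have "(matrix_inv (A z) *v axis j 1) $ i = det (?C z) / det (A z)" by simp
    moreover have "(matrix_inv (A z) *v axis j 1) $ i = matrix_inv (A z) $ i $ j"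
      by (simp add: matrix_vector_mult_def axis_def if_distrib cong: if_cong)
    ultimately show ?thesis by (simp add: divide_inverse)
  qed
  ultimately show ?thesis by (rule smooth_on_cong[OF assms(1), rotated])
qed

section \<open>Complex Hessians along curves and under coordinate changes\<close>

lemma frechet_derivative_wirtinger:
  fixes f :: "complex^'d::finite \<Rightarrow> complex"
  assumes "f differentiable (at z)"
  shows "frechet_derivative f (at z) x =
    (\<Sum>a\<in>UNIV. x $ a * wirtinger (Unbar a) f z + cnj (x $ a) * wirtinger (Bar a) f z)"
proof -
  let ?D = "frechet_derivative f (at z)"
  have lin: "linear ?D" by (rule linear_frechet_derivative[OF assms])
  have "x = (\<Sum>a\<in>UNIV. Re (x $ a) *\<^sub>R axis a 1 + Im (x $ a) *\<^sub>R axis a \<i>)"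
    by (simp add: vec_eq_iff axis_def if_distrib[of "\<lambda>x. _ *\<^sub>R x"] sum.distrib cong: if_cong)
      (simp add: complex_eq_iff)
  then have "?D x = ?D (\<Sum>a\<in>UNIV. Re (x $ a) *\<^sub>R axis a 1 + Im (x $ a) *\<^sub>R axis a \<i>)" by simp
  also have "\<dots> = (\<Sum>a\<in>UNIV. Re (x $ a) *\<^sub>R ?D (axis a 1) + Im (x $ a) *\<^sub>R ?D (axis a \<i>))"
    by (simp add: linear_sum[OF lin] linear_add[OF lin] linear_scale[OF lin])
  also have "\<dots> = (\<Sum>a\<in>UNIV. x $ a * wirtinger (Unbar a) f z + cnj (x $ a) * wirtinger (Bar a) f z)"
    by (intro sum.cong refl) (simp add: wirtinger_eq complex_eq_iff field_simps)
  finally show ?thesis .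
qed

text \<open>The derivative \<open>h *s v\<close> makes the curve holomorphic at \<zeta>, so the two
  Wirtinger derivatives of the composite do not mix. They are written out, without the factor 1/2,
  because \<open>wirtinger\<close> acts on functions on \<open>complex^'d\<close>.\<close>

lemma wirtinger_along_curve:
  fixes f :: "complex^'d::finite \<Rightarrow> complex" and \<gamma> :: "complex \<Rightarrow> complex^'d"
  assumes "f differentiable (at (\<gamma> \<zeta>))" "(\<gamma> has_derivative (\<lambda>h. h *s v)) (at \<zeta>)"
  shows "(\<lambda>\<zeta>. f (\<gamma> \<zeta>)) differentiable (at \<zeta>)"
    and "frechet_derivative (\<lambda>\<zeta>. f (\<gamma> \<zeta>)) (at \<zeta>) 1 + \<i> * frechet_derivative (\<lambda>\<zeta>. f (\<gamma> \<zeta>)) (at \<zeta>) \<i> =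
      2 * (\<Sum>b\<in>UNIV. cnj (v $ b) * wirtinger (Bar b) f (\<gamma> \<zeta>))"
    and "frechet_derivative (\<lambda>\<zeta>. f (\<gamma> \<zeta>)) (at \<zeta>) 1 - \<i> * frechet_derivative (\<lambda>\<zeta>. f (\<gamma> \<zeta>)) (at \<zeta>) \<i> =
      2 * (\<Sum>a\<in>UNIV. v $ a * wirtinger (Unbar a) f (\<gamma> \<zeta>))"
proof -
  have d: "((\<lambda>\<zeta>. f (\<gamma> \<zeta>)) has_derivative (\<lambda>h. frechet_derivative f (at (\<gamma> \<zeta>)) (h *s v))) (at \<zeta>)"
    by (rule has_derivative_compose[OF assms(2) has_derivative_frechet[OF assms(1)]])
  then show "(\<lambda>\<zeta>. f (\<gamma> \<zeta>)) differentiable (at \<zeta>)" using differentiable_def by blast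
  show "frechet_derivative (\<lambda>\<zeta>. f (\<gamma> \<zeta>)) (at \<zeta>) 1 + \<i> * frechet_derivative (\<lambda>\<zeta>. f (\<gamma> \<zeta>)) (at \<zeta>) \<i> =
      2 * (\<Sum>b\<in>UNIV. cnj (v $ b) * wirtinger (Bar b) f (\<gamma> \<zeta>))"
    and "frechet_derivative (\<lambda>\<zeta>. f (\<gamma> \<zeta>)) (at \<zeta>) 1 - \<i> * frechet_derivative (\<lambda>\<zeta>. f (\<gamma> \<zeta>)) (at \<zeta>) \<i> =
      2 * (\<Sum>a\<in>UNIV. v $ a * wirtinger (Unbar a) f (\<gamma> \<zeta>))"
    unfolding frechet_derivativeI[OF d] frechet_derivative_wirtinger[OF assms(1)]
    by (simp_all add: sum_distrib_left algebra_simps flip: sum.distrib sum_subtractf)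
qed

text \<open>Only holomorphic functions of one variable are needed for the invariance of the Laplacian: the
  complex Hessian is determined by its restrictions to complex lines.\<close>

lemma complex_hessian_along_curve:
  fixes u :: "complex^'d::finite \<Rightarrow> complex" and \<gamma> :: "complex \<Rightarrow> complex^'d"
  assumes "open V" "smooth_on V u" "open Z" "\<zeta> \<in> Z" "\<gamma> ` Z \<subseteq> V"
    and "\<And>a. (\<lambda>\<zeta>. \<gamma> \<zeta> $ a) holomorphic_on Z"
  shows "(let W = (\<lambda>\<zeta>. frechet_derivative (\<lambda>\<zeta>. u (\<gamma> \<zeta>)) (at \<zeta>) 1 + \<i> * frechet_derivative (\<lambda>\<zeta>. u (\<gamma> \<zeta>)) (at \<zeta>) \<i>)
      in frechet_derivative W (at \<zeta>) 1 - \<i> * frechet_derivative W (at \<zeta>) \<i>) =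
    4 * (\<Sum>a\<in>UNIV. \<Sum>b\<in>UNIV. deriv (\<lambda>\<zeta>. \<gamma> \<zeta> $ a) \<zeta> * cnj (deriv (\<lambda>\<zeta>. \<gamma> \<zeta> $ b) \<zeta>) * partials [Unbar a, Bar b] u (\<gamma> \<zeta>))"
proof -
  define g where "g a = (\<lambda>\<zeta>. \<gamma> \<zeta> $ a)" for a
  define W where "W = (\<lambda>\<zeta>. frechet_derivative (\<lambda>\<zeta>. u (\<gamma> \<zeta>)) (at \<zeta>) 1 + \<i> * frechet_derivative (\<lambda>\<zeta>. u (\<gamma> \<zeta>)) (at \<zeta>) \<i>)"
  have hol: "g a holomorphic_on Z" for a using assms(6) by (simp add: g_def)
  have \<gamma>: "(\<gamma> has_derivative (\<lambda>h. h *s (\<chi> a. deriv (g a) \<zeta>))) (at \<zeta>)" if "\<zeta> \<in> Z" for \<zeta>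
  proof -
    have "(g a has_derivative (\<lambda>h. h * deriv (g a) \<zeta>)) (at \<zeta>)" for a
      using holomorphic_derivI[OF hol assms(3) that, of a] by (simp add: has_field_derivative_def mult_commute_abs)
    then have "((\<lambda>\<zeta>. \<chi> a. g a \<zeta>) has_derivative (\<lambda>h. \<chi> a. h * deriv (g a) \<zeta>)) (at \<zeta>)"
      by (intro has_derivative_vec_lambda)
    moreover have "(\<lambda>\<zeta>. \<chi> a. g a \<zeta>) = \<gamma>" by (simp add: g_def)
    moreover have "(\<lambda>h. \<chi> a. h * deriv (g a) \<zeta>) = (\<lambda>h. h *s (\<chi> a. deriv (g a) \<zeta>))"
      by (auto simp: vec_eq_iff)
    ultimately show ?thesis by simp
  qed
  have inV: "\<gamma> \<zeta> \<in> V" if "\<zeta> \<in> Z" for \<zeta> using assms(5) that by auto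
  have W: "W \<zeta> = 2 * (\<Sum>b\<in>UNIV. cnj (deriv (g b) \<zeta>) * wirtinger (Bar b) u (\<gamma> \<zeta>))" if "\<zeta> \<in> Z" for \<zeta>
    unfolding W_def using wirtinger_along_curve(2)[OF smooth_on_differentiable[OF assms(2) inV[OF that]] \<gamma>[OF that]] by simp
  define E where "E b = (\<lambda>\<zeta>. cnj (deriv (g b) \<zeta>))" for b
  define F where "F b = (\<lambda>\<zeta>. wirtinger (Bar b) u (\<gamma> \<zeta>))" for b
  have E: "(E b has_derivative (\<lambda>h. cnj (deriv (deriv (g b)) \<zeta> * h))) (at \<zeta>)" for b
    unfolding E_def
    using holomorphic_derivI[OF holomorphic_deriv[OF hol assms(3)] assms(3,4), of b]
    by (intro bounded_linear.has_derivative[OF bounded_linear_cnj]) (simp add: has_field_derivative_def)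
  have sw: "wirtinger (Bar b) u differentiable (at (\<gamma> \<zeta>))" for b
    by (rule smooth_on_differentiable[OF smooth_on_wirtinger[OF assms(1,2)] inV[OF assms(4)]])
  have F: "(F b has_derivative frechet_derivative (F b) (at \<zeta>)) (at \<zeta>)"
    "frechet_derivative (F b) (at \<zeta>) 1 - \<i> * frechet_derivative (F b) (at \<zeta>) \<i> =
      2 * (\<Sum>a\<in>UNIV. deriv (g a) \<zeta> * partials [Unbar a, Bar b] u (\<gamma> \<zeta>))" for b
    unfolding F_def
    using wirtinger_along_curve(1,3)[OF sw \<gamma>[OF assms(4)]] by (simp_all add: has_derivative_frechet partials_Cons)
  have "((\<lambda>\<zeta>. 2 * (\<Sum>b\<in>UNIV. E b \<zeta> * F b \<zeta>)) has_derivative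
    (\<lambda>h. 2 * (\<Sum>b\<in>UNIV. E b \<zeta> * frechet_derivative (F b) (at \<zeta>) h + cnj (deriv (deriv (g b)) \<zeta> * h) * F b \<zeta>))) (at \<zeta>)"
    by (intro has_derivative_mult_right has_derivative_sum has_derivative_mult E F(1))
  then have "(W has_derivative (\<lambda>h. 2 * (\<Sum>b\<in>UNIV. E b \<zeta> * frechet_derivative (F b) (at \<zeta>) h + cnj (deriv (deriv (g b)) \<zeta> * h) * F b \<zeta>))) (at \<zeta>)"
    by (rule has_derivative_transform_within_open[OF _ assms(3,4)]) (simp add: W E_def F_def)
  \<comment> \<open>The terms with \<open>deriv (deriv (g b))\<close> cancel: \<open>E b\<close> is
    antiholomorphic, hence annihilated by the unbarred derivative.\<close>
  then have "frechet_derivative W (at \<zeta>) 1 - \<i> * frechet_derivative W (at \<zeta>) \<i> =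
    2 * (\<Sum>b\<in>UNIV. E b \<zeta> * (frechet_derivative (F b) (at \<zeta>) 1 - \<i> * frechet_derivative (F b) (at \<zeta>) \<i>))"
    by (simp add: frechet_derivativeI sum_distrib_left algebra_simps sum.distrib sum_subtractf)
  also have "\<dots> = 4 * (\<Sum>b\<in>UNIV. \<Sum>a\<in>UNIV. deriv (g a) \<zeta> * cnj (deriv (g b) \<zeta>) * partials [Unbar a, Bar b] u (\<gamma> \<zeta>))"
    unfolding F(2) by (simp add: E_def sum_distrib_left algebra_simps)
  also have "(\<Sum>b\<in>UNIV. \<Sum>a\<in>UNIV. deriv (g a) \<zeta> * cnj (deriv (g b) \<zeta>) * partials [Unbar a, Bar b] u (\<gamma> \<zeta>)) =
    (\<Sum>a\<in>UNIV. \<Sum>b\<in>UNIV. deriv (g a) \<zeta> * cnj (deriv (g b) \<zeta>) * partials [Unbar a, Bar b] u (\<gamma> \<zeta>))"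
    by (rule sum.swap)
  finally show ?thesis unfolding W_def g_def Let_def .
qed

text \<open>For the sum of the i-th unit vector and \<open>c\<close> times the j-th one, the
  hypothesis leaves \<open>cnj c * M i j + c * M j i = 0\<close> after removal of the diagonal
  terms; \<open>c = 1\<close> and \<open>c = \<i>\<close> together force
  \<open>M i j = 0\<close>.\<close>

lemma sesquilinear_polarization:
  fixes M :: "'d::finite \<Rightarrow> 'd \<Rightarrow> complex"
  assumes "\<And>v :: complex^'d. (\<Sum>i\<in>UNIV. \<Sum>j\<in>UNIV. v $ i * cnj (v $ j) * M i j) = 0"
  shows "M i j = 0"
proof -
  define B where "B v w = (\<Sum>i\<in>UNIV. \<Sum>j\<in>UNIV. v $ i * cnj (w $ j) * M i j)" for v w :: "complex^'d"
  have add: "B (v + v') w = B v w + B v' w" "B w (v + v') = B w v + B w v'" for v v' w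
    by (simp_all add: B_def algebra_simps sum.distrib)
  have sc: "B (c *s v) w = c * B v w" "B w (c *s v) = cnj c * B w v" for c v w
    by (simp_all add: B_def algebra_simps sum_distrib_left)
  have z: "B v v = 0" for v using assms by (simp add: B_def)
  have ax: "B (axis i 1) (axis j 1) = M i j" for i j
  proof -
    have "B (axis i 1) (axis j 1) = (\<Sum>a\<in>UNIV. \<Sum>b\<in>UNIV. if a = i \<and> b = j then M a b else 0)"
      unfolding B_def by (intro sum.cong refl) (auto simp: axis_def)
    also have "\<dots> = (\<Sum>a\<in>UNIV. if a = i then M a j else 0)"
      by (intro sum.cong refl) (auto simp: if_distrib cong: if_cong)
    also have "\<dots> = M i j" by simp
    finally show ?thesis .
  qed
  have "M i j + M j i = 0"
    using z[of "axis i 1 + axis j 1"] z[of "axis i 1"] z[of "axis j 1"] by (simp add: add ax add.commute)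
  moreover have "M j i = M i j"
    using z[of "axis i 1 + \<i> *s axis j 1"] z[of "axis i 1"] z[of "axis j 1"] by (simp add: add sc ax)
  ultimately show ?thesis by simp
qed

text \<open>\<open>frechet_derivative\<close> is a choice from the set of derivatives at the point,
  and this set is the same for functions that agree near it.\<close>

lemma frechet_derivative_cong_open:
  assumes "open Z" "\<zeta> \<in> Z" "\<And>z. z \<in> Z \<Longrightarrow> f z = g z"
  shows "frechet_derivative f (at \<zeta>) = frechet_derivative g (at \<zeta>)"
proof -
  have "(f has_derivative D) (at \<zeta>) \<longleftrightarrow> (g has_derivative D) (at \<zeta>)" for D
    using has_derivative_transform_within_open[OF _ assms(1,2), of f D UNIV g]
      has_derivative_transform_within_open[OF _ assms(1,2), of g D UNIV f] assms(3) by auto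
  then show ?thesis unfolding frechet_derivative_def by simp
qed

context complex_manifold
begin

lemma chart_inv_map: "c \<in> \<A> \<Longrightarrow> p \<in> chart_dom c \<Longrightarrow> chart_inv c (chart_map c p) = p"
  using chart[of c] unfolding homeomorphism_def by blast

lemma chart_map_inv: "c \<in> \<A> \<Longrightarrow> z \<in> chart_map c ` chart_dom c \<Longrightarrow> chart_map c (chart_inv c z) = z"
  using chart[of c] unfolding homeomorphism_def by blast

lemma chart_inv_dom: "z \<in> chart_map c ` chart_dom c \<Longrightarrow> chart_inv c z \<in> chart_dom c"
  by (rule inv_into_into)

lemma open_chart_image: "c \<in> \<A> \<Longrightarrow> open (chart_map c ` chart_dom c)"
  using chart[of c] by blast

lemma open_overlap:
  assumes "c \<in> \<A>" "c' \<in> \<A>"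
  shows "open (chart_map c ` (chart_dom c \<inter> chart_dom c'))"
proof -
  have "openin (top_of_set (chart_dom c)) (chart_dom c \<inter> chart_dom c')"
    using chart[OF assms(2)] by (simp add: openin_open_Int)
  then have "openin (top_of_set (chart_map c ` chart_dom c)) (chart_map c ` (chart_dom c \<inter> chart_dom c'))"
    using chart[OF assms(1)] homeomorphism_imp_open_map by blast
  then show ?thesis using open_chart_image[OF assms(1)] openin_open_trans by blast
qed

text \<open>\<open>holomorphic_map_on\<close> provides one complex derivative of the transition map
  but no second derivatives, so the chain rule cannot simply be applied twice. On a complex line
  through the point, both coordinate expressions of \<open>f\<close> become the same function of one
  variable, and the transition map becomes a holomorphic curve. Comparing the second derivatives in
  every direction \<open>v\<close> gives sesquilinear forms that agree on the diagonal, hence have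
  equal coefficients.\<close>

lemma complex_hessian_transform:
  assumes "c \<in> \<A>" "c' \<in> \<A>" "smooth_function \<A> f" "p \<in> chart_dom c \<inter> chart_dom c'"
  shows "partials [Unbar i, Bar j] (f \<circ> chart_inv c) (chart_map c p) = (\<Sum>a\<in>UNIV. \<Sum>b\<in>UNIV.
    wirtinger (Unbar i) (\<lambda>z. chart_map c' (chart_inv c z) $ a) (chart_map c p) *
    cnj (wirtinger (Unbar j) (\<lambda>z. chart_map c' (chart_inv c z) $ b) (chart_map c p)) *
    partials [Unbar a, Bar b] (f \<circ> chart_inv c') (chart_map c' p))"
proof -
  define U where "U = chart_map c ` (chart_dom c \<inter> chart_dom c')"
  define \<phi> where "\<phi> = chart_map c' \<circ> chart_inv c"
  define z0 where "z0 = chart_map c p"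
  define u where "u = f \<circ> chart_inv c"
  define u' where "u' = f \<circ> chart_inv c'"
  let ?\<Omega> = "chart_map c ` chart_dom c" and ?\<Omega>' = "chart_map c' ` chart_dom c'"
  have oU: "open U" unfolding U_def by (rule open_overlap[OF assms(1,2)])
  have z0: "z0 \<in> U" using assms(4) by (auto simp: U_def z0_def)
  have su: "smooth_on ?\<Omega> u" and su': "smooth_on ?\<Omega>' u'"
    using assms(1-3) by (auto simp: smooth_function_def u_def u'_def)
  have inv: "chart_inv c z \<in> chart_dom c \<inter> chart_dom c'" if "z \<in> U" for z
    using that chart_inv_map[OF assms(1)] by (auto simp: U_def)
  have uu': "u z = u' (\<phi> z)" if "z \<in> U" for z
    using inv[OF that] chart_inv_map[OF assms(2)] by (auto simp: u_def u'_def \<phi>_def)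
  have \<phi>U: "\<phi> z \<in> ?\<Omega>'" if "z \<in> U" for z using inv[OF that] by (auto simp: \<phi>_def)
  have "\<forall>z\<in>U. \<exists>D. (\<phi> has_derivative D) (at z) \<and> (\<forall>c v. D (c *s v) = c *s D v)"
    using transition[OF assms(1,2)] by (simp add: holomorphic_map_on_def U_def \<phi>_def)
  then obtain D where D: "\<And>z. z \<in> U \<Longrightarrow> (\<phi> has_derivative D z) (at z)"
      "\<And>z c v. z \<in> U \<Longrightarrow> D z (c *s v) = c *s D z v" by metis
  define J where "J a i = D z0 (axis i 1) $ a" for a i
  have comp: "((\<lambda>z. \<phi> z $ a) has_derivative (\<lambda>h. D z h $ a)) (at z)" if "z \<in> U" for z a
    by (rule bounded_linear.has_derivative[OF bounded_linear_vec_nth D(1)[OF that]])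
  have ax: "axis i \<i> = \<i> *s axis i (1::complex)" for i :: 'd by (simp add: vec_eq_iff axis_def)
  have J: "wirtinger (Unbar i) (\<lambda>z. chart_map c' (chart_inv c z) $ a) (chart_map c p) = J a i" for a i
  proof -
    have "wirtinger (Unbar i) (\<lambda>z. \<phi> z $ a) z0 = J a i"
      unfolding wirtinger_of_derivative[OF comp[OF z0]] index_of.simps ax D(2)[OF z0] by (simp add: J_def)
    then show ?thesis by (simp add: \<phi>_def z0_def)
  qed
  have lin: "D z0 v $ a = (\<Sum>i\<in>UNIV. v $ i * J a i)" for v a
  proof -
    have "v = (\<Sum>i\<in>UNIV. v $ i *s axis i 1)" by (simp add: basis_expansion)
    then have "D z0 v = D z0 (\<Sum>i\<in>UNIV. v $ i *s axis i 1)" by simp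
    also have "\<dots> = (\<Sum>i\<in>UNIV. v $ i *s D z0 (axis i 1))"
      by (simp add: linear_sum[OF has_derivative_linear[OF D(1)[OF z0]]] D(2)[OF z0])
    finally show ?thesis by (simp add: J_def)
  qed
  have levi: "(\<Sum>i\<in>UNIV. \<Sum>j\<in>UNIV. v $ i * cnj (v $ j) * partials [Unbar i, Bar j] u z0) =
    (\<Sum>a\<in>UNIV. \<Sum>b\<in>UNIV. D z0 v $ a * cnj (D z0 v $ b) * partials [Unbar a, Bar b] u' (\<phi> z0))" for v
  proof -
    define \<gamma> where "\<gamma> \<zeta> = z0 + \<zeta> *s v" for \<zeta>
    define Z where "Z = \<gamma> -` U"
    have \<gamma>': "(\<gamma> has_derivative (\<lambda>h. h *s v)) (at \<zeta>)" for \<zeta>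
    proof -
      have "((\<lambda>\<zeta>. \<chi> a. z0 $ a + \<zeta> * v $ a) has_derivative (\<lambda>h. \<chi> a. h * v $ a)) (at \<zeta>)"
        by (intro has_derivative_vec_lambda) (auto intro!: derivative_eq_intros)
      moreover have "(\<lambda>\<zeta>. \<chi> a. z0 $ a + \<zeta> * v $ a) = \<gamma>" "(\<lambda>h. \<chi> a. h * v $ a) = (\<lambda>h. h *s v)"
        by (auto simp: vec_eq_iff \<gamma>_def)
      ultimately show ?thesis by simp
    qed
    have "continuous_on UNIV \<gamma>"
      using has_derivative_continuous[OF \<gamma>'] by (simp add: continuous_at_imp_continuous_on)
    then have oZ: "open Z" unfolding Z_def by (rule open_vimage[OF oU])
    have 0: "0 \<in> Z" "\<gamma> 0 = z0" using z0 by (auto simp: Z_def \<gamma>_def)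
    have "((\<lambda>\<zeta>. \<phi> (\<gamma> \<zeta>) $ a) has_field_derivative D (\<gamma> \<zeta>) v $ a) (at \<zeta>)" if "\<zeta> \<in> Z" for \<zeta> a
    proof -
      have U: "\<gamma> \<zeta> \<in> U" using that by (simp add: Z_def)
      have "((\<lambda>\<zeta>. \<phi> (\<gamma> \<zeta>) $ a) has_derivative (\<lambda>h. D (\<gamma> \<zeta>) (h *s v) $ a)) (at \<zeta>)"
        by (rule has_derivative_compose[OF \<gamma>' comp[OF U]])
      then show ?thesis by (simp add: D(2)[OF U] has_field_derivative_def mult_commute_abs)
    qed
    note d2 = this
    have d1: "((\<lambda>\<zeta>. \<gamma> \<zeta> $ a) has_field_derivative v $ a) (at \<zeta>)" for \<zeta> a
      by (auto simp: \<gamma>_def intro!: derivative_eq_intros)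
    define W where "W w = (\<lambda>\<zeta>. frechet_derivative w (at \<zeta>) 1 + \<i> * frechet_derivative w (at \<zeta>) \<i>)"
      for w :: "complex \<Rightarrow> complex"
    have eq: "u (\<gamma> \<zeta>) = u' (\<phi> (\<gamma> \<zeta>))" if "\<zeta> \<in> Z" for \<zeta> using uu' that by (simp add: Z_def)
    have "W (\<lambda>\<zeta>. u (\<gamma> \<zeta>)) \<zeta> = W (\<lambda>\<zeta>. u' (\<phi> (\<gamma> \<zeta>))) \<zeta>" if "\<zeta> \<in> Z" for \<zeta>
    proof -
      have "frechet_derivative (\<lambda>\<zeta>. u (\<gamma> \<zeta>)) (at \<zeta>) = frechet_derivative (\<lambda>\<zeta>. u' (\<phi> (\<gamma> \<zeta>))) (at \<zeta>)"
        by (rule frechet_derivative_cong_open[OF oZ that]) (rule eq)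
      then show ?thesis by (simp only: W_def)
    qed
    then have Weq: "frechet_derivative (W (\<lambda>\<zeta>. u (\<gamma> \<zeta>))) (at 0) = frechet_derivative (W (\<lambda>\<zeta>. u' (\<phi> (\<gamma> \<zeta>)))) (at 0)"
      by (rule frechet_derivative_cong_open[OF oZ 0(1)])
    have "frechet_derivative (W (\<lambda>\<zeta>. u (\<gamma> \<zeta>))) (at 0) 1 - \<i> * frechet_derivative (W (\<lambda>\<zeta>. u (\<gamma> \<zeta>))) (at 0) \<i> =
      4 * (\<Sum>a\<in>UNIV. \<Sum>b\<in>UNIV. deriv (\<lambda>\<zeta>. \<gamma> \<zeta> $ a) 0 * cnj (deriv (\<lambda>\<zeta>. \<gamma> \<zeta> $ b) 0) * partials [Unbar a, Bar b] u (\<gamma> 0))"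
    proof (rule complex_hessian_along_curve[unfolded Let_def, folded W_def, OF open_chart_image[OF assms(1)] su oZ 0(1)])
      show "\<gamma> ` Z \<subseteq> chart_map c ` chart_dom c" by (auto simp: Z_def U_def)
      show "(\<lambda>\<zeta>. \<gamma> \<zeta> $ a) holomorphic_on Z" for a using d1 by (meson holomorphic_onI field_differentiable_def field_differentiable_at_within)
    qed
    moreover have "frechet_derivative (W (\<lambda>\<zeta>. u' (\<phi> (\<gamma> \<zeta>)))) (at 0) 1 - \<i> * frechet_derivative (W (\<lambda>\<zeta>. u' (\<phi> (\<gamma> \<zeta>)))) (at 0) \<i> =
      4 * (\<Sum>a\<in>UNIV. \<Sum>b\<in>UNIV. deriv (\<lambda>\<zeta>. \<phi> (\<gamma> \<zeta>) $ a) 0 * cnj (deriv (\<lambda>\<zeta>. \<phi> (\<gamma> \<zeta>) $ b) 0) * partials [Unbar a, Bar b] u' (\<phi> (\<gamma> 0)))"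
    proof (rule complex_hessian_along_curve[unfolded Let_def, folded W_def, OF open_chart_image[OF assms(2)] su' oZ 0(1)])
      show "(\<lambda>\<zeta>. \<phi> (\<gamma> \<zeta>)) ` Z \<subseteq> chart_map c' ` chart_dom c'" using \<phi>U by (auto simp: Z_def)
      show "(\<lambda>\<zeta>. \<phi> (\<gamma> \<zeta>) $ a) holomorphic_on Z" for a using d2 by (meson holomorphic_onI field_differentiable_def field_differentiable_at_within)
    qed
    ultimately show ?thesis
      unfolding Weq DERIV_imp_deriv[OF d1] DERIV_imp_deriv[OF d2[OF 0(1)]] 0(2) by simp
  qed
  let ?M = "\<lambda>i j. partials [Unbar i, Bar j] u z0 - (\<Sum>a\<in>UNIV. \<Sum>b\<in>UNIV. J a i * cnj (J b j) * partials [Unbar a, Bar b] u' (\<phi> z0))"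
  have "(\<Sum>i\<in>UNIV. \<Sum>j\<in>UNIV. v $ i * cnj (v $ j) * ?M i j) = 0" for v
  proof -
    have "(\<Sum>a\<in>UNIV. \<Sum>b\<in>UNIV. D z0 v $ a * cnj (D z0 v $ b) * partials [Unbar a, Bar b] u' (\<phi> z0)) =
      (\<Sum>a\<in>UNIV. \<Sum>b\<in>UNIV. \<Sum>i\<in>UNIV. \<Sum>j\<in>UNIV. v $ i * cnj (v $ j) * (J a i * cnj (J b j) * partials [Unbar a, Bar b] u' (\<phi> z0)))"
      unfolding lin by (simp add: sum_distrib_left sum_distrib_right sum_product algebra_simps,
        rule sum.cong[OF refl], rule sum.cong[OF refl], rule sum.swap)
    also have "\<dots> = (\<Sum>i\<in>UNIV. \<Sum>j\<in>UNIV. \<Sum>a\<in>UNIV. \<Sum>b\<in>UNIV. v $ i * cnj (v $ j) * (J a i * cnj (J b j) * partials [Unbar a, Bar b] u' (\<phi> z0)))"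
      (is "(\<Sum>a\<in>UNIV. \<Sum>b\<in>UNIV. \<Sum>i\<in>UNIV. \<Sum>j\<in>UNIV. ?F a b i j) = _")
    proof -
      have "(\<Sum>a\<in>UNIV. \<Sum>b\<in>UNIV. \<Sum>i\<in>UNIV. \<Sum>j\<in>UNIV. ?F a b i j) = (\<Sum>a\<in>UNIV. \<Sum>i\<in>UNIV. \<Sum>b\<in>UNIV. \<Sum>j\<in>UNIV. ?F a b i j)"
        by (intro sum.cong refl sum.swap)
      also have "\<dots> = (\<Sum>i\<in>UNIV. \<Sum>a\<in>UNIV. \<Sum>b\<in>UNIV. \<Sum>j\<in>UNIV. ?F a b i j)" by (rule sum.swap)
      also have "\<dots> = (\<Sum>i\<in>UNIV. \<Sum>a\<in>UNIV. \<Sum>j\<in>UNIV. \<Sum>b\<in>UNIV. ?F a b i j)" by (intro sum.cong refl sum.swap)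
      also have "\<dots> = (\<Sum>i\<in>UNIV. \<Sum>j\<in>UNIV. \<Sum>a\<in>UNIV. \<Sum>b\<in>UNIV. ?F a b i j)" by (intro sum.cong refl sum.swap)
      finally show ?thesis .
    qed
    finally show ?thesis using levi[of v] by (simp add: right_diff_distrib sum_subtractf sum_distrib_left)
  qed
  then have "?M i j = 0" by (rule sesquilinear_polarization)
  then show ?thesis unfolding J using inv[OF z0]
    by (simp add: u_def u'_def z0_def \<phi>_def chart_inv_map[OF assms(1)] assms(4)[THEN IntD1])
qed

end

section \<open>Independence of the chart and smoothness of iterated Laplacians\<close>

context kahler_manifold
begin

lemma invertible_metric:
  assumes "c \<in> \<A>" "p \<in> chart_dom c"
  shows "invertible (g c p)"
proof -
  have "x = 0" if "g c p *v x = 0" for x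
  proof (rule ccontr)
    assume "x \<noteq> 0"
    \<comment> \<open>The form in \<open>positive\<close> conjugates its second argument, so a
      kernel vector \<open>x\<close> enters as the conjugate of \<open>v\<close>.\<close>
    define v where "v = (\<chi> i. cnj (x $ i))"
    have "v \<noteq> 0" using \<open>x \<noteq> 0\<close> by (auto simp: v_def vec_eq_iff)
    then have "0 < Re (\<Sum>i\<in>UNIV. \<Sum>j\<in>UNIV. g c p $ i $ j * v $ i * cnj (v $ j))"
      by (rule positive[OF assms])
    also have "(\<Sum>i\<in>UNIV. \<Sum>j\<in>UNIV. g c p $ i $ j * v $ i * cnj (v $ j)) = (\<Sum>i\<in>UNIV. v $ i * (g c p *v x) $ i)"
      by (simp add: matrix_vector_mult_def v_def sum_distrib_left algebra_simps)
    finally show False using that by simp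
  qed
  then show ?thesis unfolding invertible_left_inverse matrix_left_invertible_ker by blast
qed

lemma laplacian_in_eq_trace:
  "laplacian_in g c f p = trace (matrix_inv (g c p) ** (\<chi> i j. partials [Unbar i, Bar j] (f \<circ> chart_inv c) (chart_map c p)))"
  unfolding laplacian_in_def trace_def matrix_matrix_mult_def by (simp, rule sum.swap)

lemma laplacian_in_chart_independent:
  assumes "c \<in> \<A>" "c' \<in> \<A>" "smooth_function \<A> f" "p \<in> chart_dom c \<inter> chart_dom c'"
  shows "laplacian_in g c f p = laplacian_in g c' f p"
proof -
  let ?J = "\<lambda>a i. wirtinger (Unbar i) (\<lambda>z. chart_map c' (chart_inv c z) $ a) (chart_map c p)"
  let ?P = "(\<chi> i a. ?J a i) :: complex^'d^'d" and ?Q = "(\<chi> b j. cnj (?J b j)) :: complex^'d^'d"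
  have m: "(?P ** M ** ?Q) $ i $ j = (\<Sum>a\<in>UNIV. \<Sum>b\<in>UNIV. ?J a i * cnj (?J b j) * M $ a $ b)" for M :: "complex^'d^'d" and i j
  proof -
    have "(?P ** M ** ?Q) $ i $ j = (\<Sum>b\<in>UNIV. \<Sum>a\<in>UNIV. ?J a i * cnj (?J b j) * M $ a $ b)"
      by (simp add: matrix_matrix_mult_def sum_distrib_left sum_distrib_right algebra_simps)
    then show ?thesis by (subst sum.swap) simp
  qed
  show ?thesis unfolding laplacian_in_eq_trace
  proof (rule trace_matrix_inv_congruence[where P = ?P and Q = ?Q])
    show "invertible (g c p)" using invertible_metric assms by blast
    show "g c p = ?P ** g c' p ** ?Q"
      unfolding vec_eq_iff m using tensor[OF assms(1,2,4)] by blast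
    show "(\<chi> i j. partials [Unbar i, Bar j] (f \<circ> chart_inv c) (chart_map c p)) =
      ?P ** (\<chi> i j. partials [Unbar i, Bar j] (f \<circ> chart_inv c') (chart_map c' p)) ** ?Q"
      unfolding vec_eq_iff m by (simp add: complex_hessian_transform[OF assms])
  qed
qed

text \<open>\<open>laplacian\<close> chooses a chart at every point separately; independence of the
  chart lets one fixed chart serve on its whole domain, where the result can be
  differentiated.\<close>

lemma laplacian_in_chart:
  assumes "c \<in> \<A>" "smooth_function \<A> f" "z \<in> chart_map c ` chart_dom c"
  shows "laplacian \<A> g f (chart_inv c z) = (\<Sum>i\<in>UNIV. \<Sum>j\<in>UNIV.
    matrix_inv (g c (chart_inv c z)) $ j $ i * partials [Unbar i, Bar j] (f \<circ> chart_inv c) z)"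
proof -
  let ?p = "chart_inv c z" and ?c = "SOME d. d \<in> \<A> \<and> chart_inv c z \<in> chart_dom d"
  have p: "?p \<in> chart_dom c" by (rule chart_inv_dom[OF assms(3)])
  then have "?c \<in> \<A> \<and> ?p \<in> chart_dom ?c" using assms(1) by (intro someI[of "\<lambda>d. d \<in> \<A> \<and> ?p \<in> chart_dom d" c]) simp
  then have "laplacian \<A> g f ?p = laplacian_in g c f ?p"
    unfolding laplacian_def using assms(1,2) p by (intro laplacian_in_chart_independent) auto
  then show ?thesis by (simp add: laplacian_in_def chart_map_inv[OF assms(1,3)])
qed

lemma smooth_inverse_metric:
  assumes "c \<in> \<A>"
  shows "smooth_on (chart_map c ` chart_dom c) (\<lambda>z. matrix_inv (g c (chart_inv c z)) $ i $ j)"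
proof (rule smooth_on_matrix_inv[OF open_chart_image[OF assms]])
  show "smooth_on (chart_map c ` chart_dom c) (\<lambda>z. g c (chart_inv c z) $ i $ j)" for i j
    using smooth[OF assms, of i j] by (simp add: metric_comp_def[abs_def])
  show "invertible (g c (chart_inv c z))" if "z \<in> chart_map c ` chart_dom c" for z
    by (rule invertible_metric[OF assms chart_inv_dom[OF that]])
qed

lemma smooth_function_laplacian:
  assumes "smooth_function \<A> f"
  shows "smooth_function \<A> (laplacian \<A> g f)"
  unfolding smooth_function_def
proof
  fix c assume c: "c \<in> \<A>"
  let ?S = "chart_map c ` chart_dom c"
  have "smooth_on ?S (\<lambda>z. \<Sum>i\<in>UNIV. \<Sum>j\<in>UNIV.
    matrix_inv (g c (chart_inv c z)) $ j $ i * partials [Unbar i, Bar j] (f \<circ> chart_inv c) z)"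
    using assms c unfolding smooth_function_def
    by (intro smooth_on_sum smooth_on_mult smooth_inverse_metric smooth_on_partials open_chart_image) auto
  then show "smooth_on ?S (laplacian \<A> g f \<circ> chart_inv c)"
    by (rule smooth_on_cong[OF open_chart_image[OF c], rotated]) (simp add: laplacian_in_chart[OF c assms])
qed

lemma smooth_function_laplacian_funpow:
  "smooth_function \<A> f \<Longrightarrow> smooth_function \<A> ((laplacian \<A> g ^^ k) f)"
  by (induction k) (auto intro: smooth_function_laplacian)

end

section \<open>Derivatives of iterated Laplacians at the center\<close>

definition closed_leaves where "closed_leaves k p A B = {(es, bs). closed_leaf k p A B es bs}"
definition open_leaves where "open_leaves k a p A B = {(es, bs). open_leaf k a p A B es bs}"

lemma closed_leaves_0: "closed_leaves 0 p A B = {([], [(A, B)])}"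
  unfolding closed_leaves_def by (auto elim: closed_leaf.cases intro: Done)

lemma closed_leaves_Suc: "closed_leaves (Suc k) p A B = open_leaves k p p A B"
  unfolding closed_leaves_def open_leaves_def by (auto elim: closed_leaf.cases intro: Start)

lemma open_leaves_eq:
  "open_leaves k a p A B = (\<lambda>(es, bs). (p # es, bs)) ` closed_leaves k (Suc p) (insert a A) (insert p B) \<union>
    (\<Union>(X, Y)\<in>(Pow A - {{}}) \<times> (Pow B - {{}}).
      (\<lambda>(es, bs). (p # es, (insert (Suc p) X, insert p Y) # bs)) ` open_leaves k a (Suc p) (A - X) (B - Y))"
  (is "?L = ?R")
proof (rule subset_antisym; rule subsetI)
  fix l assume "l \<in> ?L"
  then obtain es bs where l: "l = (es, bs)" "open_leaf k a p A B es bs" by (auto simp: open_leaves_def)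
  from l(2) show "l \<in> ?R"
  proof (cases rule: open_leaf.cases)
    case (Finish es')
    then show ?thesis unfolding l(1) closed_leaves_def by (intro UnI1) (auto simp: image_iff)
  next
    case (Vertex X Y es' bs')
    then have "(es', bs') \<in> open_leaves k a (Suc p) (A - X) (B - Y)" by (simp add: open_leaves_def)
    then have "l \<in> (\<lambda>(es, bs). (p # es, (insert (Suc p) X, insert p Y) # bs)) ` open_leaves k a (Suc p) (A - X) (B - Y)"
      using Vertex l(1) by (auto simp: image_iff)
    then show ?thesis using Vertex by (intro UnI2 UN_I[of "(X, Y)"]) auto
  qed
next
  fix l assume "l \<in> ?R"
  then show "l \<in> ?L"
    by (auto simp: open_leaves_def closed_leaves_def intro: Finish Vertex)
qed

text \<open>Tells \<open>Finish\<close> and \<open>Vertex\<close> apart: after \<open>Vertex\<close>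
  at stage \<open>p\<close> the heads in the first block are \<open>p\<close> and older edges,
  whereas after \<open>Finish\<close> the first block, unless it is that of the function, contains
  the head of a later edge.\<close>

lemma leaf_head_bound:
  "closed_leaf k p A B es bs \<Longrightarrow> 2 \<le> length bs \<Longrightarrow> \<exists>x\<in>snd (hd bs). p \<le> x"
  "open_leaf k a p A B es bs \<Longrightarrow> 2 \<le> length bs \<Longrightarrow> \<exists>x\<in>snd (hd bs). p \<le> x"
  by (induction rule: closed_leaf_open_leaf.inducts) (auto dest!: Suc_leD)

lemma sum_open_leaves:
  assumes "A \<subseteq> {..<p}" "B \<subseteq> {..<p}" "a \<le> p"
    and "finite (closed_leaves k (Suc p) (insert a A) (insert p B))"
    and "\<And>X Y. X \<subseteq> A \<Longrightarrow> X \<noteq> {} \<Longrightarrow> Y \<subseteq> B \<Longrightarrow> finite (open_leaves k a (Suc p) (A - X) (B - Y))"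
  shows "finite (open_leaves k a p A B)"
    and "(\<Sum>l\<in>open_leaves k a p A B. F l) =
      (\<Sum>(es, bs)\<in>closed_leaves k (Suc p) (insert a A) (insert p B). F (p # es, bs)) +
      (\<Sum>X\<in>Pow A - {{}}. \<Sum>Y\<in>Pow B - {{}}. \<Sum>(es, bs)\<in>open_leaves k a (Suc p) (A - X) (B - Y).
        F (p # es, (insert (Suc p) X, insert p Y) # bs))"
proof -
  have fin: "finite A" "finite B" using assms(1,2) finite_subset by auto
  let ?I = "(Pow A - {{}}) \<times> (Pow B - {{}})"
  let ?C = "(\<lambda>(es, bs). (p # es, bs)) ` closed_leaves k (Suc p) (insert a A) (insert p B)"
  let ?T = "\<lambda>(X, Y). (\<lambda>(es, bs). (p # es, (insert (Suc p) X, insert p Y) # bs)) ` open_leaves k a (Suc p) (A - X) (B - Y)"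
  have fI: "finite ?I" using fin by simp
  have fC: "finite ?C" using assms(4) by simp
  have fT: "finite (?T xy)" if "xy \<in> ?I" for xy using assms(5) that by (cases xy) auto
  show "finite (open_leaves k a p A B)"
    by (subst open_leaves_eq, rule finite_UnI[OF fC finite_UN_I[OF fI]]) (rule fT)
  have disj: "?C \<inter> (\<Union>xy\<in>?I. ?T xy) = {}"
  proof (rule ccontr)
    assume "?C \<inter> (\<Union>xy\<in>?I. ?T xy) \<noteq> {}"
    then obtain X Y es bs es' bs' where XY: "Y \<subseteq> B" "open_leaf k a (Suc p) (A - X) (B - Y) es bs"
      "closed_leaf k (Suc p) (insert a A) (insert p B) es' bs'" "bs' = (insert (Suc p) X, insert p Y) # bs"
      by (auto simp: closed_leaves_def open_leaves_def) blast
    have "bs \<noteq> []" using leaf_edges(2)[OF XY(2)] by simp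
    then have "2 \<le> length bs'" using XY(4) by (cases bs) auto
    then obtain x where "x \<in> insert p Y" "Suc p \<le> x"
      using leaf_head_bound(1)[OF XY(3)] XY(4) by auto
    then show False using XY(1) assms(2) by auto
  qed
  have "(\<Sum>l\<in>open_leaves k a p A B. F l) = sum F ?C + sum F (\<Union>xy\<in>?I. ?T xy)"
    by (subst open_leaves_eq, rule sum.union_disjoint[OF fC finite_UN_I[OF fI] disj]) (rule fT)
  also have "sum F ?C = (\<Sum>(es, bs)\<in>closed_leaves k (Suc p) (insert a A) (insert p B). F (p # es, bs))"
    by (subst sum.reindex) (auto simp: inj_on_def case_prod_unfold)
  also have "sum F (\<Union>xy\<in>?I. ?T xy) = (\<Sum>xy\<in>?I. sum F (?T xy))"
  proof (rule sum.UNION_disjoint[OF fI])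
    show "\<forall>xy\<in>?I. finite (?T xy)" using fT by blast
    show "\<forall>i\<in>?I. \<forall>j\<in>?I. i \<noteq> j \<longrightarrow> ?T i \<inter> ?T j = {}"
    proof (intro ballI impI)
      fix i j assume ij: "i \<in> ?I" "j \<in> ?I" "i \<noteq> j"
      obtain X Y X' Y' where e: "i = (X, Y)" "j = (X', Y')" by force
      have n: "Suc p \<notin> X" "Suc p \<notin> X'" "p \<notin> Y" "p \<notin> Y'" using ij(1,2) assms(1,2) unfolding e by auto
      \<comment> \<open>\<open>Suc p\<close> and \<open>p\<close> lie outside the sets of older
        edges, so \<open>X\<close> and \<open>Y\<close> can be recovered from the block.\<close>
      have "\<not> (insert (Suc p) X = insert (Suc p) X' \<and> insert p Y = insert p Y')"
        using n ij(3) unfolding e by (metis insert_ident)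
      then show "?T i \<inter> ?T j = {}" unfolding e by auto
    qed
  qed
  also have "\<dots> = (\<Sum>(X, Y)\<in>?I. \<Sum>(es, bs)\<in>open_leaves k a (Suc p) (A - X) (B - Y).
        F (p # es, (insert (Suc p) X, insert p Y) # bs))"
  proof (rule sum.cong[OF refl])
    fix xy assume "xy \<in> ?I"
    obtain X Y where xy: "xy = (X, Y)" by force
    show "sum F (?T xy) = (case xy of (X, Y) \<Rightarrow> \<Sum>(es, bs)\<in>open_leaves k a (Suc p) (A - X) (B - Y).
        F (p # es, (insert (Suc p) X, insert p Y) # bs))"
      unfolding xy prod.case by (subst sum.reindex) (auto simp: inj_on_def case_prod_unfold)
  qed
  also have "\<dots> = (\<Sum>X\<in>Pow A - {{}}. \<Sum>Y\<in>Pow B - {{}}. \<Sum>(es, bs)\<in>open_leaves k a (Suc p) (A - X) (B - Y).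
        F (p # es, (insert (Suc p) X, insert p Y) # bs))"
    by (simp add: sum.cartesian_product)
  finally show "(\<Sum>l\<in>open_leaves k a p A B. F l) =
      (\<Sum>(es, bs)\<in>closed_leaves k (Suc p) (insert a A) (insert p B). F (p # es, bs)) +
      (\<Sum>X\<in>Pow A - {{}}. \<Sum>Y\<in>Pow B - {{}}. \<Sum>(es, bs)\<in>open_leaves k a (Suc p) (A - X) (B - Y).
        F (p # es, (insert (Suc p) X, insert p Y) # bs))" .
qed

section \<open>Sums over the values of contracted indices\<close>

fun index_sum :: "nat list \<Rightarrow> ((nat \<Rightarrow> 'd::finite) \<Rightarrow> complex) \<Rightarrow> (nat \<Rightarrow> 'd) \<Rightarrow> complex" where
  "index_sum [] F \<iota> = F \<iota>"
| "index_sum (e # es) F \<iota> = (\<Sum>i\<in>UNIV. index_sum es F (\<iota>(e := i)))"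

text \<open>Applied to the factor of a vertex: it involves only edges created up to that moment, so
  it is constant under the sums over later edges.\<close>

lemma index_sum_factor:
  assumes "\<And>\<iota>'. (\<forall>x. x \<notin> set es \<longrightarrow> \<iota>' x = \<iota> x) \<Longrightarrow> C \<iota>' = c"
  shows "index_sum es (\<lambda>\<iota>. C \<iota> * F \<iota>) \<iota> = c * index_sum es F \<iota>"
  using assms
proof (induction es arbitrary: \<iota>)
  case (Cons e es)
  have "index_sum es (\<lambda>\<iota>. C \<iota> * F \<iota>) (\<iota>(e := i)) = c * index_sum es F (\<iota>(e := i))" for i
    by (rule Cons.IH, rule Cons.prems) auto
  then show ?case by (simp add: sum_distrib_left)
qed simp

lemma index_sum_PiE:
  assumes "distinct es"
  shows "index_sum es F \<iota> = (\<Sum>\<kappa>\<in>set es \<rightarrow>\<^sub>E UNIV. F (\<lambda>x. if x \<in> set es then \<kappa> x else \<iota> x))"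
  using assms
proof (induction es arbitrary: \<iota>)
  case (Cons e es)
  have e: "e \<notin> set es" using Cons.prems by simp
  have "(\<Sum>\<kappa>\<in>set (e # es) \<rightarrow>\<^sub>E UNIV. F (\<lambda>x. if x \<in> set (e # es) then \<kappa> x else \<iota> x)) =
    (\<Sum>(i, \<kappa>)\<in>UNIV \<times> (set es \<rightarrow>\<^sub>E UNIV). F (\<lambda>x. if x \<in> set (e # es) then (\<kappa>(e := i)) x else \<iota> x))"
    unfolding list.set PiE_insert_eq
    by (subst sum.reindex[OF inj_combinator[OF e]]) (simp add: case_prod_unfold comp_def)
  also have "\<dots> = (\<Sum>(i, \<kappa>)\<in>UNIV \<times> (set es \<rightarrow>\<^sub>E UNIV). F (\<lambda>x. if x \<in> set es then \<kappa> x else (\<iota>(e := i)) x))"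
    using e by (intro sum.cong refl) (auto simp: fun_eq_iff intro!: arg_cong[of _ _ F])
  also have "\<dots> = index_sum (e # es) F \<iota>"
    using Cons by (simp add: sum.cartesian_product)
  finally show ?case by simp
qed (simp add: PiE_empty_domain)

lemma set_partials_cong_index:
  assumes "finite A" "finite B" "\<And>x. x \<in> A \<union> B \<Longrightarrow> \<iota> x = \<iota>' x"
  shows "set_partials \<iota> A B f z = set_partials \<iota>' A B f z"
proof -
  have "map \<iota> (sorted_list_of_set A) = map \<iota>' (sorted_list_of_set A)"
    "map \<iota> (sorted_list_of_set B) = map \<iota>' (sorted_list_of_set B)"
    using assms by auto
  then show ?thesis by (simp only: set_partials_def)
qed

section \<open>Metrics in normal coordinates and the symmetry of their derivatives\<close>

lemma mset_invariant:
  assumes "\<And>x xs ys. mset xs = mset ys \<Longrightarrow> F (x # xs) = F (x # ys)"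
    and "\<And>x y zs. F (x # y # zs) = F (y # x # zs)" and eq: "mset xs = mset ys"
  shows "F xs = F ys"
proof (cases xs)
  case (Cons x us)
  then obtain y vs where ys: "ys = y # vs" using eq by (cases ys) auto
  show ?thesis
  proof (cases "x = y")
    case True
    then show ?thesis using assms(1)[of us vs x] eq unfolding Cons ys by simp
  next
    case False
    then obtain M where M: "mset us = add_mset y M" "mset vs = add_mset x M"
      using eq unfolding Cons ys by (auto simp: add_eq_conv_ex)
    obtain zs where zs: "mset zs = M" using ex_mset by blast
    have "mset vs = mset (x # zs)" by (simp add: M zs)
    then have "F (y # vs) = F (y # x # zs)" by (rule assms(1))
    moreover have "F (x # us) = F (x # y # zs)" by (rule assms(1)) (simp add: M zs)
    ultimately show ?thesis unfolding Cons ys using assms(2)[of x y zs] by simp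
  qed
qed (use eq in simp)

text \<open>The properties of a Kaehler metric in normal coordinates on which the expansion rests,
  for functions on an open subset of \<open>complex^'d\<close>. \<open>H j i\<close> is the inverse
  metric with its barred index first, and \<open>N\<close> bounds the order up to which pure
  derivatives are assumed to vanish at the center \<open>z\<close>.\<close>

locale normal_metric =
  fixes S :: "(complex^'d::finite) set" and z :: "complex^'d" and N :: nat
    and G H :: "'d \<Rightarrow> 'd \<Rightarrow> complex^'d \<Rightarrow> complex"
  assumes open_S: "open S" and z: "z \<in> S"
    and smooth_G: "smooth_on S (G i j)" and smooth_H: "smooth_on S (H i j)"
    and inverse: "w \<in> S \<Longrightarrow> (\<Sum>l\<in>UNIV. H j l w * G l c w) = (if j = c then 1 else 0)"
    and closed_unbar: "w \<in> S \<Longrightarrow> wirtinger (Unbar l) (G i j) w = wirtinger (Unbar i) (G l j) w"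
    and closed_bar: "w \<in> S \<Longrightarrow> wirtinger (Bar l) (G i j) w = wirtinger (Bar j) (G i l) w"
    and G_center: "G i j z = (if i = j then 1 else 0)"
    and pure_unbar: "1 \<le> length ks \<Longrightarrow> length ks \<le> N \<Longrightarrow> partials (map Unbar ks) (G i j) z = 0"
    and pure_bar: "1 \<le> length ks \<Longrightarrow> length ks \<le> N \<Longrightarrow> partials (map Bar ks) (G i j) z = 0"
begin

definition factor :: "'d list \<Rightarrow> 'd list \<Rightarrow> complex" where
  "factor is js = partials (map Unbar (tl is) @ map Bar (tl js)) (G (hd is) (hd js)) z"

text \<open>Derivatives commute, so the tails of both lists may be permuted, and the Kaehler
  condition exchanges the index of the metric with a derivative of the same type. By
  \<open>mset_invariant\<close> these moves generate all permutations.\<close>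

lemma factor_perm:
  assumes "mset is = mset is'" "mset js = mset js'"
  shows "factor is js = factor is' js'"
proof -
  have unbar: "factor (x # y # zs) js =
      partials (map Unbar zs @ map Bar (tl js)) (wirtinger (Unbar y) (G x (hd js))) z" for x y zs js
  proof -
    have "factor (x # y # zs) js = partials ((map Unbar zs @ map Bar (tl js)) @ [Unbar y]) (G x (hd js)) z"
      unfolding factor_def list.sel by (rule partials_perm[OF open_S smooth_G z]) simp
    then show ?thesis unfolding partials_append by (simp add: partials_Cons)
  qed
  have bar: "factor is (x # y # zs) =
      partials (map Unbar (tl is) @ map Bar zs) (wirtinger (Bar y) (G (hd is) x)) z" for x y zs "is"
  proof -
    have "factor is (x # y # zs) = partials ((map Unbar (tl is) @ map Bar zs) @ [Bar y]) (G (hd is) x) z"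
      unfolding factor_def list.sel by (rule partials_perm[OF open_S smooth_G z]) simp
    then show ?thesis unfolding partials_append by (simp add: partials_Cons)
  qed
  note cong = partials_cong[OF open_S z smooth_on_wirtinger[OF open_S smooth_G]]
  have "factor is js = factor is' js"
  proof (rule mset_invariant[of "\<lambda>is. factor is js", OF _ _ assms(1)])
    show "factor (x # xs) js = factor (x # ys) js" if "mset xs = mset ys" for x xs ys
      unfolding factor_def list.sel by (rule partials_perm[OF open_S smooth_G z]) (simp add: that)
    show "factor (x # y # zs) js = factor (y # x # zs) js" for x y zs
      unfolding unbar by (rule cong[OF closed_unbar])
  qed
  also have "\<dots> = factor is' js'"
  proof (rule mset_invariant[of "factor is'", OF _ _ assms(2)])
    show "factor is' (x # xs) = factor is' (x # ys)" if "mset xs = mset ys" for x xs ys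
      unfolding factor_def list.sel by (rule partials_perm[OF open_S smooth_G z]) (simp add: that)
    show "factor is' (x # y # zs) = factor is' (y # x # zs)" for x y zs
      unfolding bar by (rule cong[OF closed_bar])
  qed
  finally show ?thesis .
qed

definition block_value :: "(nat \<Rightarrow> 'd) \<Rightarrow> nat set \<times> nat set \<Rightarrow> complex" where
  "block_value \<iota> b = factor (map \<iota> (sorted_list_of_set (fst b))) (map \<iota> (sorted_list_of_set (snd b)))"

definition leaf_value :: "(complex^'d \<Rightarrow> complex) \<Rightarrow> (nat set \<times> nat set) list \<Rightarrow> (nat \<Rightarrow> 'd) \<Rightarrow> complex" where
  "leaf_value f bs \<iota> = prod_list (map (block_value \<iota>) (butlast bs)) * set_partials \<iota> (fst (last bs)) (snd (last bs)) f z"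

lemma leaf_value_Cons: "bs \<noteq> [] \<Longrightarrow> leaf_value f (b # bs) \<iota> = block_value \<iota> b * leaf_value f bs \<iota>"
  by (simp add: leaf_value_def)

text \<open>In the sorted lists the edges \<open>a\<close> and \<open>b\<close> need not come first;
  the symmetry of \<open>factor\<close> lets them serve as the indices of the metric, with
  \<open>X\<close> and \<open>Y\<close> as derivatives.\<close>

lemma block_value_insert:
  assumes "finite X" "finite Y" "a \<notin> X" "b \<notin> Y"
  shows "block_value \<iota> (insert a X, insert b Y) = set_partials \<iota> X Y (G (\<iota> a) (\<iota> b)) z"
proof -
  have "block_value \<iota> (insert a X, insert b Y) =
    factor (\<iota> a # map \<iota> (sorted_list_of_set X)) (\<iota> b # map \<iota> (sorted_list_of_set Y))"
    unfolding block_value_def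
  proof (rule factor_perm)
    show "mset (map \<iota> (sorted_list_of_set (fst (insert a X, insert b Y)))) = mset (\<iota> a # map \<iota> (sorted_list_of_set X))"
      "mset (map \<iota> (sorted_list_of_set (snd (insert a X, insert b Y)))) = mset (\<iota> b # map \<iota> (sorted_list_of_set Y))"
      using assms by (simp_all add: mset_sorted_list del: sorted_list_of_set_insert_remove)
  qed
  then show ?thesis by (simp add: factor_def set_partials_def)
qed

text \<open>Half of the contraction with the inverse metric \<open>H\<close>. Multiplication by the metric gives back the
  complex Hessian, which yields a recursion for the derivatives of \<open>potential\<close> at the center in which
  the derivatives of \<open>H\<close> do not occur.\<close>

definition potential :: "(complex^'d \<Rightarrow> complex) \<Rightarrow> 'd \<Rightarrow> 'd \<Rightarrow> complex^'d \<Rightarrow> complex" where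
  "potential u i c = (\<lambda>w. \<Sum>j\<in>UNIV. H j c w * partials [Unbar i, Bar j] u w)"

lemma smooth_potential: "smooth_on S u \<Longrightarrow> smooth_on S (potential u i c)"
  unfolding potential_def by (intro smooth_on_sum smooth_on_mult smooth_H smooth_on_partials open_S)

lemma metric_potential:
  assumes "w \<in> S"
  shows "(\<Sum>l\<in>UNIV. G l c w * potential u i l w) = wirtinger (Unbar i) (wirtinger (Bar c) u) w"
proof -
  have "(\<Sum>l\<in>UNIV. G l c w * potential u i l w) =
    (\<Sum>l\<in>UNIV. \<Sum>j\<in>UNIV. (H j l w * G l c w) * partials [Unbar i, Bar j] u w)"
    by (simp add: potential_def sum_distrib_left algebra_simps)
  also have "\<dots> = (\<Sum>j\<in>UNIV. (\<Sum>l\<in>UNIV. H j l w * G l c w) * partials [Unbar i, Bar j] u w)"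
    by (subst sum.swap) (simp add: sum_distrib_right)
  also have "\<dots> = partials [Unbar i, Bar c] u w"
    unfolding inverse[OF assms] by (simp add: if_distrib[of "\<lambda>x. x * _"] cong: if_cong)
  finally show ?thesis by (simp add: partials_Cons)
qed

lemma pure_set_partials:
  assumes "finite X" "finite Y" "X = {} \<or> Y = {}" "X \<noteq> {} \<or> Y \<noteq> {}" "card X \<le> N" "card Y \<le> N"
  shows "set_partials \<iota> X Y (G i j) z = 0"
proof (cases "X = {}")
  case True
  then have "1 \<le> length (map \<iota> (sorted_list_of_set Y))" using assms by (simp add: Suc_le_eq card_gt_0_iff)
  then show ?thesis using pure_bar[of "map \<iota> (sorted_list_of_set Y)"] True assms by (simp add: set_partials_def)
next
  case False
  then have "1 \<le> length (map \<iota> (sorted_list_of_set X))" using assms by (simp add: Suc_le_eq card_gt_0_iff)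
  then show ?thesis using pure_unbar[of "map \<iota> (sorted_list_of_set X)"] False assms by (simp add: set_partials_def)
qed

text \<open>The derivatives \<open>A\<close> and \<open>B\<close> are applied to
  \<open>metric_potential\<close>. The Leibniz term with \<open>X\<close> and \<open>Y\<close> empty
  contains the metric itself, the identity at the center, and is the left-hand side. Terms with just
  one of them empty are pure derivatives of the metric and vanish; the others change sides.\<close>

lemma set_partials_potential:
  assumes "smooth_on S u" "finite A" "finite B" "a \<notin> A" "p \<notin> B" "card A \<le> N" "card B \<le> N"
  shows "set_partials \<iota> A B (potential u (\<iota> a) (\<iota> p)) z =
    set_partials \<iota> (insert a A) (insert p B) u z -
    (\<Sum>X\<in>Pow A - {{}}. \<Sum>Y\<in>Pow B - {{}}. \<Sum>l\<in>UNIV.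
       set_partials \<iota> X Y (G l (\<iota> p)) z * set_partials \<iota> (A - X) (B - Y) (potential u (\<iota> a) l) z)"
proof -
  let ?P = "potential u (\<iota> a)"
  let ?T = "\<lambda>X Y. \<Sum>l\<in>UNIV. set_partials \<iota> X Y (G l (\<iota> p)) z * set_partials \<iota> (A - X) (B - Y) (?P l) z"
  have sGP: "smooth_on S (\<lambda>w. G l (\<iota> p) w * ?P l w)" for l
    by (intro smooth_on_mult smooth_G smooth_potential assms open_S)
  have "set_partials \<iota> (insert a A) (insert p B) u z = set_partials \<iota> A B (wirtinger (Unbar (\<iota> a)) (wirtinger (Bar (\<iota> p)) u)) z"
  proof -
    note sm = smooth_on_wirtinger[OF open_S]
    have "set_partials \<iota> (insert a A) (insert p B) u z = set_partials \<iota> (insert a A) B (wirtinger (Bar (\<iota> p)) u) z"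
      using assms by (intro set_partials_insert_bar[OF open_S] z) auto
    also have "\<dots> = set_partials \<iota> A B (wirtinger (Unbar (\<iota> a)) (wirtinger (Bar (\<iota> p)) u)) z"
      using assms by (intro set_partials_insert_unbar[OF open_S] z sm) auto
    finally show ?thesis .
  qed
  also have "\<dots> = set_partials \<iota> A B (\<lambda>w. \<Sum>l\<in>UNIV. G l (\<iota> p) w * ?P l w) z"
    by (rule set_partials_cong[OF open_S z, symmetric])
      (use sGP open_S in \<open>auto simp: metric_potential intro!: smooth_on_sum\<close>)
  also have "\<dots> = (\<Sum>l\<in>UNIV. set_partials \<iota> A B (\<lambda>w. G l (\<iota> p) w * ?P l w) z)"
    by (intro set_partials_sum[OF open_S z] sGP) simp
  also have "\<dots> = (\<Sum>l\<in>UNIV. \<Sum>X\<in>Pow A. \<Sum>Y\<in>Pow B. set_partials \<iota> X Y (G l (\<iota> p)) z * set_partials \<iota> (A - X) (B - Y) (?P l) z)"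
    by (intro sum.cong refl set_partials_mult[OF open_S assms(2,3) smooth_G smooth_potential[OF assms(1)] z])
  also have "\<dots> = (\<Sum>X\<in>Pow A. \<Sum>l\<in>UNIV. \<Sum>Y\<in>Pow B. set_partials \<iota> X Y (G l (\<iota> p)) z * set_partials \<iota> (A - X) (B - Y) (?P l) z)"
    by (rule sum.swap)
  also have "\<dots> = (\<Sum>X\<in>Pow A. \<Sum>Y\<in>Pow B. ?T X Y)"
    by (intro sum.cong refl sum.swap)
  also have "\<dots> = ?T {} {} + (\<Sum>X\<in>Pow A - {{}}. \<Sum>Y\<in>Pow B - {{}}. ?T X Y)"
  proof -
    have pure: "?T X Y = 0" if "X \<subseteq> A" "Y \<subseteq> B" "X = {} \<or> Y = {}" "X \<noteq> {} \<or> Y \<noteq> {}" for X Y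
    proof -
      have "finite X" "finite Y" "card X \<le> N" "card Y \<le> N"
        using that assms card_mono[of A X] card_mono[of B Y] finite_subset[of X A] finite_subset[of Y B] by auto
      then have "set_partials \<iota> X Y (G l (\<iota> p)) z = 0" for l using pure_set_partials that(3,4) by blast
      then show ?thesis by simp
    qed
    have s: "(\<Sum>Y\<in>Pow B. F Y) = F {} + (\<Sum>Y\<in>Pow B - {{}}. F Y)" if "finite B" for F :: "nat set \<Rightarrow> complex" and B
      using that by (subst sum.remove[of "Pow B" "{}"]) auto
    have "(\<Sum>X\<in>Pow A. \<Sum>Y\<in>Pow B. ?T X Y) = (\<Sum>Y\<in>Pow B. ?T {} Y) + (\<Sum>X\<in>Pow A - {{}}. \<Sum>Y\<in>Pow B. ?T X Y)"
      by (rule s[OF assms(2)])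
    also have "(\<Sum>Y\<in>Pow B. ?T {} Y) = ?T {} {}"
      unfolding s[OF assms(3), of "?T {}"] using pure[of "{}"] by (simp add: sum.neutral)
    also have "(\<Sum>X\<in>Pow A - {{}}. \<Sum>Y\<in>Pow B. ?T X Y) = (\<Sum>X\<in>Pow A - {{}}. \<Sum>Y\<in>Pow B - {{}}. ?T X Y)"
    proof (rule sum.cong[OF refl])
      fix X assume "X \<in> Pow A - {{}}"
      then show "(\<Sum>Y\<in>Pow B. ?T X Y) = (\<Sum>Y\<in>Pow B - {{}}. ?T X Y)"
        unfolding s[OF assms(3), of "?T X"] using pure[of X "{}"] by auto
    qed
    finally show ?thesis .
  qed
  also have "?T {} {} = set_partials \<iota> A B (?P (\<iota> p)) z"
    by (simp add: set_partials_empty[OF open_S] G_center if_distrib[of "\<lambda>x. x * _"] cong: if_cong)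
  finally show ?thesis by simp
qed

lemma block_value_cong:
  assumes "finite (fst b)" "finite (snd b)" "\<And>x. x \<in> fst b \<union> snd b \<Longrightarrow> \<iota> x = \<iota>' x"
  shows "block_value \<iota> b = block_value \<iota>' b"
proof -
  have "map \<iota> (sorted_list_of_set (fst b)) = map \<iota>' (sorted_list_of_set (fst b))"
    "map \<iota> (sorted_list_of_set (snd b)) = map \<iota>' (sorted_list_of_set (snd b))"
    using assms by auto
  then show ?thesis by (simp only: block_value_def)
qed

section \<open>The expansion as a signed sum over leaves\<close>

definition signed_sum :: "(complex^'d \<Rightarrow> complex) \<Rightarrow> nat list \<times> (nat set \<times> nat set) list \<Rightarrow> (nat \<Rightarrow> 'd) \<Rightarrow> complex" where
  "signed_sum f l \<iota> = (-1) ^ (length (snd l) - 1) * index_sum (fst l) (leaf_value f (snd l)) \<iota>"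

text \<open>The value of the path edge \<open>p\<close> is fixed by \<iota>, hence the sum over
  \<open>tl es\<close> only. The induction is on \<open>card A\<close>, since every vertex entered
  absorbs a nonempty \<open>X\<close>. The hypothesis on \<open>u\<close> allows one derivative more
  than the conclusion, because finishing the path adds \<open>a\<close> to \<open>A\<close> and
  \<open>p\<close> to \<open>B\<close>.\<close>

lemma open_tree:
  assumes u: "smooth_on S u"
    and closed: "\<And>p A B \<iota>. A \<subseteq> {..<p} \<Longrightarrow> B \<subseteq> {..<p} \<Longrightarrow> card A \<le> M + 1 \<Longrightarrow> card B \<le> M + 1 \<Longrightarrow>
      finite (closed_leaves k p A B) \<and>
      set_partials \<iota> A B u z = (\<Sum>l\<in>closed_leaves k p A B. signed_sum f l \<iota>)"
    and M: "M \<le> N"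
  shows "A \<subseteq> {..<p} \<Longrightarrow> B \<subseteq> {..<p} \<Longrightarrow> card A \<le> M \<Longrightarrow> card B \<le> M \<Longrightarrow> a \<le> p \<Longrightarrow> a \<notin> A \<Longrightarrow>
      finite (open_leaves k a p A B) \<and>
      set_partials \<iota> A B (potential u (\<iota> a) (\<iota> p)) z =
        (\<Sum>(es, bs)\<in>open_leaves k a p A B. signed_sum f (tl es, bs) \<iota>)"
proof (induction "card A" arbitrary: A B p \<iota> rule: less_induct)
  case less
  note prems = less.prems
  have fin: "finite A" "finite B" using prems(1,2) finite_subset by auto
  have p: "p \<notin> A" "p \<notin> B" "Suc p \<notin> A" "Suc p \<notin> B" using prems(1,2) by auto
  have C: "finite (closed_leaves k (Suc p) (insert a A) (insert p B)) \<and>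
      set_partials \<iota> (insert a A) (insert p B) u z = (\<Sum>l\<in>closed_leaves k (Suc p) (insert a A) (insert p B). signed_sum f l \<iota>)"
    using prems fin p by (intro closed) (auto simp: less_Suc_eq)
  have O: "finite (open_leaves k a (Suc p) (A - X) (B - Y)) \<and>
      set_partials \<iota>' (A - X) (B - Y) (potential u (\<iota>' a) (\<iota>' (Suc p))) z =
        (\<Sum>(es, bs)\<in>open_leaves k a (Suc p) (A - X) (B - Y). signed_sum f (tl es, bs) \<iota>')"
    if "X \<subseteq> A" "X \<noteq> {}" for X Y \<iota>'
  proof (rule less.hyps)
    show "card (A - X) < card A" using that fin by (intro psubset_card_mono) auto
    show "card (A - X) \<le> M" "card (B - Y) \<le> M"
      using prems(3,4) card_mono[OF fin(1), of "A - X"] card_mono[OF fin(2), of "B - Y"] by auto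
  qed (use prems in \<open>auto simp: less_Suc_eq\<close>)
  \<comment> \<open>The summation index \<open>l\<close> of the Leibniz formula becomes the value of
    the new edge \<open>Suc p\<close>, and the additional block accounts for the sign.\<close>
  have vertex_term: "(\<Sum>l\<in>UNIV. set_partials \<iota> X Y (G l (\<iota> p)) z * set_partials \<iota> (A - X) (B - Y) (potential u (\<iota> a) l) z) =
      - (\<Sum>(es, bs)\<in>open_leaves k a (Suc p) (A - X) (B - Y). signed_sum f (es, (insert (Suc p) X, insert p Y) # bs) \<iota>)"
    if XY: "X \<in> Pow A - {{}}" "Y \<in> Pow B - {{}}" for X Y
  proof -
    let ?b = "(insert (Suc p) X, insert p Y)"
    have f: "finite X" "finite Y" "Suc p \<notin> X" "p \<notin> Y" "p \<notin> X" "Suc p \<notin> Y" using XY fin p finite_subset by blast+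
    have l: "set_partials \<iota> X Y (G l (\<iota> p)) z * set_partials \<iota> (A - X) (B - Y) (potential u (\<iota> a) l) z =
        (\<Sum>(es, bs)\<in>open_leaves k a (Suc p) (A - X) (B - Y). - ((-1) ^ length bs * index_sum (tl es) (leaf_value f (?b # bs)) (\<iota>(Suc p := l))))" for l
    proof -
      let ?\<iota> = "\<iota>(Suc p := l)"
      have 1: "set_partials \<iota> X Y (G l (\<iota> p)) z = block_value ?\<iota> ?b"
      proof -
        have "block_value ?\<iota> ?b = set_partials ?\<iota> X Y (G l (\<iota> p)) z"
          using block_value_insert[OF f(1-4), of ?\<iota>] by simp
        also have "\<dots> = set_partials \<iota> X Y (G l (\<iota> p)) z"
          using f by (intro set_partials_cong_index) auto
        finally show ?thesis ..
      qed
      have 2: "set_partials \<iota> (A - X) (B - Y) (potential u (\<iota> a) l) z =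
        (\<Sum>(es, bs)\<in>open_leaves k a (Suc p) (A - X) (B - Y). signed_sum f (tl es, bs) ?\<iota>)"
      proof -
        have "set_partials \<iota> (A - X) (B - Y) (potential u (\<iota> a) l) z = set_partials ?\<iota> (A - X) (B - Y) (potential u (?\<iota> a) (?\<iota> (Suc p))) z"
          using fin p prems(5) by (subst set_partials_cong_index[of _ _ ?\<iota> \<iota>]) auto
        then show ?thesis using O[of X Y ?\<iota>] XY by auto
      qed
      show ?thesis unfolding 1 2 sum_distrib_left
      proof (intro sum.cong refl, clarify)
        fix es bs assume "(es, bs) \<in> open_leaves k a (Suc p) (A - X) (B - Y)"
        then have e: "es = [Suc p..<Suc p + length es]" "es \<noteq> []" "bs \<noteq> []"
          using leaf_edges(2) unfolding open_leaves_def by blast+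
        have tl: "x > Suc p" if "x \<in> set (tl es)" for x
        proof -
          have "tl es = [Suc (Suc p)..<Suc p + length es]" using e(1) by (metis tl_upt)
          then have "x \<in> set [Suc (Suc p)..<Suc p + length es]" using that by simp
          then show ?thesis by auto
        qed
        have "index_sum (tl es) (\<lambda>\<iota>. block_value \<iota> ?b * leaf_value f bs \<iota>) ?\<iota> = block_value ?\<iota> ?b * index_sum (tl es) (leaf_value f bs) ?\<iota>"
        proof (rule index_sum_factor)
          fix \<iota>' assume \<iota>': "\<forall>x. x \<notin> set (tl es) \<longrightarrow> \<iota>' x = ?\<iota> x"
          have "x \<notin> set (tl es)" if "x \<in> fst ?b \<union> snd ?b" for x
          proof -
            have "x \<le> Suc p" using that XY prems(1,2) by (auto dest!: subsetD)
            then show ?thesis using tl by fastforce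
          qed
          then show "block_value \<iota>' ?b = block_value ?\<iota> ?b"
            using \<iota>' f(1,2) by (intro block_value_cong) auto
        qed
        moreover have lv: "leaf_value f (?b # bs) = (\<lambda>\<iota>. block_value \<iota> ?b * leaf_value f bs \<iota>)"
          using leaf_value_Cons[OF e(3)] by (intro ext)
        moreover have "(-1) ^ length bs = - ((-1 :: complex) ^ (length bs - 1))" using e(3) by (cases bs) auto
        ultimately show "block_value ?\<iota> ?b * signed_sum f (tl es, bs) ?\<iota> = - ((-1) ^ length bs * index_sum (tl es) (leaf_value f (?b # bs)) ?\<iota>)"
          unfolding lv by (simp add: signed_sum_def)
      qed
    qed
    have "(\<Sum>l\<in>UNIV. set_partials \<iota> X Y (G l (\<iota> p)) z * set_partials \<iota> (A - X) (B - Y) (potential u (\<iota> a) l) z) =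
      (\<Sum>(es, bs)\<in>open_leaves k a (Suc p) (A - X) (B - Y). \<Sum>l\<in>UNIV. - ((-1) ^ length bs * index_sum (tl es) (leaf_value f (?b # bs)) (\<iota>(Suc p := l))))"
      unfolding l case_prod_unfold by (rule sum.swap)
    also have "\<dots> = (\<Sum>(es, bs)\<in>open_leaves k a (Suc p) (A - X) (B - Y). - signed_sum f (es, ?b # bs) \<iota>)"
    proof (intro sum.cong refl, clarify)
      fix es bs assume "(es, bs) \<in> open_leaves k a (Suc p) (A - X) (B - Y)"
      then have e: "es = [Suc p..<Suc p + length es]" "es \<noteq> []" using leaf_edges(2) unfolding open_leaves_def by blast+
      have es: "es = Suc p # tl es" using Cons_eq_upt_length(1)[of "hd es" "tl es" "Suc p"] e by (metis list.collapse)
      have "signed_sum f (es, ?b # bs) \<iota> = (-1) ^ length bs * index_sum (Suc p # tl es) (leaf_value f (?b # bs)) \<iota>"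
        unfolding signed_sum_def fst_conv snd_conv using es by simp
      then show "(\<Sum>l\<in>UNIV. - ((-1) ^ length bs * index_sum (tl es) (leaf_value f (?b # bs)) (\<iota>(Suc p := l)))) = - signed_sum f (es, ?b # bs) \<iota>"
        by (simp add: sum_negf sum_distrib_left)
    qed
    finally show ?thesis by (simp add: case_prod_unfold sum_negf)
  qed
  have "set_partials \<iota> A B (potential u (\<iota> a) (\<iota> p)) z =
    set_partials \<iota> (insert a A) (insert p B) u z -
    (\<Sum>X\<in>Pow A - {{}}. \<Sum>Y\<in>Pow B - {{}}. \<Sum>l\<in>UNIV.
       set_partials \<iota> X Y (G l (\<iota> p)) z * set_partials \<iota> (A - X) (B - Y) (potential u (\<iota> a) l) z)"
    using fin p prems M by (intro set_partials_potential u) auto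
  also have "\<dots> = (\<Sum>(es, bs)\<in>closed_leaves k (Suc p) (insert a A) (insert p B). signed_sum f (tl (p # es), bs) \<iota>) +
    (\<Sum>X\<in>Pow A - {{}}. \<Sum>Y\<in>Pow B - {{}}. \<Sum>(es, bs)\<in>open_leaves k a (Suc p) (A - X) (B - Y).
       signed_sum f (tl (p # es), (insert (Suc p) X, insert p Y) # bs) \<iota>)"
    using C vertex_term by (simp add: sum_negf)
  also have "\<dots> = (\<Sum>l\<in>open_leaves k a p A B. (\<lambda>(es, bs). signed_sum f (tl es, bs) \<iota>) l)"
    by (subst sum_open_leaves(2)[OF prems(1,2,5)]) (use C O in auto)
  finally have eq: "set_partials \<iota> A B (potential u (\<iota> a) (\<iota> p)) z =
        (\<Sum>(es, bs)\<in>open_leaves k a p A B. signed_sum f (tl es, bs) \<iota>)" .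
  have "finite (open_leaves k a p A B)"
    by (rule sum_open_leaves(1)[OF prems(1,2,5)]) (use C O in auto)
  then show ?case using eq by blast
qed

text \<open>A Laplacian is the trace of \<open>potential\<close>, so the path starts with
  \<open>a = p\<close>: both indices are that of one edge, which is summed over. Each Laplacian
  passes on at most one more derivative of each type, so the bound
  \<open>card A + k <= N + 1\<close> leaves at most \<open>N\<close> of them for the metric factors
  of the innermost one.\<close>

lemma closed_tree:
  assumes "\<And>k. smooth_on S (u k)"
    and "\<And>k w. w \<in> S \<Longrightarrow> u (Suc k) w = (\<Sum>i\<in>UNIV. \<Sum>j\<in>UNIV. H j i w * partials [Unbar i, Bar j] (u k) w)"
  shows "A \<subseteq> {..<p} \<Longrightarrow> B \<subseteq> {..<p} \<Longrightarrow> card A + k \<le> N + 1 \<Longrightarrow> card B + k \<le> N + 1 \<Longrightarrow>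
    finite (closed_leaves k p A B) \<and>
    set_partials \<iota> A B (u k) z = (\<Sum>l\<in>closed_leaves k p A B. signed_sum (u 0) l \<iota>)"
proof (induction k arbitrary: A B p \<iota>)
  case 0
  then show ?case by (simp add: closed_leaves_0 signed_sum_def leaf_value_def)
next
  case (Suc k)
  \<comment> \<open>With \<open>M + 1\<close> derivatives pending, the \<open>k\<close> remaining
    Laplacians exactly exhaust the bound \<open>N + 1\<close>.\<close>
  let ?M = "N - k"
  have k: "k \<le> N" using Suc.prems by linarith
  have p: "p \<notin> A" "p \<notin> B" and fin: "finite A" "finite B" using Suc.prems(1,2) finite_subset by auto
  have O: "finite (open_leaves k p p A B) \<and> set_partials \<iota>' A B (potential (u k) (\<iota>' p) (\<iota>' p)) z =
        (\<Sum>(es, bs)\<in>open_leaves k p p A B. signed_sum (u 0) (tl es, bs) \<iota>')" for \<iota>'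
  proof (rule open_tree[where M = ?M])
    fix q :: nat and A B :: "nat set" and \<iota> :: "nat \<Rightarrow> 'd"
    assume "A \<subseteq> {..<q}" "B \<subseteq> {..<q}" "card A \<le> ?M + 1" "card B \<le> ?M + 1"
    then show "finite (closed_leaves k q A B) \<and> set_partials \<iota> A B (u k) z = (\<Sum>l\<in>closed_leaves k q A B. signed_sum (u 0) l \<iota>)"
      using k by (intro Suc.IH) auto
  qed (use Suc.prems p assms(1) in auto)
  have "set_partials \<iota> A B (u (Suc k)) z = set_partials \<iota> A B (\<lambda>w. \<Sum>i\<in>UNIV. potential (u k) i i w) z"
    by (rule set_partials_cong[OF open_S z assms(1)]) (simp add: assms(2) potential_def)
  also have "\<dots> = (\<Sum>i\<in>UNIV. set_partials \<iota> A B (potential (u k) i i) z)"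
    by (intro set_partials_sum[OF open_S z] smooth_potential assms(1)) simp
  also have "\<dots> = (\<Sum>i\<in>UNIV. \<Sum>(es, bs)\<in>open_leaves k p p A B. signed_sum (u 0) (tl es, bs) (\<iota>(p := i)))"
  proof (rule sum.cong[OF refl])
    fix i
    have "set_partials \<iota> A B (potential (u k) i i) z = set_partials (\<iota>(p := i)) A B (potential (u k) i i) z"
      using fin p by (intro set_partials_cong_index) auto
    then show "set_partials \<iota> A B (potential (u k) i i) z = (\<Sum>(es, bs)\<in>open_leaves k p p A B. signed_sum (u 0) (tl es, bs) (\<iota>(p := i)))"
      using O[of "\<iota>(p := i)"] by simp
  qed
  also have "\<dots> = (\<Sum>(es, bs)\<in>open_leaves k p p A B. \<Sum>i\<in>UNIV. signed_sum (u 0) (tl es, bs) (\<iota>(p := i)))"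
    unfolding case_prod_unfold by (rule sum.swap)
  also have "\<dots> = (\<Sum>l\<in>closed_leaves (Suc k) p A B. signed_sum (u 0) l \<iota>)"
    unfolding closed_leaves_Suc
  proof (intro sum.cong refl, clarify)
    fix es bs assume "(es, bs) \<in> open_leaves k p p A B"
    then have e: "es = [p..<p + length es]" "es \<noteq> []" using leaf_edges(2) unfolding open_leaves_def by blast+
    have es: "es = p # tl es" using Cons_eq_upt_length(1)[of "hd es" "tl es" p] e by (metis list.collapse)
    have "signed_sum (u 0) (es, bs) \<iota> = (-1) ^ (length bs - 1) * index_sum (p # tl es) (leaf_value (u 0) bs) \<iota>"
      unfolding signed_sum_def fst_conv snd_conv using es by simp
    then show "(\<Sum>i\<in>UNIV. signed_sum (u 0) (tl es, bs) (\<iota>(p := i))) = signed_sum (u 0) (es, bs) \<iota>"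
      by (simp add: signed_sum_def sum_distrib_left)
  qed
  finally show ?case using O by (simp add: closed_leaves_Suc)
qed

section \<open>Leaves as values of graph operators\<close>

definition graph_sum :: "pgraph \<Rightarrow> (complex^'d \<Rightarrow> complex) \<Rightarrow> complex" where
  "graph_sum \<Gamma> f = (\<Sum>\<iota>\<in>arcs (fst \<Gamma>) \<rightarrow>\<^sub>E UNIV.
     (\<Prod>v\<in>ordinary \<Gamma>. factor (out_indices \<Gamma> \<iota> v) (in_indices \<Gamma> \<iota> v)) *
     partials (map Unbar (out_indices \<Gamma> \<iota> (snd \<Gamma>)) @ map Bar (in_indices \<Gamma> \<iota> (snd \<Gamma>))) f z)"

text \<open>A leaf orders the edges at a vertex by their positions in the enumeration, a graph
  operator by their names. The index lists agree as multisets, which suffices because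
  \<open>factor\<close> and iterated derivatives are symmetric.\<close>

lemma signed_sum_code:
  assumes \<Gamma>: "\<Gamma> \<in> sc_stable_graphs k" and p: "p \<in> ear_orders \<Gamma>" and f: "smooth_on S f"
  shows "signed_sum f (code \<Gamma> p) \<iota>\<^sub>0 = (-1) ^ card (ordinary \<Gamma>) * graph_sum \<Gamma> f"
proof -
  obtain es vs where p': "p = (es, vs)" by force
  have e: "distinct es" "set es = arcs (fst \<Gamma>)" "distinct vs" "set vs = ordinary \<Gamma>"
    using ear_orders_enumerates[OF p] by (auto simp: enumerates_def p')
  define n where "n = length es"
  define st where "st = star (\<lambda>i. tail (fst \<Gamma>) (es ! i)) (\<lambda>i. head (fst \<Gamma>) (es ! i)) {..<n} {..<n}"
  define bs where "bs = map st (vs @ [snd \<Gamma>])"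
  have bij: "bij_betw (nth es) {..<n} (arcs (fst \<Gamma>))" using e by (auto intro!: bij_betw_nth simp: n_def)
  define idx where "idx = inv_into {..<n} (nth es)"
  have idx: "es ! idx x = x" "idx x < n" if "x \<in> arcs (fst \<Gamma>)" for x
    using that bij_betw_inv_into_right[OF bij] bij_betwE[OF bij_betw_inv_into[OF bij]] by (auto simp: idx_def)
  have idx': "idx (es ! i) = i" if "i < n" for i
    using that bij_betw_inv_into_left[OF bij] by (simp add: idx_def)
  have inj: "inj_on (nth es) A" if "A \<subseteq> {..<n}" for A
    using bij that by (auto simp: bij_betw_def intro: inj_on_subset)
  have fin: "finite (fst (st v))" "finite (snd (st v))" for v by (simp_all add: st_def star_def)
  have sub: "fst (st v) \<subseteq> {..<n}" "snd (st v) \<subseteq> {..<n}" for v by (auto simp: st_def star_def)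
  have img: "nth es ` fst (st v) = out_arcs (fst \<Gamma>) v" "nth es ` snd (st v) = in_arcs (fst \<Gamma>) v" for v
  proof -
    have "nth es ` {i \<in> {..<n}. P (es ! i)} = {x \<in> arcs (fst \<Gamma>). P x}" for P
      unfolding bij_betw_imp_surj_on[OF bij, symmetric] by blast
    then show "nth es ` fst (st v) = out_arcs (fst \<Gamma>) v" "nth es ` snd (st v) = in_arcs (fst \<Gamma>) v"
      unfolding st_def star_def fst_conv snd_conv out_arcs_def in_arcs_def by simp_all
  qed
  have fa: "finite (out_arcs (fst \<Gamma>) v)" "finite (in_arcs (fst \<Gamma>) v)" for v
    unfolding img[symmetric] using fin by auto
  have mset: "mset (map \<kappa> (sorted_list_of_set (fst (st v)))) = mset (out_indices \<Gamma> \<iota> v)"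
    "mset (map \<kappa> (sorted_list_of_set (snd (st v)))) = mset (in_indices \<Gamma> \<iota> v)"
    if \<kappa>: "\<And>i. i < n \<Longrightarrow> \<kappa> i = \<iota> (es ! i)" for \<kappa> \<iota> :: "nat \<Rightarrow> 'd" and v
  proof -
    have m: "image_mset \<kappa> (mset_set A) = image_mset \<iota> (mset_set (nth es ` A))" if "A \<subseteq> {..<n}" "finite A" for A
      unfolding image_mset_mset_set[OF inj[OF that(1)], symmetric] multiset.map_comp
      using that \<kappa> by (intro image_mset_cong) auto
    show "mset (map \<kappa> (sorted_list_of_set (fst (st v)))) = mset (out_indices \<Gamma> \<iota> v)"
      "mset (map \<kappa> (sorted_list_of_set (snd (st v)))) = mset (in_indices \<Gamma> \<iota> v)"
      using m[OF sub(1) fin(1)] m[OF sub(2) fin(2)]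
      by (simp_all add: out_indices_def in_indices_def mset_sorted_list fin fa img)
  qed
  have leaf_val: "leaf_value f bs \<kappa> =
      (\<Prod>v\<in>ordinary \<Gamma>. factor (out_indices \<Gamma> \<iota> v) (in_indices \<Gamma> \<iota> v)) *
      partials (map Unbar (out_indices \<Gamma> \<iota> (snd \<Gamma>)) @ map Bar (in_indices \<Gamma> \<iota> (snd \<Gamma>))) f z"
    if \<kappa>: "\<And>i. i < n \<Longrightarrow> \<kappa> i = \<iota> (es ! i)" for \<kappa> \<iota>
  proof -
    have "block_value \<kappa> (st v) = factor (out_indices \<Gamma> \<iota> v) (in_indices \<Gamma> \<iota> v)" for v
      unfolding block_value_def by (rule factor_perm[OF mset[of \<kappa> \<iota>, OF \<kappa>]])
    then have "prod_list (map (block_value \<kappa>) (map st vs)) = (\<Prod>v\<in>ordinary \<Gamma>. factor (out_indices \<Gamma> \<iota> v) (in_indices \<Gamma> \<iota> v))"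
      using e(3,4) by (simp add: prod.distinct_set_conv_list[symmetric] comp_def)
    moreover have "set_partials \<kappa> (fst (st (snd \<Gamma>))) (snd (st (snd \<Gamma>))) f z =
        partials (map Unbar (out_indices \<Gamma> \<iota> (snd \<Gamma>)) @ map Bar (in_indices \<Gamma> \<iota> (snd \<Gamma>))) f z"
      unfolding set_partials_def
    proof (rule partials_perm[OF open_S f z])
      show "mset (map Unbar (map \<kappa> (sorted_list_of_set (fst (st (snd \<Gamma>))))) @ map Bar (map \<kappa> (sorted_list_of_set (snd (st (snd \<Gamma>)))))) =
        mset (map Unbar (out_indices \<Gamma> \<iota> (snd \<Gamma>)) @ map Bar (in_indices \<Gamma> \<iota> (snd \<Gamma>)))"
        using mset[of \<kappa> \<iota> "snd \<Gamma>", OF \<kappa>] by (metis mset_append mset_map)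
    qed
    ultimately show ?thesis by (simp add: leaf_value_def bs_def)
  qed
  define I :: "(nat \<Rightarrow> 'd) \<Rightarrow> nat \<Rightarrow> 'd" where "I \<iota> = restrict (\<lambda>i. \<iota> (es ! i)) {..<n}" for \<iota>
  define J :: "(nat \<Rightarrow> 'd) \<Rightarrow> nat \<Rightarrow> 'd" where "J \<kappa> = restrict (\<lambda>x. \<kappa> (idx x)) (arcs (fst \<Gamma>))" for \<kappa>
  define summand where "summand \<iota> = (\<Prod>v\<in>ordinary \<Gamma>. factor (out_indices \<Gamma> \<iota> v) (in_indices \<Gamma> \<iota> v)) *
      partials (map Unbar (out_indices \<Gamma> \<iota> (snd \<Gamma>)) @ map Bar (in_indices \<Gamma> \<iota> (snd \<Gamma>))) f z" for \<iota>
  have "index_sum [0..<n] (leaf_value f bs) \<iota>\<^sub>0 = (\<Sum>\<kappa>\<in>{..<n} \<rightarrow>\<^sub>E UNIV. leaf_value f bs (\<lambda>x. if x \<in> {..<n} then \<kappa> x else \<iota>\<^sub>0 x))"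
    by (subst index_sum_PiE) (simp_all add: atLeast0LessThan)
  also have "\<dots> = (\<Sum>\<iota>\<in>arcs (fst \<Gamma>) \<rightarrow>\<^sub>E UNIV. summand \<iota>)"
  proof (rule sum.reindex_bij_witness[where i = I and j = J])
    fix \<kappa> assume \<kappa>: "\<kappa> \<in> {..<n} \<rightarrow>\<^sub>E (UNIV :: 'd set)"
    have ar: "es ! i \<in> arcs (fst \<Gamma>)" if "i < n" for i using bij_betwE[OF bij] that by blast
    show "I (J \<kappa>) = \<kappa>"
      unfolding I_def J_def using \<kappa> ar idx' by (intro extensionalityI[of _ "{..<n}"]) (auto simp: PiE_def)
    show "J \<kappa> \<in> arcs (fst \<Gamma>) \<rightarrow>\<^sub>E UNIV" by (auto simp: J_def)
    show "summand (J \<kappa>) = leaf_value f bs (\<lambda>x. if x \<in> {..<n} then \<kappa> x else \<iota>\<^sub>0 x)"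
      unfolding summand_def by (rule leaf_val[symmetric]) (use ar idx' in \<open>auto simp: J_def\<close>)
  next
    fix \<iota> assume \<iota>: "\<iota> \<in> arcs (fst \<Gamma>) \<rightarrow>\<^sub>E (UNIV :: 'd set)"
    show "J (I \<iota>) = \<iota>"
      unfolding I_def J_def using \<iota> idx by (intro extensionalityI[of _ "arcs (fst \<Gamma>)"]) (auto simp: PiE_def)
    show "I \<iota> \<in> {..<n} \<rightarrow>\<^sub>E UNIV" by (auto simp: I_def)
  qed
  also have "\<dots> = graph_sum \<Gamma> f" unfolding graph_sum_def summand_def ..
  finally have "index_sum [0..<n] (leaf_value f bs) \<iota>\<^sub>0 = graph_sum \<Gamma> f" .
  moreover have "code \<Gamma> p = ([0..<n], bs)" by (simp add: code_def p' n_def bs_def st_def)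
  moreover have "length bs - 1 = card (ordinary \<Gamma>)" using distinct_card[OF e(3)] e(4) by (simp add: bs_def)
  ultimately show ?thesis by (simp add: signed_sum_def)
qed

lemma power_expansion:
  assumes "\<And>k. smooth_on S (u k)"
    and "\<And>k w. w \<in> S \<Longrightarrow> u (Suc k) w = (\<Sum>i\<in>UNIV. \<Sum>j\<in>UNIV. H j i w * partials [Unbar i, Bar j] (u k) w)"
    and "k \<le> N"
  shows "u k z = (\<Sum>\<C>\<in>sc_stable_classes k. let \<Gamma> = (SOME \<Gamma>. \<Gamma> \<in> \<C>) in
     of_nat (phi \<Gamma>) / of_nat (card (aut \<Gamma>)) * ((-1) ^ card (ordinary \<Gamma>) * graph_sum \<Gamma> (u 0)))"
proof -
  have "set_partials (\<lambda>_. undefined) {} {} (u k) z = (\<Sum>l\<in>closed_leaves k 0 {} {}. signed_sum (u 0) l (\<lambda>_. undefined))"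
    using closed_tree[of u "{}" 0 "{}" k "\<lambda>_. undefined", OF assms(1,2)] assms(3) by simp
  also have "closed_leaves k 0 {} {} = leaves k" by (simp add: closed_leaves_def leaves_def)
  also have "(\<Sum>l\<in>leaves k. signed_sum (u 0) l (\<lambda>_. undefined)) = (\<Sum>\<C>\<in>sc_stable_classes k. let \<Gamma> = (SOME \<Gamma>. \<Gamma> \<in> \<C>) in
     of_nat (phi \<Gamma>) / of_nat (card (aut \<Gamma>)) * ((-1) ^ card (ordinary \<Gamma>) * graph_sum \<Gamma> (u 0)))"
    by (rule sum_leaves) (rule signed_sum_code[OF _ _ assms(1)])
  finally show ?thesis by (simp add: set_partials_empty[OF open_S])
qed

end

section \<open>Passage from the manifold to a normal coordinate chart\<close>

lemma (in kahler_manifold) normal_metric_of_normal_coordinates: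
  assumes "normal_coordinates N \<A> g c x"
  shows "normal_metric (chart_map c ` chart_dom c) 0 N (metric_comp g c)
    (\<lambda>j i w. matrix_inv (g c (chart_inv c w)) $ j $ i)"
proof -
  let ?S = "chart_map c ` chart_dom c" and ?G = "metric_comp g c"
  have c: "c \<in> \<A>" and x: "x \<in> chart_dom c" "chart_map c x = 0"
    using assms by (auto simp: normal_coordinates_def)
  note S = open_chart_image[OF c]
  have herm: "?G i j w = cnj (?G j i w)" if "w \<in> ?S" for i j w
    unfolding metric_comp_def by (rule hermitian[OF c chart_inv_dom[OF that]])
  \<comment> \<open>As the metric is Hermitian, conjugation turns the Kaehler condition for unbarred
    derivatives into the one for barred derivatives.\<close>
  have bar: "wirtinger (Bar l) (?G i j) w = cnj (wirtinger (Unbar l) (?G j i) w)" if "w \<in> ?S" for l i j w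
  proof -
    have "wirtinger (Bar l) (?G i j) w = wirtinger (Bar l) (\<lambda>w. cnj (?G j i w)) w"
      by (rule wirtinger_cong[OF S that smooth[OF c] herm])
    also have "\<dots> = cnj (wirtinger (Unbar l) (?G j i) w)"
      by (rule wirtinger_cnj[OF smooth_on_differentiable[OF smooth[OF c] that]])
    finally show ?thesis .
  qed
  show ?thesis
  proof
    show "open ?S" by (rule S)
    show "0 \<in> ?S" using x by force
    show "smooth_on ?S (?G i j)" for i j by (rule smooth[OF c])
    show "smooth_on ?S (\<lambda>w. matrix_inv (g c (chart_inv c w)) $ i $ j)" for i j by (rule smooth_inverse_metric[OF c])
    show "(\<Sum>l\<in>UNIV. matrix_inv (g c (chart_inv c w)) $ j $ l * ?G l k w) = (if j = k then 1 else 0)" if "w \<in> ?S" for j k w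
    proof -
      have "(matrix_inv (g c (chart_inv c w)) ** g c (chart_inv c w)) $ j $ k = mat 1 $ j $ k"
        by (simp add: matrix_inv_inverse(2)[OF invertible_metric[OF c chart_inv_dom[OF that]]])
      then show ?thesis by (simp add: matrix_matrix_mult_def metric_comp_def mat_def)
    qed
    show "wirtinger (Unbar l) (?G i j) w = wirtinger (Unbar i) (?G l j) w" if "w \<in> ?S" for l i j w
      by (rule kahler[OF c that])
    show "wirtinger (Bar l) (?G i j) w = wirtinger (Bar j) (?G i l) w" if "w \<in> ?S" for l i j w
      unfolding bar[OF that] using kahler[OF c that] by metis
    show "?G i j 0 = (if i = j then 1 else 0)" for i j using assms by (simp add: normal_coordinates_def)
    show "partials (map Unbar ks) (?G i j) 0 = 0" "partials (map Bar ks) (?G i j) 0 = 0"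
      if "1 \<le> length ks" "length ks \<le> N" for ks i j
      using assms that by (simp_all add: normal_coordinates_def)
  qed
qed

theorem proposition2p13:
  fixes k :: nat
  shows "\<exists>N\<^sub>0. \<forall>N \<ge> N\<^sub>0.
    \<forall>(\<A> :: ('m::{t2_space, second_countable_topology}, 'd::finite) chart set) g c x f.
      kahler_manifold \<A> g \<longrightarrow> normal_coordinates N \<A> g c x \<longrightarrow> smooth_function \<A> f \<longrightarrow>
      (laplacian \<A> g ^^ k) f x =
        (\<Sum>\<C>\<in>sc_stable_classes k. let \<Gamma> = (SOME \<Gamma>. \<Gamma> \<in> \<C>) in
           (-1) ^ (card (verts (fst \<Gamma>)) - 1) * (of_nat (phi \<Gamma>) / of_nat (card (aut \<Gamma>))) *
           graph_operator g c \<Gamma> f x)"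
\<comment> \<open>With no derivatives pending at the outset, the bound
  \<open>card A + k <= N + 1\<close> of \<open>closed_tree\<close> holds for every \<open>N\<close>
  from \<open>k\<close> on.\<close>
proof (intro exI[of _ k] allI impI)
  fix N and \<A> :: "('m, 'd) chart set" and g c x f
  assume "k \<le> N" "kahler_manifold \<A> g" and nc: "normal_coordinates N \<A> g c x" and f: "smooth_function \<A> f"
  interpret kahler_manifold \<A> g by fact
  let ?S = "chart_map c ` chart_dom c"
  have c: "c \<in> \<A>" and x: "x \<in> chart_dom c" "chart_map c x = 0"
    using nc by (auto simp: normal_coordinates_def)
  interpret N: normal_metric ?S 0 N "metric_comp g c" "\<lambda>j i w. matrix_inv (g c (chart_inv c w)) $ j $ i"
    by (rule normal_metric_of_normal_coordinates[OF nc])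
  define u where "u k = (laplacian \<A> g ^^ k) f \<circ> chart_inv c" for k
  have sm: "smooth_function \<A> ((laplacian \<A> g ^^ k) f)" for k by (rule smooth_function_laplacian_funpow[OF f])
  have u: "smooth_on ?S (u k)" for k
    using sm c unfolding u_def smooth_function_def by blast
  have Suc: "u (Suc k) w = (\<Sum>i\<in>UNIV. \<Sum>j\<in>UNIV. matrix_inv (g c (chart_inv c w)) $ j $ i * partials [Unbar i, Bar j] (u k) w)"
    if "w \<in> ?S" for k w
    using laplacian_in_chart[OF c sm that] by (simp add: u_def)
  have gs: "N.graph_sum \<Gamma> (u 0) = graph_operator g c \<Gamma> f x" for \<Gamma>
    unfolding N.graph_sum_def graph_operator_def N.factor_def vertex_factor_def x(2) u_def by simp
  have "(laplacian \<A> g ^^ k) f x = u k 0"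
    using chart_inv_map[OF c x(1)] x(2) by (simp add: u_def)
  also have "\<dots> = (\<Sum>\<C>\<in>sc_stable_classes k. let \<Gamma> = (SOME \<Gamma>. \<Gamma> \<in> \<C>) in
     of_nat (phi \<Gamma>) / of_nat (card (aut \<Gamma>)) * ((-1) ^ card (ordinary \<Gamma>) * N.graph_sum \<Gamma> (u 0)))"
    by (rule N.power_expansion[of u, OF u Suc \<open>k \<le> N\<close>])
  also have "\<dots> = (\<Sum>\<C>\<in>sc_stable_classes k. let \<Gamma> = (SOME \<Gamma>. \<Gamma> \<in> \<C>) in
           (-1) ^ (card (verts (fst \<Gamma>)) - 1) * (of_nat (phi \<Gamma>) / of_nat (card (aut \<Gamma>))) *
           graph_operator g c \<Gamma> f x)"
  proof (rule sum.cong[OF refl])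
    fix \<C> assume C: "\<C> \<in> sc_stable_classes k"
    define \<Gamma> where "\<Gamma> = (SOME \<Gamma>. \<Gamma> \<in> \<C>)"
    have "pointed_graph \<Gamma>" unfolding \<Gamma>_def by (rule sc_stable_graphsD(1)[OF class_representative(2)[OF C]])
    then have "card (ordinary \<Gamma>) = card (verts (fst \<Gamma>)) - 1"
      using pointed_graphD(2,3) by (simp add: ordinary_def)
    then show "(let \<Gamma> = (SOME \<Gamma>. \<Gamma> \<in> \<C>) in
       of_nat (phi \<Gamma>) / of_nat (card (aut \<Gamma>)) * ((-1) ^ card (ordinary \<Gamma>) * N.graph_sum \<Gamma> (u 0))) =
      (let \<Gamma> = (SOME \<Gamma>. \<Gamma> \<in> \<C>) in
           (-1) ^ (card (verts (fst \<Gamma>)) - 1) * (of_nat (phi \<Gamma>) / of_nat (card (aut \<Gamma>))) *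
           graph_operator g c \<Gamma> f x)"
      unfolding \<Gamma>_def[symmetric] Let_def gs by simp
  qed
  finally show "(laplacian \<A> g ^^ k) f x = (\<Sum>\<C>\<in>sc_stable_classes k. let \<Gamma> = (SOME \<Gamma>. \<Gamma> \<in> \<C>) in
           (-1) ^ (card (verts (fst \<Gamma>)) - 1) * (of_nat (phi \<Gamma>) / of_nat (card (aut \<Gamma>))) *
           graph_operator g c \<Gamma> f x)" .
qed

end
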